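(* Let $\{v_{n}\}_{n=1}^{\infty}$ be a bounded sequence in $H^{1}(\mathbb{R}^{2})$ such that $$\limsup_{n\rightarrow \infty}\|\nabla v_{n}\|^{2}_{2} \leq M^{2}, \qquad \limsup_{n\rightarrow \infty}\int_{\mathbb{R}^2}\mathcal{L}(|v_{n}|^{2})|v_{n}|^{2}\,dx \geq m^{4},$$ for some $0<m,M<\infty$. Then there exists a sequence $\{x_{n}\}_{n=1}^{\infty} \subset \mathbb{R}^{2}$ and a function $V\in H^1(\mathbb{R}^2)$ such that, up to a subsequence, $$v_{n}(\cdot + x_{n})\rightharpoonup V \text{ weakly in } H^{1}(\mathbb{R}^{2}), \quad\text{with}\quad \|V\|_{2}\geq \frac{m^{2}}{M\sqrt{C_{opt}}}.$$
   Context: Functions are complex-valued on $\mathbb{R}^2$ and $\|\cdot\|_p$ is the $L^p(\mathbb{R}^2)$ norm. Fix $\gamma>0$ and $\nu=1$. The operator $\mathcal{L}$ is $\mathcal{L}=\nu I+\gamma\mathcal{B}$, where $I$ is the identity and $\mathcal{B}$ is the Fourier multiplier operator (bounded on $L^2(\mathbb{R}^2)$) with $\widehat{\mathcal{B}(f)}(\xi)=\frac{\xi_{1}^{2}}{\xi_{1}^{2}+\xi_{2}^{2}}\widehat{f}(\xi)$. The constant $C_{opt}>0$ (depending on $\gamma$) is the optimal, i.e. smallest, constant such that $$\int_{\mathbb{R}^2} \mathcal{L}(|u|^{2})|u|^{2}\,dx \leq C_{opt}\|\nabla u\|_{2}^{2}\|u\|_{2}^{2}\qquad\text{for all } u\in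 H^1(\mathbb{R}^2).$$ *)

theory Defs
  imports "HOL-Analysis.Analysis"
begin

text \<open>
  Elements of \<open>L\<^sup>2\<close> are represented by Borel measurable functions; every class modulo
  null sets has such a representative.  The codomain is \<open>complex\<close> for functions and
  \<open>complex^2\<close> for gradients, whose norm is the Hermitian norm.
\<close>

definition L2 :: "(real^2 \<Rightarrow> 'b::euclidean_space) set" where
  "L2 = {f. f \<in> borel_measurable lborel \<and> integrable lborel (\<lambda>x. (norm (f x))\<^sup>2)}"

definition L2_norm :: "(real^2 \<Rightarrow> 'b::euclidean_space) \<Rightarrow> real" where
  "L2_norm f = sqrt (\<integral>x. (norm (f x))\<^sup>2 \<partial>lborel)"

definition partial_deriv :: "2 \<Rightarrow> (real^2 \<Rightarrow> complex) \<Rightarrow> real^2 \<Rightarrow> complex" where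
  "partial_deriv i f x = frechet_derivative f (at x) (axis i 1)"

primrec Ck :: "nat \<Rightarrow> (real^2 \<Rightarrow> complex) \<Rightarrow> bool" where
  "Ck 0 f \<longleftrightarrow> continuous_on UNIV f"
| "Ck (Suc k) f \<longleftrightarrow> (\<forall>x. f differentiable (at x)) \<and> (\<forall>i. Ck k (partial_deriv i f))"

definition test_function :: "(real^2 \<Rightarrow> complex) \<Rightarrow> bool" where
  "test_function \<phi> \<longleftrightarrow> (\<forall>k. Ck k \<phi>) \<and> compact (closure {x. \<phi> x \<noteq> 0})"

definition has_weak_gradient :: "(real^2 \<Rightarrow> complex) \<Rightarrow> (real^2 \<Rightarrow> complex^2) \<Rightarrow> bool" where
  "has_weak_gradient u g \<longleftrightarrow>
     (\<forall>\<phi> i. test_function \<phi> \<longrightarrow>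
        (\<integral>x. u x * partial_deriv i \<phi> x \<partial>lborel) = - (\<integral>x. g x $ i * \<phi> x \<partial>lborel))"

definition H1 :: "(real^2 \<Rightarrow> complex) set" where
  "H1 = {u \<in> L2. \<exists>g\<in>L2. has_weak_gradient u g}"

text \<open>
  For \<open>u \<in> H1\<close> the choice is unique up to a null set, and only integrals of the gradient
  are used below.
\<close>

definition weak_gradient :: "(real^2 \<Rightarrow> complex) \<Rightarrow> real^2 \<Rightarrow> complex^2" where
  "weak_gradient u = (SOME g. g \<in> L2 \<and> has_weak_gradient u g)"

definition H1_norm :: "(real^2 \<Rightarrow> complex) \<Rightarrow> real" where
  "H1_norm u = sqrt ((L2_norm u)\<^sup>2 + (L2_norm (weak_gradient u))\<^sup>2)"

definition H1_inner :: "(real^2 \<Rightarrow> complex) \<Rightarrow> (real^2 \<Rightarrow> complex) \<Rightarrow> complex" where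
  "H1_inner u w =
     (\<integral>x. u x * cnj (w x) + (\<Sum>i\<in>UNIV. weak_gradient u x $ i * cnj (weak_gradient w x $ i)) \<partial>lborel)"

definition H1_weakly_converges :: "(nat \<Rightarrow> real^2 \<Rightarrow> complex) \<Rightarrow> (real^2 \<Rightarrow> complex) \<Rightarrow> bool" where
  "H1_weakly_converges u V \<longleftrightarrow>
     (\<forall>n. u n \<in> H1) \<and> V \<in> H1 \<and>
     (\<forall>w\<in>H1. (\<lambda>n. H1_inner (u n) w) \<longlonglongrightarrow> H1_inner V w)"

definition fourier_integral :: "(real^2 \<Rightarrow> complex) \<Rightarrow> real^2 \<Rightarrow> complex" where
  "fourier_integral f \<xi> = (\<integral>x. cis (- 2 * pi * (\<xi> \<bullet> x)) * f x \<partial>lborel)"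

text \<open>
  \<open>F\<close> is the Fourier--Plancherel transform of \<open>f\<close>: the limit in \<open>L\<^sup>2\<close> of the Fourier
  integrals of the truncations of \<open>f\<close> to balls, which are in \<open>L\<^sup>1\<close>.
\<close>

definition has_L2_fourier :: "(real^2 \<Rightarrow> complex) \<Rightarrow> (real^2 \<Rightarrow> complex) \<Rightarrow> bool" where
  "has_L2_fourier f F \<longleftrightarrow>
     f \<in> L2 \<and> F \<in> L2 \<and>
     ((\<lambda>R::real. \<integral>\<^sup>+\<xi>. ennreal ((cmod (F \<xi> -
          fourier_integral (\<lambda>x. indicator (ball 0 R) x * f x) \<xi>))\<^sup>2) \<partial>lborel)
        \<longlongrightarrow> 0) at_top"

text \<open>The result of a multiplier operator is determined up to a null set.\<close>

definition fourier_multiplier ::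
    "(real^2 \<Rightarrow> complex) \<Rightarrow> (real^2 \<Rightarrow> complex) \<Rightarrow> real^2 \<Rightarrow> complex" where
  "fourier_multiplier \<sigma> f =
     (SOME h. \<exists>F. has_L2_fourier f F \<and> has_L2_fourier h (\<lambda>\<xi>. \<sigma> \<xi> * F \<xi>))"

text \<open>
  The symbol is homogeneous of degree zero, so the operator does not depend on the
  normalisation of the Fourier transform.
\<close>

definition opB :: "(real^2 \<Rightarrow> complex) \<Rightarrow> real^2 \<Rightarrow> complex" where
  "opB = fourier_multiplier (\<lambda>\<xi>. of_real ((\<xi> $ 1)\<^sup>2 / ((\<xi> $ 1)\<^sup>2 + (\<xi> $ 2)\<^sup>2)))"

definition opL :: "real \<Rightarrow> real \<Rightarrow> (real^2 \<Rightarrow> complex) \<Rightarrow> real^2 \<Rightarrow> complex" where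
  "opL \<nu> \<gamma> f x = of_real \<nu> * f x + of_real \<gamma> * opB f x"

text \<open>
  The integral is real, since the symbol of \<open>opB\<close> is real and even; \<open>Re\<close> only changes its
  type.
\<close>

definition quartic :: "real \<Rightarrow> (real^2 \<Rightarrow> complex) \<Rightarrow> real" where
  "quartic \<gamma> u =
     Re (\<integral>x. opL 1 \<gamma> (\<lambda>y. of_real ((cmod (u y))\<^sup>2)) x * of_real ((cmod (u x))\<^sup>2) \<partial>lborel)"

definition C_opt :: "real \<Rightarrow> real" where
  "C_opt \<gamma> =
     (LEAST C. \<forall>u\<in>H1. quartic \<gamma> u \<le> C * (L2_norm (weak_gradient u))\<^sup>2 * (L2_norm u)\<^sup>2)"

end

theory Submission
  imports Defs "HOL-Probability.Characteristic_Functions" "HOL-Library.Diagonal_Subsequence"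
begin

text \<open>
  Fix translations, a subsequence and a weak limit \<open>U\<close> of the translated functions, and
  subtract \<open>U\<close>. Because the remainder tends weakly to zero, \<open>\<parallel>u\<parallel>\<^sup>2\<close>, \<open>\<parallel>\<nabla>u\<parallel>\<^sup>2\<close> and the quartic
  functional all split in the limit into the value of \<open>U\<close> plus the value of the remainder
  (\<open>norm_splitting\<close>, \<open>quartic_splitting\<close>, \<open>extract_profile\<close>). Each weak limit of translates
  of the remainder that does not vanish almost everywhere is again one of the original
  sequence (\<open>weak_limits_remainder\<close>). So the extraction can be repeated. A sequence whose
  quartic functional stays above \<open>\<epsilon>\<close> has a weak limit of translates whose norm is bounded
  below in terms of \<open>\<epsilon>\<close> and the \<open>H\<^sup>1\<close> bound alone (\<open>non_vanishing\<close>). The mass is finite,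
  hence after finitely many extractions the quartic functional of the remainder is at most
  \<open>\<epsilon>\<close>.

  Suppose that all these weak limits have norm less than \<open>b = m\<^sup>2 / (M * sqrt C)\<close>, where \<open>C\<close>
  is the optimal constant. An extracted profile \<open>U\<close> lowers the quartic functional by at most
  \<open>C \<parallel>\<nabla>U\<parallel>\<^sup>2 \<parallel>U\<parallel>\<^sup>2 \<le> C b\<^sup>2 \<parallel>\<nabla>U\<parallel>\<^sup>2\<close>, and the gradient energies of the profiles add up to at
  most \<open>M\<^sup>2\<close>. So the limit of the quartic functional is at most \<open>C b\<^sup>2 M\<^sup>2 = m\<^sup>4\<close>
  (\<open>quartic_limit_le\<close>). The first profile is not zero and its norm is strictly less than \<open>b\<close>,
  which makes this inequality strict and contradicts the hypothesis (\<open>large_profile\<close>).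

  The analysis takes place on the Fourier side. Plancherel's theorem and the inversion of the
  transform on \<open>L\<^sup>2\<close> come from Gaussian regularisation. They show that the multiplier
  operator is well defined, and that the quartic functional is a bounded quadratic form in
  \<open>\<bar>u\<bar>\<^sup>2\<close>, invariant under translations and bounded below by \<open>\<parallel>u\<parallel>\<^sub>4\<^sup>4\<close>. Testing the weak
  gradient against bump functions identifies \<open>H\<^sup>1\<close> with a weighted \<open>L\<^sup>2\<close> space, so weak
  compactness in \<open>H\<^sup>1\<close> reduces to \<open>L\<^sup>2\<close>. Compactness comes from cutting a function at a
  frequency \<open>A\<close>: the low part is, at every point, an inner product with a fixed \<open>L\<^sup>2\<close>
  function, so it converges pointwise under weak convergence, and the high part is small in
  \<open>L\<^sup>4\<close> uniformly over bounded sets of \<open>H\<^sup>1\<close>.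
\<close>

section \<open>Square-integrable functions\<close>

lemma L2_iff: "f \<in> L2 \<longleftrightarrow> f \<in> borel_measurable borel \<and> integrable lborel (\<lambda>x. (norm (f x))\<^sup>2)"
  by (simp add: L2_def)

lemma L2_measurable [measurable_dest]: "f \<in> L2 \<Longrightarrow> f \<in> borel_measurable borel"
  by (simp add: L2_iff)

lemma L2_integrable: "f \<in> L2 \<Longrightarrow> integrable lborel (\<lambda>x. (norm (f x))\<^sup>2)"
  by (simp add: L2_iff)

lemma L2_norm_sq: "(L2_norm f)\<^sup>2 = (\<integral>x. (norm (f x))\<^sup>2 \<partial>lborel)"
  by (simp add: L2_norm_def)

lemma L2_norm_nonneg [simp]: "0 \<le> L2_norm f"
  by (simp add: L2_norm_def)

lemma L2_bound:
  fixes f :: "real^2 \<Rightarrow> 'a::euclidean_space" and g :: "real^2 \<Rightarrow> 'b::euclidean_space"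
  assumes "f \<in> L2" "g \<in> borel_measurable borel" "\<And>x. norm (g x) \<le> C * norm (f x)"
  shows "g \<in> L2"
proof -
  have [measurable]: "f \<in> borel_measurable borel" "g \<in> borel_measurable borel" using assms by auto
  have "integrable lborel (\<lambda>x. (norm (g x))\<^sup>2)"
  proof (rule Bochner_Integration.integrable_bound)
    show "integrable lborel (\<lambda>x. C\<^sup>2 * (norm (f x))\<^sup>2)" using L2_integrable[OF assms(1)] by simp
    show "AE x in lborel. norm ((norm (g x))\<^sup>2) \<le> norm (C\<^sup>2 * (norm (f x))\<^sup>2)"
      using assms(3) by (auto simp: power_mult_distrib[symmetric] intro!: AE_I2 power_mono)
  qed auto
  then show ?thesis using assms by (simp add: L2_iff)
qed

lemma L2_zero [simp]: "(\<lambda>x. 0) \<in> L2"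
  by (simp add: L2_iff)

lemma L2_add [intro]:
  fixes f g :: "real^2 \<Rightarrow> 'b::euclidean_space"
  assumes "f \<in> L2" "g \<in> L2" shows "(\<lambda>x. f x + g x) \<in> L2"
proof -
  have [measurable]: "f \<in> borel_measurable borel" "g \<in> borel_measurable borel" using assms by auto
  have "integrable lborel (\<lambda>x. (norm (f x + g x))\<^sup>2)"
  proof (rule Bochner_Integration.integrable_bound)
    show "integrable lborel (\<lambda>x. 2 * (norm (f x))\<^sup>2 + 2 * (norm (g x))\<^sup>2)"
      by (intro Bochner_Integration.integrable_add integrable_mult_right L2_integrable assms)
    have "(norm (f x + g x))\<^sup>2 \<le> 2 * (norm (f x))\<^sup>2 + 2 * (norm (g x))\<^sup>2" for x
    proof -
      have "(norm (f x + g x))\<^sup>2 \<le> (norm (f x) + norm (g x))\<^sup>2"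
        by (intro power_mono norm_triangle_ineq) auto
      also have "\<dots> \<le> 2 * (norm (f x))\<^sup>2 + 2 * (norm (g x))\<^sup>2"
        using sum_squares_bound[of "norm (f x)" "norm (g x)"] by (simp add: power2_sum)
      finally show ?thesis .
    qed
    then show "AE x in lborel. norm ((norm (f x + g x))\<^sup>2) \<le> norm (2 * (norm (f x))\<^sup>2 + 2 * (norm (g x))\<^sup>2)"
      by (intro AE_I2) simp
  qed auto
  then show ?thesis using assms by (simp add: L2_iff)
qed

lemma L2_mult_bounded:
  fixes f k :: "real^2 \<Rightarrow> complex"
  assumes "f \<in> L2" "k \<in> borel_measurable borel" "\<And>x. norm (k x) \<le> C"
  shows "(\<lambda>x. k x * f x) \<in> L2"
proof (rule L2_bound[OF assms(1)])
  have [measurable]: "f \<in> borel_measurable borel" using assms by auto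
  show "(\<lambda>x. k x * f x) \<in> borel_measurable borel" using assms by measurable
  show "norm (k x * f x) \<le> C * norm (f x)" for x
    using assms(3)[of x] by (simp add: norm_mult mult_right_mono)
qed

lemma L2_cmult [intro]: "(f :: real^2 \<Rightarrow> complex) \<in> L2 \<Longrightarrow> (\<lambda>x. c * f x) \<in> L2"
  by (rule L2_mult_bounded[where C="norm c"]) auto

lemma L2_uminus [intro]: "(f :: real^2 \<Rightarrow> complex) \<in> L2 \<Longrightarrow> (\<lambda>x. - f x) \<in> L2"
  using L2_cmult[of f "-1"] by simp

lemma L2_diff [intro]: "(f :: real^2 \<Rightarrow> complex) \<in> L2 \<Longrightarrow> g \<in> L2 \<Longrightarrow> (\<lambda>x. f x - g x) \<in> L2"
  using L2_add[of f "\<lambda>x. - g x"] L2_uminus[of g] by simp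

lemma L2_cnj [intro]: "f \<in> L2 \<Longrightarrow> (\<lambda>x. cnj (f x)) \<in> L2"
  by (rule L2_bound[where C=1 and f=f]) (auto intro!: borel_measurable_continuous_on[of cnj] continuous_intros)

section \<open>Translations and dilations of the plane\<close>

lemma lborel_integral_shift:
  fixes f :: "real^2 \<Rightarrow> 'b::{banach,second_countable_topology}"
  assumes [measurable]: "f \<in> borel_measurable borel"
  shows "(\<integral>x. f (x + y) \<partial>lborel) = (\<integral>x. f x \<partial>lborel)"
proof -
  have "(\<integral>x. f x \<partial>lborel) = (\<integral>x. f x \<partial>distr lborel borel ((+) y))" by (simp add: lborel_distr_plus)
  also have "\<dots> = (\<integral>x. f (y + x) \<partial>lborel)" by (subst integral_distr) auto
  finally show ?thesis by (simp add: add.commute)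
qed

lemma lborel_integrable_shift:
  fixes f :: "real^2 \<Rightarrow> 'b::{banach,second_countable_topology}"
  assumes [measurable]: "f \<in> borel_measurable borel" and "integrable lborel f"
  shows "integrable lborel (\<lambda>x. f (x + y))"
proof -
  have "integrable (distr lborel borel ((+) y)) f" using assms by (simp add: lborel_distr_plus)
  then have "integrable lborel (\<lambda>x. f (y + x))" by (subst (asm) integrable_distr_eq) auto
  then show ?thesis by (simp add: add.commute)
qed

text \<open>
  The Jacobian is \<open>c\<^sup>2\<close> in the plane. With \<open>c = a\<close> this turns a Gaussian of width \<open>a\<close> into
  the fixed one.
\<close>

lemma lborel_integral_scale:
  fixes f :: "real^2 \<Rightarrow> 'b::{banach,second_countable_topology}"
  assumes [measurable]: "f \<in> borel_measurable borel" and c: "c \<noteq> 0"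
  shows "(\<integral>x. f x \<partial>lborel) = c\<^sup>2 *\<^sub>R (\<integral>x. f (c *\<^sub>R x) \<partial>lborel)"
proof -
  have "(\<integral>x. f x \<partial>lborel) = (\<integral>x. f x \<partial>density (distr lborel borel (\<lambda>x. 0 + c *\<^sub>R x)) (\<lambda>_. \<bar>c\<bar>^DIM(real^2)))"
    by (subst lborel_affine[OF c, of 0]) simp
  also have "\<dots> = (\<integral>x. (c\<^sup>2) *\<^sub>R f x \<partial>(distr lborel borel (\<lambda>x. 0 + c *\<^sub>R x)))"
    by (subst integral_density) (auto simp: )
  also have "\<dots> = (\<integral>x. (c\<^sup>2) *\<^sub>R f (c *\<^sub>R x) \<partial>lborel)"
    by (subst integral_distr) auto
  finally show ?thesis by simp
qed

lemma lborel_integrable_reflect: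
  fixes f :: "real^2 \<Rightarrow> 'b::{banach,second_countable_topology}"
  assumes [measurable]: "f \<in> borel_measurable borel" and "integrable lborel f"
  shows "integrable lborel (\<lambda>x. f (- x))"
proof -
  have eq: "lborel = (distr lborel borel uminus :: (real^2) measure)"
    using lborel_affine[of "-1" "0::real^2"] by (simp add: density_1)
  have "integrable (distr lborel borel uminus) f" using assms eq by simp
  then show ?thesis by (subst (asm) integrable_distr_eq) auto
qed

lemma L2_shift:
  assumes "f \<in> L2" shows "(\<lambda>x. f (x + y)) \<in> L2"
proof -
  have [measurable]: "f \<in> borel_measurable borel" using assms by auto
  show ?thesis using lborel_integrable_shift[of "\<lambda>x. (norm (f x))\<^sup>2" y] L2_integrable[OF assms]
    by (simp add: L2_iff)
qed

lemma L2_norm_shift: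
  assumes "f \<in> L2" shows "L2_norm (\<lambda>x. f (x + y)) = L2_norm f"
proof -
  have [measurable]: "f \<in> borel_measurable borel" using assms by auto
  show ?thesis using lborel_integral_shift[of "\<lambda>x. (norm (f x))\<^sup>2" y]
    by (simp add: L2_norm_def)
qed

lemma L2_reflect:
  assumes "f \<in> L2" shows "(\<lambda>x. f (- x)) \<in> L2"
proof -
  have [measurable]: "f \<in> borel_measurable borel" using assms by auto
  show ?thesis using lborel_integrable_reflect[of "\<lambda>x. (norm (f x))\<^sup>2"] L2_integrable[OF assms]
    by (simp add: L2_iff)
qed

section \<open>The inner product and the norm\<close>

definition L2_inner :: "(real^2 \<Rightarrow> complex) \<Rightarrow> (real^2 \<Rightarrow> complex) \<Rightarrow> complex" where
  "L2_inner f g = (\<integral>x. f x * cnj (g x) \<partial>lborel)"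

lemma L2_integrable_mult_norm:
  fixes f g :: "real^2 \<Rightarrow> complex"
  assumes "f \<in> L2" "g \<in> L2" shows "integrable lborel (\<lambda>x. norm (f x) * norm (g x))"
proof (rule Bochner_Integration.integrable_bound)
  have [measurable]: "f \<in> borel_measurable borel" "g \<in> borel_measurable borel" using assms by auto
  show "integrable lborel (\<lambda>x. (norm (f x))\<^sup>2 + (norm (g x))\<^sup>2)"
    by (intro Bochner_Integration.integrable_add L2_integrable assms)
  have "norm (f x) * norm (g x) \<le> (norm (f x))\<^sup>2 + (norm (g x))\<^sup>2" for x
  proof -
    have "2 * norm (f x) * norm (g x) \<le> (norm (f x))\<^sup>2 + (norm (g x))\<^sup>2" by (rule sum_squares_bound)
    moreover have "0 \<le> norm (f x) * norm (g x)" by simp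
    ultimately show ?thesis by linarith
  qed
  then show "AE x in lborel. norm (norm (f x) * norm (g x)) \<le> norm ((norm (f x))\<^sup>2 + (norm (g x))\<^sup>2)"
    by (intro AE_I2) simp
  show "(\<lambda>x. norm (f x) * norm (g x)) \<in> borel_measurable lborel" by measurable
qed

lemma L2_integrable_mult:
  fixes f g :: "real^2 \<Rightarrow> complex"
  assumes "f \<in> L2" "g \<in> L2" shows "integrable lborel (\<lambda>x. f x * g x)"
proof -
  have [measurable]: "f \<in> borel_measurable borel" "g \<in> borel_measurable borel" using assms by auto
  show ?thesis
    by (rule Bochner_Integration.integrable_bound[OF L2_integrable_mult_norm[OF assms]]) (auto simp: norm_mult)
qed

lemma L2_integrable_inner:
  "f \<in> L2 \<Longrightarrow> g \<in> L2 \<Longrightarrow> integrable lborel (\<lambda>x. f x * cnj (g x))"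
  using L2_integrable_mult[of f "\<lambda>x. cnj (g x)"] by auto

lemma L2_Cauchy_Schwarz_norm:
  fixes f g :: "real^2 \<Rightarrow> complex"
  assumes "f \<in> L2" "g \<in> L2"
  shows "(\<integral>x. norm (f x) * norm (g x) \<partial>lborel) \<le> L2_norm f * L2_norm g"
proof -
  define I where "I = (\<integral>x. norm (f x) * norm (g x) \<partial>lborel)"
  define a where "a = (L2_norm f)\<^sup>2"
  define b where "b = (L2_norm g)\<^sup>2"
  \<comment> \<open>a nonnegative quadratic polynomial in \<open>t\<close>, so its discriminant is not positive\<close>
  have q: "0 \<le> t\<^sup>2 * a - 2 * t * I + b" for t :: real
  proof -
    have "0 \<le> (\<integral>x. (t * norm (f x) - norm (g x))\<^sup>2 \<partial>lborel)" by simp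
    also have "\<dots> = (\<integral>x. t\<^sup>2 * (norm (f x))\<^sup>2 - 2 * t * (norm (f x) * norm (g x)) + (norm (g x))\<^sup>2 \<partial>lborel)"
      by (rule Bochner_Integration.integral_cong) (auto simp: power2_diff power_mult_distrib)
    also have "\<dots> = t\<^sup>2 * a - 2 * t * I + b"
      using L2_integrable_mult_norm[OF assms] L2_integrable[OF assms(1)] L2_integrable[OF assms(2)]
      by (simp add: a_def b_def I_def L2_norm_sq)
    finally show ?thesis .
  qed
  have I0: "0 \<le> I" unfolding I_def by (rule Bochner_Integration.integral_nonneg) auto
  have a0: "0 \<le> a" "0 \<le> b" by (auto simp: a_def b_def)
  have "I\<^sup>2 \<le> a * b"
  proof (cases "a = 0")
    case True
    have "I = 0"
    proof (rule ccontr)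
      assume "I \<noteq> 0"
      then show False using q[of "(b+1)/(2*I)"] True by (simp add: field_simps)
    qed
    then show ?thesis using True by simp
  next
    case False
    then have "a > 0" using a0 by simp
    have "0 \<le> (I/a)\<^sup>2 * a - 2 * (I/a) * I + b" by (rule q)
    also have "\<dots> = b - I\<^sup>2 / a" using False by (simp add: power2_eq_square field_simps)
    finally show ?thesis using \<open>a > 0\<close> by (simp add: field_simps)
  qed
  then have "I\<^sup>2 \<le> (L2_norm f * L2_norm g)\<^sup>2" by (simp add: a_def b_def power_mult_distrib)
  then show ?thesis unfolding I_def[symmetric] by (rule power2_le_imp_le) simp
qed

lemma L2_Cauchy_Schwarz_mult:
  assumes "f \<in> L2" "g \<in> L2" shows "norm (\<integral>x. f x * g x \<partial>lborel) \<le> L2_norm f * L2_norm (g :: real^2 \<Rightarrow> complex)"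
proof -
  have "norm (\<integral>x. f x * g x \<partial>lborel) \<le> (\<integral>x. norm (f x * g x) \<partial>lborel)"
    by (rule integral_norm_bound)
  also have "\<dots> \<le> L2_norm f * L2_norm g" using L2_Cauchy_Schwarz_norm[OF assms] by (simp add: norm_mult)
  finally show ?thesis .
qed

lemma L2_norm_cnj [simp]: "L2_norm (\<lambda>x. cnj (f x)) = L2_norm f"
  by (simp add: L2_norm_def)

lemma L2_Cauchy_Schwarz:
  assumes "f \<in> L2" "g \<in> L2" shows "norm (L2_inner f g) \<le> L2_norm f * L2_norm g"
  using L2_Cauchy_Schwarz_mult[OF assms(1) L2_cnj[OF assms(2)]] by (simp add: L2_inner_def)

lemma L2_inner_self: "L2_inner f f = of_real ((L2_norm f)\<^sup>2)"
  by (simp add: L2_inner_def L2_norm_sq complex_norm_square[symmetric] flip: of_real_power)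

lemma L2_inner_add_left: "f \<in> L2 \<Longrightarrow> g \<in> L2 \<Longrightarrow> h \<in> L2 \<Longrightarrow> L2_inner (\<lambda>x. f x + g x) h = L2_inner f h + L2_inner g h"
  by (simp add: L2_inner_def ring_distribs L2_integrable_inner)

lemma L2_inner_diff_left: "f \<in> L2 \<Longrightarrow> g \<in> L2 \<Longrightarrow> h \<in> L2 \<Longrightarrow> L2_inner (\<lambda>x. f x - g x) h = L2_inner f h - L2_inner g h"
  by (simp add: L2_inner_def ring_distribs L2_integrable_inner)

lemma L2_inner_commute: "L2_inner f g = cnj (L2_inner g f)"
  unfolding L2_inner_def by (subst Bochner_Integration.integral_cnj[symmetric]) (simp add: mult.commute)

lemma L2_inner_add_right: "f \<in> L2 \<Longrightarrow> g \<in> L2 \<Longrightarrow> h \<in> L2 \<Longrightarrow> L2_inner h (\<lambda>x. f x + g x) = L2_inner h f + L2_inner h g"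
  by (simp add: L2_inner_def ring_distribs L2_integrable_inner)

lemma L2_inner_diff_right: "f \<in> L2 \<Longrightarrow> g \<in> L2 \<Longrightarrow> h \<in> L2 \<Longrightarrow> L2_inner h (\<lambda>x. f x - g x) = L2_inner h f - L2_inner h g"
  by (simp add: L2_inner_def ring_distribs L2_integrable_inner)

lemma L2_inner_cmult_right: "L2_inner f (\<lambda>x. c * g x) = cnj c * L2_inner f g"
proof -
  have "L2_inner f (\<lambda>x. c * g x) = (\<integral>x. cnj c * (f x * cnj (g x)) \<partial>lborel)"
    unfolding L2_inner_def by (rule Bochner_Integration.integral_cong) auto
  then show ?thesis by (simp add: L2_inner_def)
qed

lemma L2_norm_cmult: "L2_norm (\<lambda>x. c * f x) = norm c * L2_norm (f :: real^2 \<Rightarrow> complex)"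
  by (simp add: L2_norm_def norm_mult power_mult_distrib real_sqrt_mult)

lemma L2_norm_add_sq:
  assumes "f \<in> L2" "g \<in> L2"
  shows "(L2_norm (\<lambda>x. f x + g x))\<^sup>2 = (L2_norm f)\<^sup>2 + (L2_norm g)\<^sup>2 + 2 * Re (L2_inner f g)"
proof -
  have "complex_of_real ((L2_norm (\<lambda>x. f x + g x))\<^sup>2) = L2_inner (\<lambda>x. f x + g x) (\<lambda>x. f x + g x)"
    by (simp only: L2_inner_self)
  also have "\<dots> = L2_inner f f + L2_inner f g + L2_inner g f + L2_inner g g"
    using assms by (simp add: L2_inner_add_left L2_inner_add_right L2_add)
  also have "\<dots> = of_real ((L2_norm f)\<^sup>2 + (L2_norm g)\<^sup>2) + (L2_inner f g + cnj (L2_inner f g))"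
    using L2_inner_commute[of g f] by (simp add: L2_inner_self)
  finally have "complex_of_real ((L2_norm (\<lambda>x. f x + g x))\<^sup>2) = of_real ((L2_norm f)\<^sup>2 + (L2_norm g)\<^sup>2 + 2 * Re (L2_inner f g))"
    by (simp add: complex_add_cnj)
  then show ?thesis by (simp only: of_real_eq_iff)
qed

lemma L2_norm_diff_sq:
  assumes "f \<in> L2" "g \<in> L2"
  shows "(L2_norm (\<lambda>x. f x - g x))\<^sup>2 = (L2_norm f)\<^sup>2 + (L2_norm g)\<^sup>2 - 2 * Re (L2_inner f g)"
  using L2_norm_add_sq[OF assms(1) L2_cmult[OF assms(2), of "-1"]]
    L2_norm_cmult[of "-1" g] L2_inner_cmult_right[of f "-1" g] by simp

lemma L2_norm_triangle:
  assumes "f \<in> L2" "g \<in> L2"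
  shows "L2_norm (\<lambda>x. f x + g x) \<le> L2_norm f + L2_norm (g :: real^2 \<Rightarrow> complex)"
proof (rule power2_le_imp_le)
  have "Re (L2_inner f g) \<le> L2_norm f * L2_norm g"
    using L2_Cauchy_Schwarz[OF assms] complex_Re_le_cmod order_trans by blast
  then show "(L2_norm (\<lambda>x. f x + g x))\<^sup>2 \<le> (L2_norm f + L2_norm g)\<^sup>2"
    by (simp add: L2_norm_add_sq[OF assms] power2_sum)
qed simp

lemma L2_norm_diff_commute: "L2_norm (\<lambda>x. f x - g x) = L2_norm (\<lambda>x. g x - f x)"
  by (simp add: L2_norm_def norm_minus_commute)

lemma L2_norm_diff_triangle:
  assumes "f \<in> L2" "g \<in> L2" "h \<in> L2"
  shows "L2_norm (\<lambda>x. f x - h x) \<le> L2_norm (\<lambda>x. f x - g x) + L2_norm (\<lambda>x. g x - h x :: complex)"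
  using L2_norm_triangle[of "\<lambda>x. f x - g x" "\<lambda>x. g x - h x"] assms by auto

lemma L2_norm_reverse_triangle:
  assumes "f \<in> L2" "g \<in> L2"
  shows "\<bar>L2_norm f - L2_norm g\<bar> \<le> L2_norm (\<lambda>x. f x - g x :: complex)"
  using L2_norm_triangle[OF L2_diff[OF assms] assms(2)]
    L2_norm_triangle[OF L2_diff[OF assms(2,1)] assms(1)]
    L2_norm_diff_commute[of f g] by simp

lemma L2_norm_cong_AE:
  assumes "AE x in lborel. f x = g x" "f \<in> borel_measurable borel" "g \<in> borel_measurable borel"
  shows "L2_norm f = L2_norm g"
  unfolding L2_norm_def using assms by (intro arg_cong[where f=sqrt] integral_cong_AE) auto

lemma L2_norm_eq_0_iff:
  assumes "f \<in> L2" shows "L2_norm f = 0 \<longleftrightarrow> (AE x in lborel. f x = 0)"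
  using integral_nonneg_eq_0_iff_AE[OF L2_integrable[OF assms]] by (simp add: L2_norm_def)

lemma L2_norm_diff_eq_0D:
  fixes f g :: "real^2 \<Rightarrow> complex"
  assumes "f \<in> L2" "g \<in> L2" "L2_norm (\<lambda>x. f x - g x) = 0" shows "AE x in lborel. f x = g x"
  using L2_norm_eq_0_iff[OF L2_diff[OF assms(1,2)]] assms(3) by auto

lemma L2_cong_AE:
  assumes "f \<in> L2" "g \<in> borel_measurable borel" "AE x in lborel. f x = g x" shows "g \<in> L2"
proof -
  have [measurable]: "f \<in> borel_measurable borel" "g \<in> borel_measurable borel" using assms by auto
  have "integrable lborel (\<lambda>x. (norm (f x))\<^sup>2) \<longleftrightarrow> integrable lborel (\<lambda>x. (norm (g x))\<^sup>2)"
    by (rule integrable_cong_AE) (use assms(3) in auto)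
  then show ?thesis using assms by (simp add: L2_iff)
qed

lemma L2_nn_integral:
  fixes f :: "real^2 \<Rightarrow> complex" assumes "f \<in> L2"
  shows "(\<integral>\<^sup>+x. ennreal ((cmod (f x))\<^sup>2) \<partial>lborel) = ennreal ((L2_norm f)\<^sup>2)"
  unfolding L2_norm_sq by (rule nn_integral_eq_integral[OF L2_integrable[OF assms]]) simp

lemma L2_nn_integral_le:
  fixes f :: "real^2 \<Rightarrow> complex"
  assumes [measurable]: "f \<in> borel_measurable borel" and le: "(\<integral>\<^sup>+x. ennreal ((cmod (f x))\<^sup>2) \<partial>lborel) \<le> ennreal c" and c: "0 \<le> c"
  shows "f \<in> L2" "(L2_norm f)\<^sup>2 \<le> c"
proof -
  show f: "f \<in> L2" unfolding L2_iff using le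
    by (auto intro!: integrableI_bounded simp: le_less_trans[OF le])
  show "(L2_norm f)\<^sup>2 \<le> c" using le c by (simp add: L2_nn_integral[OF f])
qed

section \<open>Limits and completeness\<close>

text \<open>
  Membership of the limit in \<open>L\<^sup>2\<close> and the bound come together. Used where pointwise
  convergence is known along with a bound for the norms.
\<close>

lemma L2_Fatou:
  fixes g :: "nat \<Rightarrow> real^2 \<Rightarrow> complex"
  assumes g: "\<And>k. g k \<in> L2" and f[measurable]: "f \<in> borel_measurable borel"
    and lim: "AE x in lborel. (\<lambda>k. g k x) \<longlonglongrightarrow> f x"
    and bd: "\<forall>\<^sub>F k in sequentially. (L2_norm (g k))\<^sup>2 \<le> c" and c: "0 \<le> c"
  shows "f \<in> L2" "(L2_norm f)\<^sup>2 \<le> c"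
proof -
  have [measurable]: "g k \<in> borel_measurable borel" for k using g by auto
  have "(\<integral>\<^sup>+x. ennreal ((cmod (f x))\<^sup>2) \<partial>lborel) = (\<integral>\<^sup>+x. liminf (\<lambda>k. ennreal ((cmod (g k x))\<^sup>2)) \<partial>lborel)"
  proof (rule nn_integral_cong_AE, use lim in eventually_elim)
    case (elim x)
    then have "(\<lambda>k. ennreal ((cmod (g k x))\<^sup>2)) \<longlonglongrightarrow> ennreal ((cmod (f x))\<^sup>2)"
      by (intro tendsto_intros)
    then show ?case by (intro lim_imp_Liminf[symmetric]) auto
  qed
  also have "\<dots> \<le> liminf (\<lambda>k. \<integral>\<^sup>+x. ennreal ((cmod (g k x))\<^sup>2) \<partial>lborel)"
    by (rule nn_integral_liminf) auto
  also have "\<dots> = liminf (\<lambda>k. ennreal ((L2_norm (g k))\<^sup>2))" by (simp add: L2_nn_integral g)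
  also have "\<dots> \<le> liminf (\<lambda>k. ennreal c)"
    by (rule Liminf_mono) (use bd in eventually_elim, auto intro: ennreal_leI)
  also have "\<dots> = ennreal c" by (simp add: Liminf_const)
  finally show "f \<in> L2" "(L2_norm f)\<^sup>2 \<le> c" using L2_nn_integral_le[OF f _ c] by auto
qed

lemma L2_dominated:
  fixes f :: "nat \<Rightarrow> real^2 \<Rightarrow> complex" and h :: "real^2 \<Rightarrow> real"
  assumes h: "h \<in> L2" and [measurable]: "\<And>n. f n \<in> borel_measurable borel"
    and le: "\<And>n x. norm (f n x) \<le> h x"
    and lim: "AE x in lborel. (\<lambda>n. f n x) \<longlonglongrightarrow> 0"
  shows "(\<lambda>n. L2_norm (f n)) \<longlonglongrightarrow> 0"
proof -
  have [measurable]: "h \<in> borel_measurable borel" using h by auto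
  have "(\<lambda>n. \<integral>x. (norm (f n x))\<^sup>2 \<partial>lborel) \<longlonglongrightarrow> (\<integral>x. 0 \<partial>(lborel :: (real^2) measure))"
  proof (rule integral_dominated_convergence[where w="\<lambda>x. (norm (h x))\<^sup>2"])
    show "integrable lborel (\<lambda>x. (norm (h x))\<^sup>2)" by (rule L2_integrable[OF h])
    show "AE x in lborel. (\<lambda>n. (norm (f n x))\<^sup>2) \<longlonglongrightarrow> 0"
      using lim by eventually_elim (auto intro!: tendsto_eq_intros)
    fix n show "AE x in lborel. norm ((norm (f n x))\<^sup>2) \<le> (norm (h x))\<^sup>2"
      by (intro AE_I2) (use le order_trans[OF norm_ge_zero le] in \<open>auto intro!: power_mono\<close>)
  qed auto
  then have "(\<lambda>n. sqrt (\<integral>x. (norm (f n x))\<^sup>2 \<partial>lborel)) \<longlonglongrightarrow> sqrt 0"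
    by (intro tendsto_intros) simp
  then show ?thesis by (simp add: L2_norm_def)
qed

text \<open>
  Along a subsequence with increments of norm at most \<open>4\<^sup>-\<^sup>k\<close>, the sum of \<open>2\<^sup>k \<bar>d\<^sub>k\<bar>\<^sup>2\<close> is
  integrable. Since \<open>t \<le> 2\<^sup>-\<^sup>k + 2\<^sup>k t\<^sup>2\<close>, the increments are then absolutely summable at
  almost every point. Fatou's lemma shows that the pointwise limit is the limit in the norm.
\<close>

lemma L2_complete:
  fixes f :: "nat \<Rightarrow> real^2 \<Rightarrow> complex"
  assumes f: "\<And>n. f n \<in> L2"
    and cauchy: "\<And>e. e > 0 \<Longrightarrow> \<exists>N. \<forall>m\<ge>N. \<forall>n\<ge>N. L2_norm (\<lambda>x. f m x - f n x) < e"
  obtains F where "F \<in> L2" "(\<lambda>n. L2_norm (\<lambda>x. f n x - F x)) \<longlonglongrightarrow> 0"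
proof -
  have [measurable]: "f k \<in> borel_measurable borel" for k using f by auto
  have "\<forall>k. \<exists>N. \<forall>m\<ge>N. \<forall>n\<ge>N. L2_norm (\<lambda>x. f m x - f n x) < (1/2)^(2*k)"
    by (intro allI cauchy) simp
  then obtain N where N: "\<And>k m n. m \<ge> N k \<Longrightarrow> n \<ge> N k \<Longrightarrow> L2_norm (\<lambda>x. f m x - f n x) < (1/2)^(2*k)"
    by metis
  \<comment> \<open>the partial sums make \<open>r\<close> monotone, so both \<open>r k\<close> and \<open>r (Suc k)\<close> lie beyond \<open>N k\<close>\<close>
  define r where "r k = k + (\<Sum>j\<le>k. N j)" for k
  have r: "r k \<ge> N k" "r k \<ge> k" for k
    using member_le_sum[of k "{..k}" N] by (auto simp: r_def)
  have rS: "r (Suc k) \<ge> N k" for k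
    using r(1)[of k] by (simp add: r_def)
  define d where "d k x = f (r (Suc k)) x - f (r k) x" for k x
  have dL: "d k \<in> L2" for k unfolding d_def using f by auto
  have d: "(L2_norm (d k))\<^sup>2 \<le> (1/2)^(4*k)" for k
  proof -
    have "L2_norm (d k) \<le> (1/2)^(2*k)" using N[OF rS r(1), of k] by (simp add: d_def[abs_def])
    then have "(L2_norm (d k))\<^sup>2 \<le> ((1/2)^(2*k))\<^sup>2" by (intro power_mono) auto
    also have "\<dots> = (1/2)^(4*k)" by (simp add: power_mult[symmetric])
    finally show ?thesis .
  qed
  have [measurable]: "d k \<in> borel_measurable borel" for k using dL by auto
  have "(\<integral>\<^sup>+x. (\<Sum>k. ennreal (2^k * (cmod (d k x))\<^sup>2)) \<partial>lborel) = (\<Sum>k. \<integral>\<^sup>+x. ennreal (2^k * (cmod (d k x))\<^sup>2) \<partial>lborel)"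
    by (rule nn_integral_suminf) auto
  also have "\<dots> = (\<Sum>k. ennreal (2^k * (L2_norm (d k))\<^sup>2))"
    by (simp add: ennreal_mult nn_integral_cmult L2_nn_integral[OF dL])
  also have "\<dots> \<le> (\<Sum>k. ennreal ((1/2)^k))"
  proof (rule suminf_le)
    fix k
    have "2^k * (L2_norm (d k))\<^sup>2 \<le> 2^k * (1/2)^(4*k)" by (intro mult_left_mono d) simp
    also have "\<dots> \<le> 2^k * (1/2)^(2*k)" by (intro mult_left_mono power_decreasing) auto
    also have "\<dots> = (1/2)^k" by (simp add: power_mult power_mult_distrib[symmetric] power2_eq_square)
    finally show "ennreal (2^k * (L2_norm (d k))\<^sup>2) \<le> ennreal ((1/2)^k)" by (rule ennreal_leI)
  qed auto
  also have "\<dots> = ennreal (\<Sum>k. (1/2)^k)" by (intro suminf_ennreal2) (auto simp: summable_geometric)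
  also have "\<dots> < \<infinity>" by simp
  finally have "AE x in lborel. (\<Sum>k. ennreal (2^k * (cmod (d k x))\<^sup>2)) \<noteq> \<infinity>"
    by (intro nn_integral_PInf_AE) auto
  then have conv: "AE x in lborel. convergent (\<lambda>k. f (r k) x)"
  proof eventually_elim
    case (elim x)
    then have s: "summable (\<lambda>k. 2^k * (cmod (d k x))\<^sup>2)" by (intro summable_suminf_not_top) auto
    have "summable (\<lambda>k. d k x)"
    proof (rule summable_comparison_test)
      show "summable (\<lambda>k. (1/2)^k + 2^k * (cmod (d k x))\<^sup>2)"
        by (intro summable_add s summable_geometric) simp
      have "cmod (d k x) \<le> (1/2)^k + 2^k * (cmod (d k x))\<^sup>2" for k
      proof (cases "cmod (d k x) \<le> (1/2)^k")
        case True then show ?thesis by (simp add: add_increasing2)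
      next
        case False
        then have "cmod (d k x) * 1 \<le> cmod (d k x) * (2^k * cmod (d k x))"
          by (intro mult_left_mono) (auto simp: field_simps)
        then show ?thesis by (simp add: power2_eq_square mult_ac add_increasing)
      qed
      then show "\<exists>N. \<forall>n\<ge>N. norm (d n x) \<le> (1/2)^n + 2^n * (cmod (d n x))\<^sup>2" by auto
    qed
    then have "convergent (\<lambda>n. \<Sum>k<n. d k x)" by (simp add: summable_iff_convergent)
    then have "convergent (\<lambda>n. (\<Sum>k<n. d k x) + f (r 0) x)"
      by (intro convergent_add convergent_const)
    moreover have "(\<Sum>k<n. d k x) + f (r 0) x = f (r n) x" for n
      by (simp add: d_def sum_lessThan_telescope[of "\<lambda>k. f (r k) x"])
    ultimately show ?case by simp
  qed
  define F where "F x = lim (\<lambda>k. f (r k) x)" for x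
  have [measurable]: "F \<in> borel_measurable borel" unfolding F_def by measurable
  have lim: "AE x in lborel. (\<lambda>k. f (r k) x) \<longlonglongrightarrow> F x"
    using conv by eventually_elim (simp add: F_def convergent_LIMSEQ_iff)
  have key: "(\<lambda>x. f m x - F x) \<in> L2 \<and> (L2_norm (\<lambda>x. f m x - F x))\<^sup>2 \<le> e\<^sup>2"
    if e: "e > 0" and M: "\<And>n. n \<ge> M \<Longrightarrow> L2_norm (\<lambda>x. f m x - f n x) < e" for e m M
  proof -
    have l: "AE x in lborel. (\<lambda>k. f m x - f (r k) x) \<longlonglongrightarrow> f m x - F x"
      using lim by eventually_elim (auto intro!: tendsto_intros)
    have b: "\<forall>\<^sub>F k in sequentially. (L2_norm (\<lambda>x. f m x - f (r k) x))\<^sup>2 \<le> e\<^sup>2"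
    proof (rule eventually_sequentiallyI[of M])
      fix k assume "M \<le> k"
      then have "r k \<ge> M" using r(2)[of k] by linarith
      then show "(L2_norm (\<lambda>x. f m x - f (r k) x))\<^sup>2 \<le> e\<^sup>2"
        using M[of "r k"] by (intro power_mono) auto
    qed
    show ?thesis
      using L2_Fatou[where g="\<lambda>k x. f m x - f (r k) x", OF _ _ l b] f by auto
  qed
  obtain M0 where "\<forall>m\<ge>M0. \<forall>n\<ge>M0. L2_norm (\<lambda>x. f m x - f n x) < 1" using cauchy[of 1] by auto
  then have "(\<lambda>x. f M0 x - F x) \<in> L2" using key[of 1 M0 M0] by auto
  from L2_diff[OF f this, of M0] have FL: "F \<in> L2" by simp
  have "(\<lambda>n. L2_norm (\<lambda>x. f n x - F x)) \<longlonglongrightarrow> 0"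
  proof (rule LIMSEQ_I)
    fix e :: real assume "e > 0"
    then obtain M where "\<forall>m\<ge>M. \<forall>n\<ge>M. L2_norm (\<lambda>x. f m x - f n x) < e/2" using cauchy[of "e/2"] by auto
    then have "\<forall>m\<ge>M. (L2_norm (\<lambda>x. f m x - F x))\<^sup>2 \<le> (e/2)\<^sup>2" using key[of "e/2" M] \<open>e>0\<close> by auto
    then have "\<forall>m\<ge>M. L2_norm (\<lambda>x. f m x - F x) \<le> e/2"
      using \<open>e>0\<close> by (auto intro: power2_le_imp_le)
    then have "\<forall>m\<ge>M. norm (L2_norm (\<lambda>x. f m x - F x) - 0) < e" using \<open>e>0\<close> by fastforce
    then show "\<exists>no. \<forall>n\<ge>no. norm (L2_norm (\<lambda>x. f n x - F x) - 0) < e" by blast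
  qed
  with FL show thesis using that by blast
qed

section \<open>Continuity of translations\<close>

lemma L2_indicator_ball: "(\<lambda>x. B * indicator (ball (0::real^2) R) x :: real) \<in> L2"
proof -
  have "integrable lborel (\<lambda>x::real^2. B\<^sup>2 * indicator (ball 0 R) x :: real)"
    using emeasure_bounded_finite[of "ball (0::real^2) R"]
    by (intro integrable_mult_right integrable_real_indicator) auto
  moreover have "(\<lambda>x::real^2. (norm (B * indicator (ball 0 R) x :: real))\<^sup>2) = (\<lambda>x. B\<^sup>2 * indicator (ball 0 R) x :: real)"
    by (auto simp: indicator_def fun_eq_iff)
  moreover have "(\<lambda>x::real^2. B * indicator (ball 0 R) x :: real) \<in> borel_measurable borel"
    by (intro borel_measurable_times borel_measurable_indicator) auto
  ultimately show ?thesis unfolding L2_iff by simp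
qed

lemma L2_bounded_support:
  fixes f :: "real^2 \<Rightarrow> complex"
  assumes "f \<in> borel_measurable borel" "\<And>x. norm (f x) \<le> B" "\<And>x. norm x \<ge> R \<Longrightarrow> f x = 0"
  shows "f \<in> L2" "integrable lborel f"
proof -
  have [measurable]: "f \<in> borel_measurable borel" by fact
  have le: "norm (f x) \<le> 1 * norm (B * indicator (ball (0::real^2) R) x :: real)" for x
    using assms(2)[of x] assms(3)[of x] by (auto simp: indicator_def)
  show "f \<in> L2" by (rule L2_bound[OF L2_indicator_ball assms(1) le])
  have "integrable lborel (\<lambda>x::real^2. B * indicator (ball 0 R) x :: real)"
    using emeasure_bounded_finite[of "ball (0::real^2) R"]
    by (intro integrable_mult_right integrable_real_indicator) auto
  then show "integrable lborel f"
    by (rule Bochner_Integration.integrable_bound) (use le in auto)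
qed

text \<open>
  Continuous functions with compact support are dense. A measurable function is almost
  everywhere a limit of continuous functions. Clamping the values to a disc and cutting off
  in space preserves continuity and supplies the dominating functions.
\<close>

lemma L2_approx_continuous:
  assumes f: "f \<in> L2" and "e > 0"
  obtains \<phi> B R where "continuous_on UNIV \<phi>" "\<And>x. norm (\<phi> x) \<le> B" "\<And>x. norm x \<ge> R \<Longrightarrow> \<phi> x = 0" "L2_norm (\<lambda>x. f x - \<phi> x :: complex) < e"
proof -
  have [measurable]: "f \<in> borel_measurable borel" using f by auto
  \<comment> \<open>\<open>c m\<close> retracts the plane onto the disc of radius \<open>m\<close>; \<open>cut m\<close> is \<open>1\<close> on the ball of radius \<open>m\<close>
    and \<open>0\<close> outside that of radius \<open>m + 1\<close>\<close>
  define c where "c m z = z * of_real (real m / max (real m) (cmod z))" for m :: nat and z :: complex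
  define cut where "cut m x = max 0 (min 1 (real m + 1 - norm x))" for m :: nat and x :: "real^2"
  have c_cont: "continuous_on UNIV (c m)" if "m > 0" for m
    unfolding c_def using that by (auto intro!: continuous_intros)
  have cut_cont: "continuous_on UNIV (cut m)" for m unfolding cut_def by (intro continuous_intros)
  have [measurable]: "c m \<in> borel_measurable borel" if "m > 0" for m
    using c_cont[OF that] by (rule borel_measurable_continuous_onI)
  have [measurable]: "cut m \<in> borel_measurable borel" for m
    using cut_cont by (rule borel_measurable_continuous_onI)
  have c_le: "cmod (c m z) \<le> cmod z" for m z
    by (auto simp: c_def norm_mult norm_divide max_def divide_simps mult_left_le intro!: mult_left_le)
  have c_le': "cmod (c m z) \<le> m" for m z
    by (auto simp: c_def norm_mult norm_divide max_def divide_simps mult_left_mono)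
  have c_eq: "c m z = z" if "cmod z \<le> m" "m > 0" for m z using that by (auto simp: c_def max_def)
  have cut: "0 \<le> cut m x" "cut m x \<le> 1" "norm x \<ge> m + 1 \<Longrightarrow> cut m x = 0" "norm x \<le> m \<Longrightarrow> cut m x = 1" for m x
    by (auto simp: cut_def)
  define t where "t m x = cut m x * c m (f x)" for m x
  have t_meas[measurable]: "t m \<in> borel_measurable borel" if "m > 0" for m unfolding t_def[abs_def] using that by measurable
  have "(\<lambda>n. L2_norm (\<lambda>x. f x - t (Suc n) x)) \<longlonglongrightarrow> 0"
  proof (rule L2_dominated[where h="\<lambda>x. 2 * norm (f x)"])
    show "(\<lambda>x. 2 * norm (f x)) \<in> L2" using f by (rule L2_bound[where C=2]) auto
    fix n x
    have "norm (t (Suc n) x) \<le> 1 * norm (f x)" unfolding t_def norm_mult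
      using cut(1,2)[of "Suc n" x] c_le by (intro mult_mono) auto
    then show "norm (f x - t (Suc n) x) \<le> 2 * norm (f x)"
      using norm_triangle_ineq4[of "f x" "t (Suc n) x"] by linarith
  next
    show "AE x in lborel. (\<lambda>n. f x - t (Suc n) x) \<longlonglongrightarrow> 0"
    proof (rule AE_I2)
      fix x
      obtain N :: nat where "N \<ge> max (cmod (f x)) (norm x)" using real_arch_simple by blast
      then have "t (Suc n) x = f x" if "n \<ge> N" for n
        using c_eq[of "f x" "Suc n"] cut(4)[of x "Suc n"] that by (auto simp: t_def)
      then show "(\<lambda>n. f x - t (Suc n) x) \<longlonglongrightarrow> 0"
        by (intro tendsto_eventually eventually_sequentiallyI[of N]) auto
    qed
  qed auto
  then have "\<forall>\<^sub>F n in sequentially. L2_norm (\<lambda>x. f x - t (Suc n) x) < e/2"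
    using \<open>e > 0\<close> by (intro order_tendstoD) auto
  then obtain n where n: "L2_norm (\<lambda>x. f x - t (Suc n) x) < e/2" by (auto simp: eventually_sequentially)
  define m where "m = Suc n"
  have m: "m > 0" "L2_norm (\<lambda>x. f x - t m x) < e/2" using n by (auto simp: m_def)
  have [measurable]: "t m \<in> borel_measurable borel" "c m \<in> borel_measurable borel" using m by auto
  have cut_c_le: "norm (complex_of_real (cut m x) * c m z) \<le> m" for x z
  proof -
    have "norm (complex_of_real (cut m x) * c m z) \<le> 1 * real m"
      unfolding norm_mult using cut(1,2)[of m x] c_le'[of m z] by (intro mult_mono) auto
    then show ?thesis by simp
  qed
  have t_le: "norm (t m x) \<le> m" for x unfolding t_def by (rule cut_c_le)
  have t_0: "norm x \<ge> m + 1 \<Longrightarrow> t m x = 0" for x by (simp add: t_def cut)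
  have tL: "t m \<in> L2" by (rule L2_bounded_support(1)[of _ m "m+1"]) (use t_le t_0 in auto)
  have "f measurable_on UNIV"
    by (subst measurable_on_UNIV[symmetric])
      (simp add: measurable_on_iff_borel_measurable lebesgue_on_UNIV_eq measurable_completion)
  then obtain N g where N: "negligible N" and g: "\<And>k. continuous_on UNIV (g k)"
    and lim: "\<And>x. x \<notin> N \<Longrightarrow> (\<lambda>k. g k x) \<longlonglongrightarrow> f x"
    unfolding measurable_on_def by auto
  have "AE x in lebesgue. x \<notin> N" using N by (simp add: negligible_iff_null_sets AE_not_in)
  then have AE: "AE x in lborel. x \<notin> N" by (simp add: AE_completion_iff)
  define \<phi> where "\<phi> k x = cut m x * c m (g k x)" for k x
  have \<phi>_cont: "continuous_on UNIV (\<phi> k)" for k unfolding \<phi>_def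
    by (intro continuous_intros cut_cont g continuous_on_compose2[OF c_cont[OF m(1)]]) auto
  have [measurable]: "\<phi> k \<in> borel_measurable borel" for k using \<phi>_cont by (rule borel_measurable_continuous_onI)
  have \<phi>_le: "norm (\<phi> k x) \<le> m" for k x unfolding \<phi>_def by (rule cut_c_le)
  have \<phi>_0: "norm x \<ge> m + 1 \<Longrightarrow> \<phi> k x = 0" for k x by (simp add: \<phi>_def cut)
  have "(\<lambda>k. L2_norm (\<lambda>x. t m x - \<phi> k x)) \<longlonglongrightarrow> 0"
  proof (rule L2_dominated[OF L2_indicator_ball[of "2 * real m" "real m + 1"]])
    fix k x show "norm (t m x - \<phi> k x) \<le> 2 * real m * indicator (ball 0 (real m + 1)) x"
      using \<phi>_le[of k x] t_le[of x] \<phi>_0[of x k] t_0[of x] norm_triangle_ineq4[of "t m x" "\<phi> k x"]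
      by (auto simp: indicator_def)
  next
    show "AE x in lborel. (\<lambda>k. t m x - \<phi> k x) \<longlonglongrightarrow> 0"
      using AE
    proof eventually_elim
      case (elim x)
      have "(\<lambda>k. c m (g k x)) \<longlonglongrightarrow> c m (f x)"
        using c_cont[OF m(1)] lim[OF elim] by (auto simp: continuous_on_eq_continuous_at intro: isCont_tendsto_compose)
      then have "(\<lambda>k. t m x - \<phi> k x) \<longlonglongrightarrow> t m x - cut m x * c m (f x)"
        unfolding \<phi>_def by (intro tendsto_intros)
      then show ?case by (simp add: t_def)
    qed
  qed auto
  then have "\<forall>\<^sub>F k in sequentially. L2_norm (\<lambda>x. t m x - \<phi> k x) < e/2"
    using \<open>e > 0\<close> by (intro order_tendstoD) auto
  then obtain k where k: "L2_norm (\<lambda>x. t m x - \<phi> k x) < e/2" by (auto simp: eventually_sequentially)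
  have "\<phi> k \<in> L2" by (rule L2_bounded_support(1)[of _ m "m+1"]) (use \<phi>_le \<phi>_0 in auto)
  then have "L2_norm (\<lambda>x. f x - \<phi> k x) < e"
    using L2_norm_diff_triangle[OF f tL, of "\<phi> k"] k m(2) by linarith
  then show thesis using that[of "\<phi> k" m "m+1"] \<phi>_cont \<phi>_le \<phi>_0 by blast
qed

text \<open>
  The shift is an isometry, so it suffices to consider the dense set of continuous functions
  with compact support, where dominated convergence applies.
\<close>

lemma L2_translation_continuous:
  fixes f :: "real^2 \<Rightarrow> complex"
  assumes f: "f \<in> L2" and h: "h \<longlonglongrightarrow> 0"
  shows "(\<lambda>n. L2_norm (\<lambda>x. f (x + h n) - f x)) \<longlonglongrightarrow> 0"
proof (rule LIMSEQ_I)
  fix e :: real assume "e > 0"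
  then have "e/4 > 0" by simp
  from L2_approx_continuous[OF f this] obtain \<phi> B R where \<phi>: "continuous_on UNIV \<phi>" "\<And>x. norm (\<phi> x) \<le> B"
    "\<And>x. norm x \<ge> R \<Longrightarrow> \<phi> x = 0" and close: "L2_norm (\<lambda>x. f x - \<phi> x) < e/4" by metis
  have [measurable]: "f \<in> borel_measurable borel" using f by auto
  have [measurable]: "\<phi> \<in> borel_measurable borel" using \<phi>(1) by (rule borel_measurable_continuous_onI)
  have \<phi>L: "\<phi> \<in> L2" using \<phi> by (intro L2_bounded_support(1)[of _ B R]) auto
  obtain H where H: "\<And>n. norm (h n) \<le> H" using h convergentI convergent_imp_Bseq BseqE by metis
  have B0: "0 \<le> B" using \<phi>(2)[of 0] norm_ge_zero order_trans by blast
  have "(\<lambda>n. L2_norm (\<lambda>x. \<phi> (x + h n) - \<phi> x)) \<longlonglongrightarrow> 0"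
  proof (rule L2_dominated[OF L2_indicator_ball[of "2*B" "R+H"]])
    fix n and x :: "real^2"
    have "\<phi> (x + h n) = 0" "\<phi> x = 0" if "norm x \<ge> R + H"
    proof -
      have "norm x \<le> norm (x + h n) + norm (h n)"
        using norm_triangle_ineq4[of "x + h n" "h n"] by simp
      then show "\<phi> (x + h n) = 0" using H[of n] that by (intro \<phi>(3)) linarith
      have "0 \<le> H" using H[of n] norm_ge_zero order_trans by blast
      then show "\<phi> x = 0" using that by (intro \<phi>(3)) linarith
    qed
    then show "norm (\<phi> (x + h n) - \<phi> x) \<le> 2 * B * indicator (ball 0 (R + H)) x"
      using \<phi>(2)[of "x + h n"] \<phi>(2)[of x] norm_triangle_ineq4[of "\<phi> (x + h n)" "\<phi> x"]
      by (auto simp: indicator_def)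
  next
    show "AE x in lborel. (\<lambda>n. \<phi> (x + h n) - \<phi> x) \<longlonglongrightarrow> 0"
    proof (rule AE_I2)
      fix x
      have "(\<lambda>n. x + h n) \<longlonglongrightarrow> x" using tendsto_add[OF tendsto_const h, of x] by simp
      then have "(\<lambda>n. \<phi> (x + h n)) \<longlonglongrightarrow> \<phi> x"
        using \<phi>(1) by (auto simp: continuous_on_eq_continuous_at intro: isCont_tendsto_compose)
      then show "(\<lambda>n. \<phi> (x + h n) - \<phi> x) \<longlonglongrightarrow> 0"
        using tendsto_diff[OF _ tendsto_const[of "\<phi> x"]] by fastforce
    qed
  qed auto
  then obtain N where N: "\<And>n. n \<ge> N \<Longrightarrow> L2_norm (\<lambda>x. \<phi> (x + h n) - \<phi> x) < e/4"
    using LIMSEQ_D[of "\<lambda>n. L2_norm (\<lambda>x. \<phi> (x + h n) - \<phi> x)" 0 "e/4"] \<open>e > 0\<close> by auto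
  have "norm (L2_norm (\<lambda>x. f (x + h n) - f x) - 0) < e" if "n \<ge> N" for n
  proof -
    have fs: "(\<lambda>x. f (x + h n)) \<in> L2" "(\<lambda>x. \<phi> (x + h n)) \<in> L2" using f \<phi>L L2_shift by auto
    have "L2_norm (\<lambda>x. f (x + h n) - f x) \<le> L2_norm (\<lambda>x. f (x + h n) - \<phi> (x + h n)) + L2_norm (\<lambda>x. \<phi> (x + h n) - f x)"
      by (rule L2_norm_diff_triangle) (use fs f in auto)
    also have "L2_norm (\<lambda>x. f (x + h n) - \<phi> (x + h n)) = L2_norm (\<lambda>x. f x - \<phi> x)"
      using L2_norm_shift[of "\<lambda>x. f x - \<phi> x" "h n"] f \<phi>L by auto
    also have "L2_norm (\<lambda>x. \<phi> (x + h n) - f x) \<le> L2_norm (\<lambda>x. \<phi> (x + h n) - \<phi> x) + L2_norm (\<lambda>x. \<phi> x - f x)"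
      by (rule L2_norm_diff_triangle) (use fs f \<phi>L in auto)
    finally show ?thesis using close N[OF that] L2_norm_diff_commute[of f \<phi>] \<open>e > 0\<close> by auto
  qed
  then show "\<exists>no. \<forall>n\<ge>no. norm (L2_norm (\<lambda>x. f (x + h n) - f x) - 0) < e" by blast
qed

section \<open>The Fourier integral of a Gaussian\<close>

lemma norm_cis_mult [simp]: "norm (cis a * z) = norm z"
  by (simp add: norm_mult)

lemma cis_measurable [measurable (raw)]: "g \<in> borel_measurable M \<Longrightarrow> (\<lambda>x. cis (g x)) \<in> borel_measurable M"
  by (rule measurable_compose[where g=cis]) (auto intro!: borel_measurable_continuous_onI continuous_on_cis continuous_intros)

text \<open>
  Lebesgue measure on a Euclidean space is the image of a product measure, so functions with
  separated variables integrate factor by factor.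
\<close>

lemma lborel_integral_prod:
  fixes f :: "'a::euclidean_space \<Rightarrow> real \<Rightarrow> complex"
  assumes "\<And>b. b \<in> Basis \<Longrightarrow> integrable lborel (f b)"
  shows "integrable lborel (\<lambda>x::'a. \<Prod>b\<in>Basis. f b (x \<bullet> b))"
    "(\<integral>x. (\<Prod>b\<in>Basis. f b (x \<bullet> b)) \<partial>lborel) = (\<Prod>b\<in>Basis. \<integral>t. f b t \<partial>lborel)"
proof -
  interpret product_sigma_finite "\<lambda>_::'a. lborel :: real measure" by standard
  have [measurable]: "\<And>b. b \<in> Basis \<Longrightarrow> f b \<in> borel_measurable borel" using assms by auto
  have *: "(\<Prod>b\<in>Basis. f b ((\<Sum>b\<in>Basis. x b *\<^sub>R b) \<bullet> b)) = (\<Prod>b\<in>Basis. f b (x b))" for x :: "'a \<Rightarrow> real"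
    by (rule prod.cong) auto
  have i: "integrable (\<Pi>\<^sub>M b\<in>Basis. lborel) (\<lambda>x. \<Prod>b\<in>Basis. f b (x b))"
    using assms by (intro product_integrable_prod) auto
  show "integrable lborel (\<lambda>x::'a. \<Prod>b\<in>Basis. f b (x \<bullet> b))"
    unfolding lborel_eq[where 'a='a] by (subst integrable_distr_eq) (auto simp: * i)
  show "(\<integral>x. (\<Prod>b\<in>Basis. f b (x \<bullet> b)) \<partial>lborel) = (\<Prod>b\<in>Basis. \<integral>t. f b t \<partial>lborel)"
    unfolding lborel_eq[where 'a='a]
    by (subst integral_distr) (use assms in \<open>auto simp: * product_integral_prod\<close>)
qed

text \<open>
  This is the characteristic function of the standard normal distribution, after the
  substitution \<open>y = sqrt (2 \<pi>) a t\<close>.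
\<close>

lemma gaussian_fourier_1d:
  assumes a: "a > 0"
  shows "integrable lborel (\<lambda>t. cis (- 2 * pi * (x * t)) * of_real (exp (- pi * a\<^sup>2 * t\<^sup>2)))"
    "(\<integral>t. cis (- 2 * pi * (x * t)) * of_real (exp (- pi * a\<^sup>2 * t\<^sup>2)) \<partial>lborel) = of_real (exp (- pi * x\<^sup>2 / a\<^sup>2) / a)"
proof -
  define s where "s = - sqrt (2 * pi) * x / a"
  define c where "c = sqrt (2 * pi) * a"
  have c0: "c > 0" using a by (simp add: c_def)
  define F where "F y = cis (s * y) * of_real (std_normal_density y)" for y
  have Fm[measurable]: "F \<in> borel_measurable borel" unfolding F_def by measurable
  have Fi: "integrable lborel F"
    unfolding F_def by (rule Bochner_Integration.integrable_bound[OF integrable_std_normal_moment[of 0]]) auto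
  have "complex_of_real (exp (- s\<^sup>2 / 2)) = char std_normal_distribution s"
    by (simp add: char_std_normal_distribution)
  also have "\<dots> = (\<integral>y. F y \<partial>lborel)" unfolding char_def F_def
    by (subst integral_density) (auto simp: cis_conv_exp scaleR_conv_of_real mult.commute)
  also have "\<dots> = c *\<^sub>R (\<integral>t. F (0 + c * t) \<partial>lborel)"
    using lborel_integral_real_affine[of c F 0] c0 by simp
  finally have 1: "(\<integral>t. F (c * t) \<partial>lborel) = complex_of_real (exp (- s\<^sup>2 / 2)) / of_real c"
    using c0 by (simp add: scaleR_conv_of_real field_simps)
  have sc: "s * (c * t) = - 2 * pi * (x * t)" for t
    using a by (simp add: s_def c_def field_simps)
  have F: "F (c * t) = (1 / sqrt (2 * pi)) *\<^sub>R (cis (- 2 * pi * (x * t)) * of_real (exp (- pi * a\<^sup>2 * t\<^sup>2)))" for t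
    by (simp only: F_def sc) (simp add: std_normal_density_def c_def power_mult_distrib scaleR_conv_of_real)
  have "integrable lborel (\<lambda>t. F (0 + c * t))"
    using c0 Fi by (intro lborel_integrable_real_affine) auto
  then have "integrable lborel (\<lambda>t. sqrt (2 * pi) *\<^sub>R F (c * t))" by simp
  then show "integrable lborel (\<lambda>t. cis (- 2 * pi * (x * t)) * of_real (exp (- pi * a\<^sup>2 * t\<^sup>2)))"
    unfolding F by simp
  have s2: "- s\<^sup>2 / 2 = - pi * x\<^sup>2 / a\<^sup>2" by (simp add: s_def power_divide power_mult_distrib)
  define I where "I = (\<integral>t. cis (- 2 * pi * (x * t)) * of_real (exp (- pi * a\<^sup>2 * t\<^sup>2)) \<partial>lborel)"
  have "(1 / sqrt (2 * pi)) *\<^sub>R I = (\<integral>t. F (c * t) \<partial>lborel)"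
    unfolding F I_def by (rule integral_scaleR_right[symmetric])
  also have "\<dots> = complex_of_real (exp (- pi * x\<^sup>2 / a\<^sup>2) / c)"
    unfolding 1 s2 by (simp only: of_real_divide)
  finally have e: "(1 / sqrt (2 * pi)) *\<^sub>R I = complex_of_real (exp (- pi * x\<^sup>2 / a\<^sup>2) / c)" .
  have "I = sqrt (2 * pi) *\<^sub>R ((1 / sqrt (2 * pi)) *\<^sub>R I)" by simp
  also have "\<dots> = of_real (sqrt (2 * pi) * (exp (- pi * x\<^sup>2 / a\<^sup>2) / c))"
    unfolding e by (simp only: scaleR_conv_of_real of_real_mult)
  also have "sqrt (2 * pi) * (exp (- pi * x\<^sup>2 / a\<^sup>2) / c) = exp (- pi * x\<^sup>2 / a\<^sup>2) / a"
  proof -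
    have "k * (E / (k * a)) = E / a" if "k > 0" for k E :: real using that by simp
    then show ?thesis unfolding c_def by (metis pi_gt_zero real_sqrt_gt_zero zero_less_mult_iff zero_less_numeral)
  qed
  finally show "(\<integral>t. cis (- 2 * pi * (x * t)) * of_real (exp (- pi * a\<^sup>2 * t\<^sup>2)) \<partial>lborel) = of_real (exp (- pi * x\<^sup>2 / a\<^sup>2) / a)"
    unfolding I_def .
qed

lemma cis_sum: "finite A \<Longrightarrow> cis (\<Sum>a\<in>A. f a) = (\<Prod>a\<in>A. cis (f a))"
  by (induction A rule: finite_induct) (auto simp: cis_mult[symmetric])

lemma gaussian_fourier:
  assumes a: "a > 0"
  shows "integrable lborel (\<lambda>\<xi>::real^2. cis (- 2 * pi * (x \<bullet> \<xi>)) * of_real (exp (- pi * a\<^sup>2 * (norm \<xi>)\<^sup>2)))" (is ?i)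
    and "(\<integral>\<xi>. cis (- 2 * pi * (x \<bullet> \<xi>)) * of_real (exp (- pi * a\<^sup>2 * (norm \<xi>)\<^sup>2)) \<partial>lborel) = of_real (exp (- pi * (norm (x :: real^2))\<^sup>2 / a\<^sup>2) / a\<^sup>2)" (is ?e)
proof -
  define f where "f b t = cis (- 2 * pi * ((x \<bullet> b) * t)) * of_real (exp (- pi * a\<^sup>2 * t\<^sup>2))" for b :: "real^2" and t
  have eq: "cis (- 2 * pi * (x \<bullet> \<xi>)) * of_real (exp (- pi * a\<^sup>2 * (norm \<xi>)\<^sup>2)) = (\<Prod>b\<in>Basis. f b (\<xi> \<bullet> b))" for \<xi> :: "real^2"
  proof -
    have 1: "- 2 * pi * (x \<bullet> \<xi>) = (\<Sum>b\<in>Basis. - 2 * pi * ((x \<bullet> b) * (\<xi> \<bullet> b)))"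
      by (subst euclidean_inner) (simp add: sum_distrib_left)
    have 2: "- pi * a\<^sup>2 * (norm \<xi>)\<^sup>2 = (\<Sum>b\<in>Basis. - pi * a\<^sup>2 * (\<xi> \<bullet> b)\<^sup>2)"
      unfolding power2_norm_eq_inner euclidean_inner[of \<xi> \<xi>] sum_distrib_left by (simp add: power2_eq_square)
    show ?thesis unfolding 1 2 f_def
      by (simp add: cis_sum exp_sum prod.distrib)
  qed
  have i: "integrable lborel (f b)" for b unfolding f_def using gaussian_fourier_1d(1)[OF a] by simp
  show ?i unfolding eq by (rule lborel_integral_prod(1)) (rule i)
  have "(\<integral>\<xi>. (\<Prod>b\<in>Basis. f b (\<xi> \<bullet> b)) \<partial>lborel) = (\<Prod>b\<in>Basis. of_real (exp (- pi * (x \<bullet> b)\<^sup>2 / a\<^sup>2) / a))"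
    unfolding lborel_integral_prod(2)[OF i]
    by (rule prod.cong[OF refl]) (simp only: f_def[abs_def] gaussian_fourier_1d(2)[OF a])
  also have "\<dots> = of_real ((\<Prod>b\<in>(Basis::(real^2) set). exp (- pi * (x \<bullet> b)\<^sup>2 / a\<^sup>2)) / a\<^sup>2)"
    by (simp only: of_real_prod[symmetric] prod_dividef) simp
  also have "(\<Prod>b\<in>(Basis::(real^2) set). exp (- pi * (x \<bullet> b)\<^sup>2 / a\<^sup>2)) = exp (\<Sum>b\<in>Basis. - pi * (x \<bullet> b)\<^sup>2 / a\<^sup>2)"
    by (simp only: exp_sum finite_Basis)
  also have "(\<Sum>b\<in>Basis. - pi * (x \<bullet> b)\<^sup>2 / a\<^sup>2) = - pi * (norm x)\<^sup>2 / a\<^sup>2"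
    unfolding power2_norm_eq_inner euclidean_inner[of x x] sum_distrib_left sum_divide_distrib
    by (simp only: power2_eq_square)
  finally show ?e unfolding eq .
qed

section \<open>Plancherel's theorem\<close>

abbreviation FI where "FI \<equiv> fourier_integral"

lemma borel_measurable_fourier_integral [measurable]:
  assumes [measurable]: "f \<in> borel_measurable borel"
  shows "FI f \<in> borel_measurable borel"
  unfolding fourier_integral_def[abs_def] by measurable

lemma fourier_integrable:
  assumes "integrable lborel f" shows "integrable lborel (\<lambda>x. cis (c * (\<xi> \<bullet> x)) * f x)"
proof -
  have [measurable]: "f \<in> borel_measurable borel" using assms by auto
  show ?thesis by (rule Bochner_Integration.integrable_bound[OF assms]) auto
qed

lemma fourier_integral_bound:
  shows "norm (FI f \<xi>) \<le> (\<integral>x. norm (f x) \<partial>lborel)"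
  unfolding fourier_integral_def by (rule order_trans[OF integral_norm_bound]) simp

lemma fourier_integral_add: "integrable lborel f \<Longrightarrow> integrable lborel g \<Longrightarrow> FI (\<lambda>x. f x + g x) \<xi> = FI f \<xi> + FI g \<xi>"
  unfolding fourier_integral_def distrib_left by (intro Bochner_Integration.integral_add fourier_integrable)

lemma fourier_integral_diff: "integrable lborel f \<Longrightarrow> integrable lborel g \<Longrightarrow> FI (\<lambda>x. f x - g x) \<xi> = FI f \<xi> - FI g \<xi>"
  unfolding fourier_integral_def right_diff_distrib by (intro Bochner_Integration.integral_diff fourier_integrable)

lemma fourier_integral_cmult: "FI (\<lambda>x. c * f x) \<xi> = c * FI f \<xi>"
proof -
  have "FI (\<lambda>x. c * f x) \<xi> = (\<integral>x. c * (cis (- 2 * pi * (\<xi> \<bullet> x)) * f x) \<partial>lborel)"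
    unfolding fourier_integral_def by (rule Bochner_Integration.integral_cong) auto
  then show ?thesis by (simp add: fourier_integral_def)
qed

lemma fourier_integral_shift:
  assumes [measurable]: "f \<in> borel_measurable borel"
  shows "FI (\<lambda>x. f (x + y)) \<xi> = cis (2 * pi * (\<xi> \<bullet> y)) * FI f \<xi>"
proof -
  have "FI f \<xi> = (\<integral>x. cis (- 2 * pi * (\<xi> \<bullet> (x + y))) * f (x + y) \<partial>lborel)"
    unfolding fourier_integral_def
    by (rule lborel_integral_shift[symmetric, where f="\<lambda>x. cis (- 2 * pi * (\<xi> \<bullet> x)) * f x"]) measurable
  also have "\<dots> = (\<integral>x. cis (- 2 * pi * (\<xi> \<bullet> y)) * (cis (- 2 * pi * (\<xi> \<bullet> x)) * f (x + y)) \<partial>lborel)"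
    unfolding mult.assoc[symmetric] cis_mult inner_add_right by (simp add: algebra_simps)
  also have "\<dots> = cis (- 2 * pi * (\<xi> \<bullet> y)) * FI (\<lambda>x. f (x + y)) \<xi>"
    by (simp add: fourier_integral_def)
  finally have e: "FI f \<xi> = cis (- 2 * pi * (\<xi> \<bullet> y)) * FI (\<lambda>x. f (x + y)) \<xi>" .
  show ?thesis unfolding e mult.assoc[symmetric] cis_mult by simp
qed

lemma fourier_integral_cnj: "FI (\<lambda>x. cnj (f x)) \<xi> = cnj (FI f (- \<xi>))"
  unfolding fourier_integral_def by (subst Bochner_Integration.integral_cnj[symmetric]) (simp add: cis_cnj)

text \<open>
  The common reason for all exchanges of integrals with an exponential kernel: the integrand
  is dominated by a multiple of the product of two integrable functions.
\<close>

lemma Fubini_bounded_kernel: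
  fixes f g :: "real^2 \<Rightarrow> complex" and K :: "real^2 \<Rightarrow> real^2 \<Rightarrow> complex"
  assumes f: "integrable lborel f" and g: "integrable lborel g"
    and K[measurable]: "case_prod K \<in> borel_measurable (borel \<Otimes>\<^sub>M borel)" and C: "\<And>x y. norm (K x y) \<le> C"
  shows "(\<integral>x. \<integral>y. f x * g y * K x y \<partial>lborel \<partial>lborel) = (\<integral>y. \<integral>x. f x * g y * K x y \<partial>lborel \<partial>lborel)"
proof -
  have [measurable]: "f \<in> borel_measurable borel" "g \<in> borel_measurable borel" using f g by auto
  have C0: "0 \<le> C" using C[of 0 0] norm_ge_zero order_trans by blast
  have le: "norm (f x * g y * K x y) \<le> (C * norm (f x)) * norm (g y)" for x y
    using mult_left_mono[OF C[of x y], of "norm (f x) * norm (g y)"] by (simp add: norm_mult mult_ac)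
  have b: "integrable lborel (\<lambda>y. (C * norm (f x)) * norm (g y))" for x using g by simp
  have inner: "integrable lborel (\<lambda>y. f x * g y * K x y)" for x
    by (rule Bochner_Integration.integrable_bound[OF b[of x]]) (use le C0 in \<open>auto simp: abs_mult\<close>)
  have "integrable (lborel \<Otimes>\<^sub>M lborel) (\<lambda>(x, y). f x * g y * K x y)"
  proof (rule lborel_pair.Fubini_integrable)
    show "(\<lambda>(x, y). f x * g y * K x y) \<in> borel_measurable (lborel \<Otimes>\<^sub>M lborel)" by measurable
    show "integrable lborel (\<lambda>x. \<integral>y. norm (case (x, y) of (x, y) \<Rightarrow> f x * g y * K x y) \<partial>lborel)"
    proof (rule Bochner_Integration.integrable_bound)
      show "integrable lborel (\<lambda>x. C * (\<integral>y. norm (g y) \<partial>lborel) * norm (f x))" using f by simp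
      show "AE x in lborel. norm (\<integral>y. norm (case (x, y) of (x, y) \<Rightarrow> f x * g y * K x y) \<partial>lborel)
          \<le> norm (C * (\<integral>y. norm (g y) \<partial>lborel) * norm (f x))"
      proof (rule AE_I2)
        fix x
        have "(\<integral>y. norm (f x * g y * K x y) \<partial>lborel) \<le> (\<integral>y. (C * norm (f x)) * norm (g y) \<partial>lborel)"
          by (rule integral_mono[OF integrable_norm[OF inner] b le])
        then show "norm (\<integral>y. norm (case (x, y) of (x, y) \<Rightarrow> f x * g y * K x y) \<partial>lborel)
          \<le> norm (C * (\<integral>y. norm (g y) \<partial>lborel) * norm (f x))"
          using C0 by (simp add: abs_mult mult_ac)
      qed
    qed measurable
    show "AE x in lborel. integrable lborel (\<lambda>y. case (x, y) of (x, y) \<Rightarrow> f x * g y * K x y)"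
      using inner by simp
  qed
  from lborel_pair.Fubini_integral[OF this] show ?thesis by simp
qed

lemma fourier_integral_mult:
  assumes f: "integrable lborel f" and g: "integrable lborel g"
  shows "(\<integral>\<xi>. FI f \<xi> * g \<xi> \<partial>lborel) = (\<integral>x. f x * FI g x \<partial>lborel)"
proof -
  have "(\<integral>\<xi>. FI f \<xi> * g \<xi> \<partial>lborel) = (\<integral>\<xi>. \<integral>x. f x * g \<xi> * cis (- 2 * pi * (\<xi> \<bullet> x)) \<partial>lborel \<partial>lborel)"
    unfolding fourier_integral_def
    by (subst Bochner_Integration.integral_mult_left_zero[symmetric]) (simp add: mult_ac)
  also have "\<dots> = (\<integral>x. \<integral>\<xi>. f x * g \<xi> * cis (- 2 * pi * (\<xi> \<bullet> x)) \<partial>lborel \<partial>lborel)"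
    by (rule Fubini_bounded_kernel[OF f g, where C=1, symmetric]) auto
  also have "\<dots> = (\<integral>x. f x * FI g x \<partial>lborel)"
    unfolding fourier_integral_def
    by (subst Bochner_Integration.integral_mult_right_zero[symmetric]) (simp add: mult_ac inner_commute)
  finally show ?thesis .
qed

text \<open>
  The Gaussian weight makes the left side finite before square integrability of the transform
  is known. Its own transform is an approximate identity of width \<open>a\<close>, so the right side is
  an average of the autocorrelation of \<open>f\<close> over translations of size \<open>a\<close>.
\<close>

lemma gaussian_mean_square:
  assumes f: "integrable lborel f" "f \<in> L2" and a: "a > 0"
  shows "complex_of_real (\<integral>\<xi>. (cmod (FI f \<xi>))\<^sup>2 * exp (- pi * a\<^sup>2 * (norm \<xi>)\<^sup>2) \<partial>lborel)
    = (\<integral>k. of_real (exp (- pi * (norm k)\<^sup>2)) * L2_inner f (\<lambda>x. f (x + a *\<^sub>R k)) \<partial>lborel)"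
proof -
  have [measurable]: "f \<in> borel_measurable borel" using f by auto
  define \<gamma> where "\<gamma> \<xi> = complex_of_real (exp (- pi * a\<^sup>2 * (norm \<xi>)\<^sup>2))" for \<xi> :: "real^2"
  define \<Gamma> where "\<Gamma> x = complex_of_real (exp (- pi * (norm x)\<^sup>2 / a\<^sup>2) / a\<^sup>2)" for x :: "real^2"
  have [measurable]: "\<gamma> \<in> borel_measurable borel" "\<Gamma> \<in> borel_measurable borel" unfolding \<gamma>_def \<Gamma>_def by measurable
  have \<gamma>_int: "integrable lborel (\<lambda>\<xi>. cis (- 2 * pi * (x \<bullet> \<xi>)) * \<gamma> \<xi>)"
    and \<gamma>_FI: "(\<integral>\<xi>. cis (- 2 * pi * (x \<bullet> \<xi>)) * \<gamma> \<xi> \<partial>lborel) = \<Gamma> x" for x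
    using gaussian_fourier[OF a, of x] by (auto simp: \<gamma>_def \<Gamma>_def)
  have \<gamma>_int0: "integrable lborel \<gamma>" using \<gamma>_int[of 0] by simp
  have \<Gamma>_int: "integrable lborel \<Gamma>"
  proof -
    have 1: "1/a > 0" using a by simp
    have "\<Gamma> = (\<lambda>x. of_real (1/a\<^sup>2) * (cis (- 2 * pi * (0 \<bullet> x)) * of_real (exp (- pi * (1/a)\<^sup>2 * (norm x)\<^sup>2))))"
      by (auto simp: \<Gamma>_def fun_eq_iff power_divide)
    then show ?thesis using integrable_mult_right[OF gaussian_fourier(1)[OF 1, of 0], of "of_real (1/a\<^sup>2)"]
      by (simp only:)
  qed
  \<comment> \<open>\<open>g\<close> is the conjugate transform with the weight; its own transform is \<open>f\<close>, conjugated and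
    averaged over Gaussian translations\<close>
  define g where "g \<xi> = cnj (FI f \<xi>) * \<gamma> \<xi>" for \<xi>
  have [measurable]: "g \<in> borel_measurable borel" unfolding g_def[abs_def]
    by (intro borel_measurable_times borel_measurable_fourier_integral borel_measurable_continuous_on[of cnj] continuous_intros) auto
  have g_int: "integrable lborel g"
  proof (rule Bochner_Integration.integrable_bound)
    show "integrable lborel (\<lambda>\<xi>. of_real (\<integral>x. norm (f x) \<partial>lborel) * \<gamma> \<xi>)" using \<gamma>_int0 by simp
    have "norm (g \<xi>) \<le> norm (of_real (\<integral>x. norm (f x) \<partial>lborel) * \<gamma> \<xi>)" for \<xi>
      unfolding g_def norm_mult using fourier_integral_bound[of f \<xi>]
      by (intro mult_right_mono) (auto intro: order_trans)
    then show "AE \<xi> in lborel. norm (g \<xi>) \<le> norm (of_real (\<integral>x. norm (f x) \<partial>lborel) * \<gamma> \<xi>)" by (intro AE_I2)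
  qed measurable
  have cf: "integrable lborel (\<lambda>x. cnj (f x))" using f(1) by (simp)
  have FIg: "FI g x = (\<integral>h. cnj (f (x + h)) * \<Gamma> h \<partial>lborel)" for x
  proof -
    have "FI g x = (\<integral>\<xi>. \<integral>y. (cis (- 2 * pi * (x \<bullet> \<xi>)) * \<gamma> \<xi>) * cnj (f y) * cis (2 * pi * (\<xi> \<bullet> y)) \<partial>lborel \<partial>lborel)"
      unfolding fourier_integral_def[of g] g_def
    proof (rule Bochner_Integration.integral_cong[OF refl])
      fix \<xi>
      have "cnj (FI f \<xi>) = (\<integral>y. cis (2 * pi * (\<xi> \<bullet> y)) * cnj (f y) \<partial>lborel)"
        unfolding fourier_integral_def by (subst Bochner_Integration.integral_cnj[symmetric]) (simp add: cis_cnj)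
      then have "cis (- 2 * pi * (x \<bullet> \<xi>)) * (cnj (FI f \<xi>) * \<gamma> \<xi>) = (cis (- 2 * pi * (x \<bullet> \<xi>)) * \<gamma> \<xi>) * (\<integral>y. cis (2 * pi * (\<xi> \<bullet> y)) * cnj (f y) \<partial>lborel)"
        by simp
      also have "\<dots> = (\<integral>y. (cis (- 2 * pi * (x \<bullet> \<xi>)) * \<gamma> \<xi>) * cnj (f y) * cis (2 * pi * (\<xi> \<bullet> y)) \<partial>lborel)"
        by (subst Bochner_Integration.integral_mult_right_zero[symmetric]) (simp add: mult_ac)
      finally show "cis (- 2 * pi * (x \<bullet> \<xi>)) * (cnj (FI f \<xi>) * \<gamma> \<xi>) = \<dots>" .
    qed
    also have "\<dots> = (\<integral>y. \<integral>\<xi>. (cis (- 2 * pi * (x \<bullet> \<xi>)) * \<gamma> \<xi>) * cnj (f y) * cis (2 * pi * (\<xi> \<bullet> y)) \<partial>lborel \<partial>lborel)"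
      by (rule Fubini_bounded_kernel[OF \<gamma>_int cf, where C=1]) auto
    also have "\<dots> = (\<integral>y. cnj (f y) * \<Gamma> (x - y) \<partial>lborel)"
    proof (rule Bochner_Integration.integral_cong[OF refl])
      fix y
      have "(\<integral>\<xi>. (cis (- 2 * pi * (x \<bullet> \<xi>)) * \<gamma> \<xi>) * cnj (f y) * cis (2 * pi * (\<xi> \<bullet> y)) \<partial>lborel)
          = (\<integral>\<xi>. cnj (f y) * (cis (- 2 * pi * ((x - y) \<bullet> \<xi>)) * \<gamma> \<xi>) \<partial>lborel)"
      proof (rule Bochner_Integration.integral_cong[OF refl])
        fix \<xi>
        have "cis (- 2 * pi * ((x - y) \<bullet> \<xi>)) = cis (- 2 * pi * (x \<bullet> \<xi>)) * cis (2 * pi * (\<xi> \<bullet> y))"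
          unfolding cis_mult by (rule arg_cong[where f=cis]) (simp add: inner_diff_left inner_commute algebra_simps)
        then show "(cis (- 2 * pi * (x \<bullet> \<xi>)) * \<gamma> \<xi>) * cnj (f y) * cis (2 * pi * (\<xi> \<bullet> y)) = cnj (f y) * (cis (- 2 * pi * ((x - y) \<bullet> \<xi>)) * \<gamma> \<xi>)"
          by (simp only: mult_ac)
      qed
      then show "(\<integral>\<xi>. (cis (- 2 * pi * (x \<bullet> \<xi>)) * \<gamma> \<xi>) * cnj (f y) * cis (2 * pi * (\<xi> \<bullet> y)) \<partial>lborel) = cnj (f y) * \<Gamma> (x - y)"
        by (simp only: \<gamma>_FI Bochner_Integration.integral_mult_right_zero)
    qed
    also have "\<dots> = (\<integral>h. cnj (f (h + x)) * \<Gamma> (x - (h + x)) \<partial>lborel)"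
    proof (rule lborel_integral_shift[symmetric, where f="\<lambda>y. cnj (f y) * \<Gamma> (x - y)"])
      have [measurable]: "(\<lambda>y. cnj (f y)) \<in> borel_measurable borel" by (rule L2_measurable[OF L2_cnj[OF f(2)]])
      show "(\<lambda>y. cnj (f y) * \<Gamma> (x - y)) \<in> borel_measurable borel" by measurable
    qed
    also have "\<dots> = (\<integral>h. cnj (f (x + h)) * \<Gamma> h \<partial>lborel)"
      by (simp add: \<Gamma>_def add.commute)
    finally show ?thesis .
  qed
  have A_le: "(\<integral>x. norm (f x) * norm (f (x + h)) \<partial>lborel) \<le> (L2_norm f)\<^sup>2" for h
    using L2_Cauchy_Schwarz_norm[OF f(2) L2_shift[OF f(2), of h]] by (simp add: L2_norm_shift[OF f(2)] power2_eq_square)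
  have A_int: "integrable lborel (\<lambda>x. f x * cnj (f (x + h)))" for h
    by (rule L2_integrable_inner[OF f(2) L2_shift[OF f(2)]])
  have [measurable]: "(\<lambda>x. cnj (f x)) \<in> borel_measurable borel" by (rule L2_measurable[OF L2_cnj[OF f(2)]])
  have int: "integrable (lborel \<Otimes>\<^sub>M lborel) (\<lambda>(h, x). f x * cnj (f (x + h)) * \<Gamma> h)"
  proof (rule lborel_pair.Fubini_integrable)
    show "(\<lambda>(h, x). f x * cnj (f (x + h)) * \<Gamma> h) \<in> borel_measurable (lborel \<Otimes>\<^sub>M lborel)"
    proof -
      have "(\<lambda>p. (\<lambda>x. cnj (f x)) (snd p + fst p)) \<in> borel_measurable (lborel \<Otimes>\<^sub>M lborel)"
        by (rule measurable_compose[where g="\<lambda>x. cnj (f x)" and N=borel]) measurable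
      then have [measurable]: "(\<lambda>p. cnj (f (snd p + fst p))) \<in> borel_measurable (lborel \<Otimes>\<^sub>M lborel)" by simp
      show ?thesis unfolding case_prod_unfold by measurable
    qed
    have eq: "(\<integral>x. norm (f x * cnj (f (x + h)) * \<Gamma> h) \<partial>lborel) = (\<integral>x. norm (f x) * norm (f (x + h)) \<partial>lborel) * norm (\<Gamma> h)" for h
      by (simp add: norm_mult)
    show "integrable lborel (\<lambda>h. \<integral>x. norm (case (h, x) of (h, x) \<Rightarrow> f x * cnj (f (x + h)) * \<Gamma> h) \<partial>lborel)"
    proof (rule Bochner_Integration.integrable_bound)
      show "integrable lborel (\<lambda>h. (L2_norm f)\<^sup>2 * norm (\<Gamma> h))" using \<Gamma>_int by simp
      show "AE h in lborel. norm (\<integral>x. norm (case (h, x) of (h, x) \<Rightarrow> f x * cnj (f (x + h)) * \<Gamma> h) \<partial>lborel) \<le> norm ((L2_norm f)\<^sup>2 * norm (\<Gamma> h))"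
        using A_le by (auto simp: eq abs_mult intro!: mult_right_mono)
    qed measurable
    show "AE h in lborel. integrable lborel (\<lambda>x. case (h, x) of (h, x) \<Rightarrow> f x * cnj (f (x + h)) * \<Gamma> h)"
      using A_int by simp
  qed
  \<comment> \<open>multiplication formula, exchange of the integrals, and the substitution \<open>h = a k\<close>\<close>
  have "complex_of_real (\<integral>\<xi>. (cmod (FI f \<xi>))\<^sup>2 * exp (- pi * a\<^sup>2 * (norm \<xi>)\<^sup>2) \<partial>lborel) = (\<integral>\<xi>. FI f \<xi> * g \<xi> \<partial>lborel)"
    unfolding integral_complex_of_real[symmetric] g_def \<gamma>_def
    by (rule Bochner_Integration.integral_cong[OF refl]) (simp add: complex_norm_square mult.assoc[symmetric] flip: of_real_power)
  also have "\<dots> = (\<integral>x. f x * FI g x \<partial>lborel)" by (rule fourier_integral_mult[OF f(1) g_int])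
  also have "\<dots> = (\<integral>x. \<integral>h. f x * cnj (f (x + h)) * \<Gamma> h \<partial>lborel \<partial>lborel)"
    unfolding FIg by (subst Bochner_Integration.integral_mult_right_zero[symmetric]) (simp add: mult.assoc)
  also have "\<dots> = (\<integral>h. \<integral>x. f x * cnj (f (x + h)) * \<Gamma> h \<partial>lborel \<partial>lborel)"
    by (rule lborel_pair.Fubini_integral[OF int])
  also have "\<dots> = (\<integral>h. \<Gamma> h * L2_inner f (\<lambda>x. f (x + h)) \<partial>lborel)"
    unfolding L2_inner_def by (simp add: mult.commute)
  also have "\<dots> = a\<^sup>2 *\<^sub>R (\<integral>k. \<Gamma> (a *\<^sub>R k) * L2_inner f (\<lambda>x. f (x + a *\<^sub>R k)) \<partial>lborel)"
  proof (rule lborel_integral_scale[where f="\<lambda>h. \<Gamma> h * L2_inner f (\<lambda>x. f (x + h))"])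
    have "(\<lambda>(h, x). f x * cnj (f (x + h)) * \<Gamma> h) \<in> borel_measurable (lborel \<Otimes>\<^sub>M lborel)" using int by auto
    then have "(\<lambda>h. \<integral>x. f x * cnj (f (x + h)) * \<Gamma> h \<partial>lborel) \<in> borel_measurable lborel"
      by (intro lborel.borel_measurable_lebesgue_integral)
    then show "(\<lambda>h. \<Gamma> h * L2_inner f (\<lambda>x. f (x + h))) \<in> borel_measurable borel"
      by (simp add: L2_inner_def mult.commute)
  qed (use a in simp)
  also have "\<dots> = (\<integral>k. of_real (exp (- pi * (norm k)\<^sup>2)) * L2_inner f (\<lambda>x. f (x + a *\<^sub>R k)) \<partial>lborel)"
  proof -
    have "\<Gamma> (a *\<^sub>R k) = of_real (exp (- pi * (norm k)\<^sup>2)) / of_real (a\<^sup>2)" for k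
      using a by (simp add: \<Gamma>_def power_mult_distrib)
    then have "a\<^sup>2 *\<^sub>R (\<Gamma> (a *\<^sub>R k) * z) = of_real (exp (- pi * (norm k)\<^sup>2)) * z" for k z
      using a by (simp add: scaleR_conv_of_real)
    then show ?thesis by (simp only: integral_scaleR_right[symmetric])
  qed
  finally show ?thesis .
qed

text \<open>
  Let \<open>a\<close> tend to zero in the preceding identity. The right side tends to \<open>\<parallel>f\<parallel>\<^sup>2\<close> because
  translations are continuous. Boundedness of the left side gives square integrability by
  Fatou's lemma, and then dominated convergence gives its limit.
\<close>

lemma fourier_integral_Plancherel:
  assumes f: "integrable lborel f" "f \<in> L2"
  shows "FI f \<in> L2" "L2_norm (FI f) = L2_norm f"
proof -
  have [measurable]: "f \<in> borel_measurable borel" using f by auto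
  define a where "a n = 1 / real (Suc n)" for n
  have a: "a n > 0" "a n \<le> 1" for n by (auto simp: a_def)
  have a_lim: "a \<longlonglongrightarrow> 0" unfolding a_def by (rule LIMSEQ_Suc[OF lim_1_over_n])
  define J where "J n = (\<integral>\<xi>. (cmod (FI f \<xi>))\<^sup>2 * exp (- pi * (a n)\<^sup>2 * (norm \<xi>)\<^sup>2) \<partial>lborel)" for n
  have G: "integrable lborel (\<lambda>k::real^2. exp (- pi * (norm k)\<^sup>2))" "(\<integral>k. exp (- pi * (norm (k::real^2))\<^sup>2) \<partial>lborel) = 1"
  proof -
    have "integrable lborel (\<lambda>k::real^2. complex_of_real (exp (- pi * (norm k)\<^sup>2)))"
      using gaussian_fourier(1)[of 1 0] by simp
    then show "integrable lborel (\<lambda>k::real^2. exp (- pi * (norm k)\<^sup>2))" by (simp only: complex_of_real_integrable_eq)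
    have "(\<integral>k. complex_of_real (exp (- pi * (norm (k::real^2))\<^sup>2)) \<partial>lborel) = 1"
      using gaussian_fourier(2)[of 1 0] by simp
    then show "(\<integral>k. exp (- pi * (norm (k::real^2))\<^sup>2) \<partial>lborel) = 1"
      by (simp only: integral_complex_of_real of_real_eq_1_iff)
  qed
  have inner_lim: "(\<lambda>n. L2_inner f (\<lambda>x. f (x + a n *\<^sub>R k))) \<longlonglongrightarrow> L2_inner f f" for k
  proof (rule LIM_zero_cancel, rule Lim_null_comparison)
    have "(\<lambda>n. a n *\<^sub>R k) \<longlonglongrightarrow> 0" using tendsto_scaleR[OF a_lim tendsto_const[of k]] by simp
    then have "(\<lambda>n. L2_norm (\<lambda>x. f (x + a n *\<^sub>R k) - f x)) \<longlonglongrightarrow> 0"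
      by (rule L2_translation_continuous[OF f(2)])
    then show "(\<lambda>n. L2_norm f * L2_norm (\<lambda>x. f (x + a n *\<^sub>R k) - f x)) \<longlonglongrightarrow> 0"
      by (rule tendsto_mult_right_zero)
    show "\<forall>\<^sub>F n in sequentially. norm (L2_inner f (\<lambda>x. f (x + a n *\<^sub>R k)) - L2_inner f f) \<le> L2_norm f * L2_norm (\<lambda>x. f (x + a n *\<^sub>R k) - f x)"
      using L2_Cauchy_Schwarz[OF f(2) L2_diff[OF L2_shift[OF f(2)] f(2)]]
      by (intro always_eventually allI) (simp add: L2_inner_diff_right L2_shift f)
  qed
  have inner_le: "norm (L2_inner f (\<lambda>x. f (x + y))) \<le> (L2_norm f)\<^sup>2" for y
    using L2_Cauchy_Schwarz[OF f(2) L2_shift[OF f(2), of y]] by (simp add: L2_norm_shift f power2_eq_square)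
  have Jeq: "complex_of_real (J n) = (\<integral>k. of_real (exp (- pi * (norm k)\<^sup>2)) * L2_inner f (\<lambda>x. f (x + a n *\<^sub>R k)) \<partial>lborel)" for n
    unfolding J_def by (rule gaussian_mean_square[OF f a(1)])
  have inner_meas[measurable]: "(\<lambda>k. L2_inner f (\<lambda>x. f (x + c *\<^sub>R k))) \<in> borel_measurable borel" for c
  proof -
    have [measurable]: "(\<lambda>x. cnj (f x)) \<in> borel_measurable borel" using L2_cnj[OF f(2)] by auto
    have "(\<lambda>p. (\<lambda>x. cnj (f x)) (snd p + c *\<^sub>R fst p)) \<in> borel_measurable (lborel \<Otimes>\<^sub>M lborel)"
      by (rule measurable_compose[where g="\<lambda>x. cnj (f x)" and N=borel]) measurable
    then have [measurable]: "(\<lambda>p. cnj (f (snd p + c *\<^sub>R fst p))) \<in> borel_measurable (lborel \<Otimes>\<^sub>M lborel)" by simp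
    have "(\<lambda>(k, x). f x * cnj (f (x + c *\<^sub>R k))) \<in> borel_measurable (lborel \<Otimes>\<^sub>M lborel)"
      unfolding case_prod_unfold by measurable
    then have "(\<lambda>k. \<integral>x. f x * cnj (f (x + c *\<^sub>R k)) \<partial>lborel) \<in> borel_measurable lborel"
      by (intro lborel.borel_measurable_lebesgue_integral)
    then show ?thesis by (simp add: L2_inner_def)
  qed
  have "(\<lambda>n. complex_of_real (J n)) \<longlonglongrightarrow> (\<integral>k. of_real (exp (- pi * (norm (k::real^2))\<^sup>2)) * L2_inner f f \<partial>lborel)"
    unfolding Jeq
  proof (rule integral_dominated_convergence[where w="\<lambda>k. exp (- pi * (norm k)\<^sup>2) * (L2_norm f)\<^sup>2"])
    show "integrable lborel (\<lambda>k::real^2. exp (- pi * (norm k)\<^sup>2) * (L2_norm f)\<^sup>2)" using G(1) by simp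
    show "AE k in lborel. (\<lambda>n. complex_of_real (exp (- pi * (norm k)\<^sup>2)) * L2_inner f (\<lambda>x. f (x + a n *\<^sub>R k))) \<longlonglongrightarrow> of_real (exp (- pi * (norm k)\<^sup>2)) * L2_inner f f"
      by (intro AE_I2 tendsto_mult_left inner_lim)
    show "AE k in lborel. norm (complex_of_real (exp (- pi * (norm k)\<^sup>2)) * L2_inner f (\<lambda>x. f (x + a n *\<^sub>R k))) \<le> exp (- pi * (norm k)\<^sup>2) * (L2_norm f)\<^sup>2" for n
      using inner_le by (intro AE_I2) (simp add: norm_mult)
  qed measurable
  also have "(\<integral>k. of_real (exp (- pi * (norm (k::real^2))\<^sup>2)) * L2_inner f f \<partial>lborel) = complex_of_real ((L2_norm f)\<^sup>2)"
    by (simp only: Bochner_Integration.integral_mult_left_zero integral_complex_of_real G L2_inner_self) simp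
  finally have J_lim: "J \<longlonglongrightarrow> (L2_norm f)\<^sup>2" by (simp only: tendsto_of_real_iff)
  define w where "w n \<xi> = exp (- pi * (a n)\<^sup>2 * (norm \<xi>)\<^sup>2 / 2)" for n and \<xi> :: "real^2"
  have [measurable]: "w n \<in> borel_measurable borel" for n unfolding w_def by measurable
  have w: "0 \<le> w n \<xi>" "w n \<xi> \<le> 1" for n \<xi> by (auto simp: w_def)
  have w_lim: "(\<lambda>n. w n \<xi>) \<longlonglongrightarrow> 1" for \<xi>
    unfolding w_def by (rule tendsto_eq_intros a_lim refl | simp)+
  define h where "h n \<xi> = complex_of_real (w n \<xi>) * FI f \<xi>" for n \<xi>
  have [measurable]: "h n \<in> borel_measurable borel" for n unfolding h_def by measurable
  have h_sq: "(norm (h n \<xi>))\<^sup>2 = (cmod (FI f \<xi>))\<^sup>2 * exp (- pi * (a n)\<^sup>2 * (norm \<xi>)\<^sup>2)" for n \<xi>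
    by (simp add: h_def norm_mult power_mult_distrib w_def exp_double[symmetric] mult.commute)
  have hL: "h n \<in> L2" for n
  proof -
    have "integrable lborel (\<lambda>\<xi>. (norm (h n \<xi>))\<^sup>2)"
    proof (rule Bochner_Integration.integrable_bound)
      have "integrable lborel (\<lambda>\<xi>::real^2. complex_of_real (exp (- pi * (a n)\<^sup>2 * (norm \<xi>)\<^sup>2)))"
        using gaussian_fourier(1)[OF a(1)[of n], of 0] by simp
      then show "integrable lborel (\<lambda>\<xi>::real^2. (\<integral>x. norm (f x) \<partial>lborel)\<^sup>2 * exp (- pi * (a n)\<^sup>2 * (norm \<xi>)\<^sup>2))"
        by (simp only: complex_of_real_integrable_eq integrable_mult_right)
      show "AE \<xi> in lborel. norm ((norm (h n \<xi>))\<^sup>2) \<le> norm ((\<integral>x. norm (f x) \<partial>lborel)\<^sup>2 * exp (- pi * (a n)\<^sup>2 * (norm \<xi>)\<^sup>2))"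
        unfolding h_sq using fourier_integral_bound[of f] by (intro AE_I2) (auto simp: abs_mult intro!: mult_right_mono power_mono)
    qed measurable
    then show ?thesis by (simp add: L2_iff)
  qed
  have h_norm: "(L2_norm (h n))\<^sup>2 = J n" for n unfolding L2_norm_sq h_sq J_def ..
  have h_lim: "(\<lambda>n. h n \<xi>) \<longlonglongrightarrow> FI f \<xi>" for \<xi>
  proof -
    have "(\<lambda>n. complex_of_real (w n \<xi>) * FI f \<xi>) \<longlonglongrightarrow> of_real 1 * FI f \<xi>"
      by (intro tendsto_intros w_lim)
    then show ?thesis by (simp add: h_def)
  qed
  have "J n \<le> (L2_norm f)\<^sup>2 + 1" if "J n < (L2_norm f)\<^sup>2 + 1" for n using that by simp
  moreover have "\<forall>\<^sub>F n in sequentially. J n < (L2_norm f)\<^sup>2 + 1" using J_lim by (rule order_tendstoD) simp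
  ultimately have "\<forall>\<^sub>F n in sequentially. (L2_norm (h n))\<^sup>2 \<le> (L2_norm f)\<^sup>2 + 1"
    unfolding h_norm by (rule eventually_mono[rotated])
  then show FL: "FI f \<in> L2" using h_lim by (intro L2_Fatou(1)[of h "FI f"] hL) auto
  have "(\<lambda>n. \<integral>\<xi>. (cmod (FI f \<xi>))\<^sup>2 * exp (- pi * (a n)\<^sup>2 * (norm \<xi>)\<^sup>2) \<partial>lborel) \<longlonglongrightarrow> (\<integral>\<xi>. (cmod (FI f \<xi>))\<^sup>2 \<partial>lborel)"
  proof (rule integral_dominated_convergence[where w="\<lambda>\<xi>. (cmod (FI f \<xi>))\<^sup>2"])
    show "integrable lborel (\<lambda>\<xi>. (cmod (FI f \<xi>))\<^sup>2)" by (rule L2_integrable[OF FL])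
    show "AE \<xi> in lborel. (\<lambda>n. (cmod (FI f \<xi>))\<^sup>2 * exp (- pi * (a n)\<^sup>2 * (norm \<xi>)\<^sup>2)) \<longlonglongrightarrow> (cmod (FI f \<xi>))\<^sup>2"
      by (intro AE_I2) (rule tendsto_eq_intros a_lim refl | simp)+
    show "AE \<xi> in lborel. norm ((cmod (FI f \<xi>))\<^sup>2 * exp (- pi * (a n)\<^sup>2 * (norm \<xi>)\<^sup>2)) \<le> (cmod (FI f \<xi>))\<^sup>2" for n
      by (intro AE_I2) (simp add: mult_left_le)
  qed measurable
  then have "J \<longlonglongrightarrow> (L2_norm (FI f))\<^sup>2" unfolding J_def[abs_def] L2_norm_sq .
  then have "(L2_norm (FI f))\<^sup>2 = (L2_norm f)\<^sup>2" using J_lim by (rule LIMSEQ_unique)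
  then show "L2_norm (FI f) = L2_norm f" by (simp add: power2_eq_iff_nonneg)
qed

section \<open>The Fourier transform on \<open>L\<^sup>2\<close>\<close>

definition trunc :: "real \<Rightarrow> (real^2 \<Rightarrow> complex) \<Rightarrow> real^2 \<Rightarrow> complex" where
  "trunc R f = (\<lambda>x. indicator (ball 0 R) x * f x)"

lemma borel_measurable_indicator_ball [measurable]:
  "(indicator (ball (c :: real^2) R) :: real^2 \<Rightarrow> complex) \<in> borel_measurable borel"
  by (intro borel_measurable_indicator) auto

lemma indicator_ball_L2: "(\<lambda>x::real^2. indicator (ball 0 R) x :: complex) \<in> L2"
  by (rule L2_bounded_support(1)[where B=1 and R=R]) (auto simp: indicator_def)

lemma trunc_L2: "f \<in> L2 \<Longrightarrow> trunc R f \<in> L2"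
  unfolding trunc_def by (rule L2_mult_bounded[where C=1]) (auto simp: indicator_def)

lemma trunc_integrable: "f \<in> L2 \<Longrightarrow> integrable lborel (trunc R f)"
  unfolding trunc_def by (rule L2_integrable_mult[OF indicator_ball_L2])

lemma trunc_tendsto:
  assumes f: "f \<in> L2"
  shows "((\<lambda>R. L2_norm (\<lambda>x. f x - trunc R f x)) \<longlongrightarrow> 0) at_top"
proof (rule tendsto_at_topI_sequentially)
  fix X :: "nat \<Rightarrow> real" assume X: "filterlim X at_top sequentially"
  show "(\<lambda>n. L2_norm (\<lambda>x. f x - trunc (X n) f x)) \<longlonglongrightarrow> 0"
  proof (rule L2_dominated[where h="\<lambda>x. norm (f x)"])
    show "(\<lambda>x. norm (f x)) \<in> L2" using f by (auto simp: L2_iff intro: borel_measurable_norm)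
    show "(\<lambda>x. f x - trunc (X n) f x) \<in> borel_measurable borel" for n
      using L2_diff[OF f trunc_L2[OF f]] by (rule L2_measurable)
    show "norm (f x - trunc (X n) f x) \<le> norm (f x)" for n x
      by (auto simp: trunc_def indicator_def)
    show "AE x in lborel. (\<lambda>n. f x - trunc (X n) f x) \<longlonglongrightarrow> 0"
    proof (rule AE_I2)
      fix x :: "real^2"
      have "\<forall>\<^sub>F n in sequentially. X n > norm x" using X by (rule filterlim_at_top_dense[THEN iffD1, rule_format])
      then have "\<forall>\<^sub>F n in sequentially. f x - trunc (X n) f x = 0"
        by eventually_elim (auto simp: trunc_def)
      then show "(\<lambda>n. f x - trunc (X n) f x) \<longlonglongrightarrow> 0" by (rule tendsto_eventually)
    qed
  qed
qed

lemma fourier_trunc_L2: "f \<in> L2 \<Longrightarrow> FI (trunc R f) \<in> L2"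
  by (intro fourier_integral_Plancherel(1) trunc_integrable trunc_L2)

text \<open>
  The definition is phrased with a nonnegative integral, which makes sense for all measurable
  functions. Since the transforms of the truncations lie in \<open>L\<^sup>2\<close>, it can be read as
  convergence in the norm.
\<close>

lemma has_L2_fourier_iff:
  "has_L2_fourier f F \<longleftrightarrow> f \<in> L2 \<and> F \<in> L2 \<and> ((\<lambda>R. L2_norm (\<lambda>\<xi>. F \<xi> - FI (trunc R f) \<xi>)) \<longlongrightarrow> 0) at_top"
proof -
  have "((\<lambda>R. \<integral>\<^sup>+\<xi>. ennreal ((cmod (F \<xi> - FI (trunc R f) \<xi>))\<^sup>2) \<partial>lborel) \<longlongrightarrow> 0) at_top \<longleftrightarrow>
    ((\<lambda>R. L2_norm (\<lambda>\<xi>. F \<xi> - FI (trunc R f) \<xi>)) \<longlongrightarrow> 0) at_top" if f: "f \<in> L2" and F: "F \<in> L2"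
  proof -
    have "((\<lambda>R. \<integral>\<^sup>+\<xi>. ennreal ((cmod (F \<xi> - FI (trunc R f) \<xi>))\<^sup>2) \<partial>lborel) \<longlongrightarrow> 0) at_top \<longleftrightarrow>
        ((\<lambda>R. ennreal ((L2_norm (\<lambda>\<xi>. F \<xi> - FI (trunc R f) \<xi>))\<^sup>2)) \<longlongrightarrow> ennreal 0) at_top"
      by (simp add: L2_nn_integral[OF L2_diff[OF F fourier_trunc_L2[OF f]]])
    also have "\<dots> \<longleftrightarrow> ((\<lambda>R. (L2_norm (\<lambda>\<xi>. F \<xi> - FI (trunc R f) \<xi>))\<^sup>2) \<longlongrightarrow> 0) at_top"
      by (rule tendsto_ennreal_iff) auto
    also have "\<dots> \<longleftrightarrow> ((\<lambda>R. L2_norm (\<lambda>\<xi>. F \<xi> - FI (trunc R f) \<xi>)) \<longlongrightarrow> 0) at_top"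
      by simp
    finally show ?thesis .
  qed
  then show ?thesis unfolding has_L2_fourier_def trunc_def[symmetric] by auto
qed

lemma L2_norm_tendsto:
  fixes g :: "'i \<Rightarrow> real^2 \<Rightarrow> complex"
  assumes "f \<in> L2" "\<And>i. g i \<in> L2" "((\<lambda>i. L2_norm (\<lambda>x. f x - g i x)) \<longlongrightarrow> 0) net"
  shows "((\<lambda>i. L2_norm (g i)) \<longlongrightarrow> L2_norm f) net"
proof (rule LIM_zero_cancel, rule Lim_null_comparison[OF _ assms(3)])
  show "\<forall>\<^sub>F i in net. norm (L2_norm (g i) - L2_norm f) \<le> L2_norm (\<lambda>x. f x - g i x)"
    using L2_norm_reverse_triangle[OF assms(1,2)]
    by (intro always_eventually allI) (simp add: abs_minus_commute)
qed

lemma L2_inner_tendsto: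
  fixes f :: "'i \<Rightarrow> real^2 \<Rightarrow> complex"
  assumes f: "f0 \<in> L2" "\<And>i. f i \<in> L2" "((\<lambda>i. L2_norm (\<lambda>x. f0 x - f i x)) \<longlongrightarrow> 0) net"
    and g: "g0 \<in> L2" "\<And>i. g i \<in> L2" "((\<lambda>i. L2_norm (\<lambda>x. g0 x - g i x)) \<longlongrightarrow> 0) net"
  shows "((\<lambda>i. L2_inner (f i) (g i)) \<longlongrightarrow> L2_inner f0 g0) net"
proof (rule LIM_zero_cancel, rule Lim_null_comparison)
  show "((\<lambda>i. L2_norm (\<lambda>x. f0 x - f i x) * L2_norm (g i) + L2_norm f0 * L2_norm (\<lambda>x. g0 x - g i x)) \<longlongrightarrow> 0) net"
    by (rule tendsto_eq_intros f(3) L2_norm_tendsto[OF g] g(3) refl | simp)+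
  have "norm (L2_inner (f i) (g i) - L2_inner f0 g0) \<le> L2_norm (\<lambda>x. f0 x - f i x) * L2_norm (g i) + L2_norm f0 * L2_norm (\<lambda>x. g0 x - g i x)" for i
  proof -
    have "L2_inner f0 g0 - L2_inner (f i) (g i) = L2_inner (\<lambda>x. f0 x - f i x) (g i) + L2_inner f0 (\<lambda>x. g0 x - g i x)"
      using f g by (simp add: L2_inner_diff_left L2_inner_diff_right)
    then have "norm (L2_inner (f i) (g i) - L2_inner f0 g0) = norm (L2_inner (\<lambda>x. f0 x - f i x) (g i) + L2_inner f0 (\<lambda>x. g0 x - g i x))"
      by (metis norm_minus_commute)
    also have "\<dots> \<le> L2_norm (\<lambda>x. f0 x - f i x) * L2_norm (g i) + L2_norm f0 * L2_norm (\<lambda>x. g0 x - g i x)"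
      using f g by (intro norm_triangle_le add_mono L2_Cauchy_Schwarz) auto
    finally show ?thesis .
  qed
  then show "\<forall>\<^sub>F i in net. norm (L2_inner (f i) (g i) - L2_inner f0 g0) \<le> L2_norm (\<lambda>x. f0 x - f i x) * L2_norm (g i) + L2_norm f0 * L2_norm (\<lambda>x. g0 x - g i x)"
    by simp
qed

lemma fourier_trunc_diff_norm:
  assumes "f \<in> L2" "g \<in> L2"
  shows "L2_norm (\<lambda>\<xi>. FI (trunc R f) \<xi> - FI (trunc S g) \<xi>) = L2_norm (\<lambda>x. trunc R f x - trunc S g x)"
proof -
  have "L2_norm (FI (\<lambda>x. trunc R f x - trunc S g x)) = L2_norm (\<lambda>x. trunc R f x - trunc S g x)"
    using assms by (intro fourier_integral_Plancherel(2) Bochner_Integration.integrable_diff trunc_integrable L2_diff trunc_L2)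
  moreover have "FI (\<lambda>x. trunc R f x - trunc S g x) = (\<lambda>\<xi>. FI (trunc R f) \<xi> - FI (trunc S g) \<xi>)"
    using assms by (intro ext fourier_integral_diff trunc_integrable)
  ultimately show ?thesis by simp
qed

text \<open>
  The transform is isometric on truncations, so their transforms form a Cauchy sequence.
\<close>

lemma L2_fourier_exists:
  assumes f: "f \<in> L2" shows "\<exists>F. has_L2_fourier f F"
proof -
  define d where "d R = L2_norm (\<lambda>x. f x - trunc R f x)" for R
  have d: "(d \<longlongrightarrow> 0) at_top" unfolding d_def by (rule trunc_tendsto[OF f])
  have dn: "(\<lambda>n. d (real n)) \<longlonglongrightarrow> 0" by (rule filterlim_compose[OF d filterlim_real_sequentially])
  have tr: "L2_norm (\<lambda>\<xi>. FI (trunc R f) \<xi> - FI (trunc S f) \<xi>) \<le> d R + d S" for R S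
    unfolding fourier_trunc_diff_norm[OF f f] d_def
    using L2_norm_diff_triangle[OF trunc_L2[OF f] f trunc_L2[OF f], of R S] L2_norm_diff_commute[of f "trunc R f"] by simp
  obtain F where F: "F \<in> L2" "(\<lambda>n. L2_norm (\<lambda>x. FI (trunc (real n) f) x - F x)) \<longlonglongrightarrow> 0"
  proof (rule L2_complete[of "\<lambda>n. FI (trunc (real n) f)"])
    show "FI (trunc (real n) f) \<in> L2" for n by (rule fourier_trunc_L2[OF f])
    fix e :: real assume "e > 0"
    then have "\<forall>\<^sub>F n in sequentially. d (real n) < e/2" using dn by (intro order_tendstoD(2)[of _ 0]) auto
    then obtain N where N: "\<And>n. n\<ge>N \<Longrightarrow> d (real n) < e/2" by (auto simp: eventually_sequentially)
    have "L2_norm (\<lambda>x. FI (trunc (real m) f) x - FI (trunc (real n) f) x) < e" if "m \<ge> N" "n \<ge> N" for m n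
      using tr[of "real m" "real n"] N[OF that(1)] N[OF that(2)] by linarith
    then show "\<exists>N. \<forall>m\<ge>N. \<forall>n\<ge>N. L2_norm (\<lambda>x. FI (trunc (real m) f) x - FI (trunc (real n) f) x) < e" by blast
  qed auto
  have "L2_norm (\<lambda>\<xi>. F \<xi> - FI (trunc R f) \<xi>) \<le> d R" for R
  proof (rule LIMSEQ_le_const)
    show "(\<lambda>n. L2_norm (\<lambda>x. FI (trunc (real n) f) x - F x) + (d (real n) + d R)) \<longlonglongrightarrow> d R"
      by (rule tendsto_eq_intros F(2) dn refl | simp)+
    show "\<exists>N. \<forall>n\<ge>N. L2_norm (\<lambda>\<xi>. F \<xi> - FI (trunc R f) \<xi>) \<le> L2_norm (\<lambda>x. FI (trunc (real n) f) x - F x) + (d (real n) + d R)"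
    proof (intro exI allI impI)
      fix n
      show "L2_norm (\<lambda>\<xi>. F \<xi> - FI (trunc R f) \<xi>) \<le> L2_norm (\<lambda>x. FI (trunc (real n) f) x - F x) + (d (real n) + d R)"
        using L2_norm_diff_triangle[OF F(1) fourier_trunc_L2[OF f] fourier_trunc_L2[OF f], of R "real n"]
          tr[of "real n" R] L2_norm_diff_commute[of F "FI (trunc (real n) f)"] by linarith
    qed
  qed
  then have "((\<lambda>R. L2_norm (\<lambda>\<xi>. F \<xi> - FI (trunc R f) \<xi>)) \<longlongrightarrow> 0) at_top"
    by (intro Lim_null_comparison[OF _ d]) simp
  then show ?thesis using f F by (auto simp: has_L2_fourier_iff)
qed

lemma has_L2_fourierD: "has_L2_fourier f F \<Longrightarrow> f \<in> L2" "has_L2_fourier f F \<Longrightarrow> F \<in> L2"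
  by (auto simp: has_L2_fourier_iff)

lemma has_L2_fourier_add:
  assumes "has_L2_fourier f F" "has_L2_fourier g G"
  shows "has_L2_fourier (\<lambda>x. f x + g x) (\<lambda>\<xi>. F \<xi> + G \<xi>)"
proof -
  note L = has_L2_fourierD[OF assms(1)] has_L2_fourierD[OF assms(2)]
  have "trunc R (\<lambda>x. f x + g x) = (\<lambda>x. trunc R f x + trunc R g x)" for R
    by (auto simp: trunc_def fun_eq_iff ring_distribs)
  then have eq: "FI (trunc R (\<lambda>x. f x + g x)) \<xi> = FI (trunc R f) \<xi> + FI (trunc R g) \<xi>" for R \<xi>
    using fourier_integral_add[OF trunc_integrable[OF L(1)] trunc_integrable[OF L(3)]] by simp
  have "((\<lambda>R. L2_norm (\<lambda>\<xi>. (F \<xi> + G \<xi>) - FI (trunc R (\<lambda>x. f x + g x)) \<xi>)) \<longlongrightarrow> 0) at_top"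
  proof (rule Lim_null_comparison)
    show "((\<lambda>R. L2_norm (\<lambda>\<xi>. F \<xi> - FI (trunc R f) \<xi>) + L2_norm (\<lambda>\<xi>. G \<xi> - FI (trunc R g) \<xi>)) \<longlongrightarrow> 0) at_top"
      using assms tendsto_add[of _ 0 at_top _ 0] by (auto simp: has_L2_fourier_iff)
    have "L2_norm (\<lambda>\<xi>. (F \<xi> + G \<xi>) - FI (trunc R (\<lambda>x. f x + g x)) \<xi>) \<le> L2_norm (\<lambda>\<xi>. F \<xi> - FI (trunc R f) \<xi>) + L2_norm (\<lambda>\<xi>. G \<xi> - FI (trunc R g) \<xi>)" for R
      using L2_norm_triangle[of "\<lambda>\<xi>. F \<xi> - FI (trunc R f) \<xi>" "\<lambda>\<xi>. G \<xi> - FI (trunc R g) \<xi>"] L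
      by (simp add: eq L2_diff fourier_trunc_L2 algebra_simps)
    then show "\<forall>\<^sub>F R in at_top. norm (L2_norm (\<lambda>\<xi>. (F \<xi> + G \<xi>) - FI (trunc R (\<lambda>x. f x + g x)) \<xi>)) \<le> L2_norm (\<lambda>\<xi>. F \<xi> - FI (trunc R f) \<xi>) + L2_norm (\<lambda>\<xi>. G \<xi> - FI (trunc R g) \<xi>)"
      by simp
  qed
  then show ?thesis using L by (auto simp: has_L2_fourier_iff)
qed

lemma has_L2_fourier_cmult:
  assumes "has_L2_fourier f F" shows "has_L2_fourier (\<lambda>x. c * f x) (\<lambda>\<xi>. c * F \<xi>)"
proof -
  have "trunc R (\<lambda>x. c * f x) = (\<lambda>x. c * trunc R f x)" for R
    by (auto simp: trunc_def fun_eq_iff)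
  then have "L2_norm (\<lambda>\<xi>. c * F \<xi> - FI (trunc R (\<lambda>x. c * f x)) \<xi>) = norm c * L2_norm (\<lambda>\<xi>. F \<xi> - FI (trunc R f) \<xi>)" for R
    by (simp add: fourier_integral_cmult right_diff_distrib[symmetric] L2_norm_cmult)
  moreover have "((\<lambda>R. norm c * L2_norm (\<lambda>\<xi>. F \<xi> - FI (trunc R f) \<xi>)) \<longlongrightarrow> 0) at_top"
    using assms by (intro tendsto_mult_right_zero) (auto simp: has_L2_fourier_iff)
  ultimately show ?thesis using has_L2_fourierD[OF assms] by (auto simp: has_L2_fourier_iff)
qed

lemma has_L2_fourier_diff:
  assumes "has_L2_fourier f F" "has_L2_fourier g G"
  shows "has_L2_fourier (\<lambda>x. f x - g x) (\<lambda>\<xi>. F \<xi> - G \<xi>)"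
  using has_L2_fourier_add[OF assms(1) has_L2_fourier_cmult[OF assms(2), of "-1"]] by simp

lemma has_L2_fourier_norm:
  assumes "has_L2_fourier f F" shows "L2_norm F = L2_norm f"
proof (rule tendsto_unique)
  note L = has_L2_fourierD[OF assms]
  show "((\<lambda>R. L2_norm (FI (trunc R f))) \<longlongrightarrow> L2_norm F) at_top"
    using assms by (intro L2_norm_tendsto L fourier_trunc_L2) (auto simp: has_L2_fourier_iff)
  have "((\<lambda>R. L2_norm (trunc R f)) \<longlongrightarrow> L2_norm f) at_top"
    by (intro L2_norm_tendsto L trunc_L2 trunc_tendsto)
  then show "((\<lambda>R. L2_norm (FI (trunc R f))) \<longlongrightarrow> L2_norm f) at_top"
    by (simp add: fourier_integral_Plancherel(2) trunc_integrable trunc_L2 L)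
qed simp

lemma has_L2_fourier_dist:
  "has_L2_fourier f F \<Longrightarrow> has_L2_fourier g G \<Longrightarrow> L2_norm (\<lambda>\<xi>. F \<xi> - G \<xi>) = L2_norm (\<lambda>x. f x - g x)"
  by (intro has_L2_fourier_norm has_L2_fourier_diff)

lemma has_L2_fourier_unique:
  assumes "has_L2_fourier f F" "has_L2_fourier f G" shows "AE \<xi> in lborel. F \<xi> = G \<xi>"
  using has_L2_fourier_dist[OF assms]
  by (intro L2_norm_diff_eq_0D has_L2_fourierD(2)[OF assms(1)] has_L2_fourierD(2)[OF assms(2)]) (simp add: L2_norm_def)

text \<open>
  The relation sees both functions only up to null sets. Transforms are unique only in this
  sense, so this lemma is needed to exchange one representative for another.
\<close>

lemma has_L2_fourier_cong_AE:
  assumes h: "has_L2_fourier f F" and [measurable]: "f' \<in> borel_measurable borel" "F' \<in> borel_measurable borel"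
    and AE: "AE x in lborel. f x = f' x" "AE \<xi> in lborel. F \<xi> = F' \<xi>"
  shows "has_L2_fourier f' F'"
proof -
  note L = has_L2_fourierD[OF h]
  have [measurable]: "f \<in> borel_measurable borel" "F \<in> borel_measurable borel" using L by auto
  have L': "f' \<in> L2" "F' \<in> L2"
    using L2_cong_AE[OF L(1) _ AE(1)] L2_cong_AE[OF L(2) _ AE(2)] by auto
  have FI: "FI (trunc R f') \<xi> = FI (trunc R f) \<xi>" for R \<xi>
    unfolding fourier_integral_def trunc_def by (rule integral_cong_AE) (use AE(1) in auto)
  have "L2_norm (\<lambda>\<xi>. F' \<xi> - FI (trunc R f') \<xi>) = L2_norm (\<lambda>\<xi>. F \<xi> - FI (trunc R f) \<xi>)" for R
    by (rule L2_norm_cong_AE) (use AE(2) L2_measurable[OF fourier_trunc_L2[OF L(1)]] in \<open>auto simp: FI\<close>)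
  then show ?thesis using h L' by (simp add: has_L2_fourier_iff)
qed

text \<open>
  Polarisation: norms are preserved, and multiplication by \<open>\<i>\<close> recovers the imaginary part.
\<close>

lemma has_L2_fourier_inner:
  assumes "has_L2_fourier f F" "has_L2_fourier g G"
  shows "L2_inner F G = L2_inner f g"
proof -
  have re: "Re (L2_inner F G) = Re (L2_inner f g)" if "has_L2_fourier f F" "has_L2_fourier g G" for f F g G
    using L2_norm_add_sq[OF has_L2_fourierD(1)[OF that(1)] has_L2_fourierD(1)[OF that(2)]]
      L2_norm_add_sq[OF has_L2_fourierD(2)[OF that(1)] has_L2_fourierD(2)[OF that(2)]]
      has_L2_fourier_norm[OF that(1)] has_L2_fourier_norm[OF that(2)] has_L2_fourier_norm[OF has_L2_fourier_add[OF that]]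
    by simp
  have "Re (L2_inner F (\<lambda>\<xi>. \<i> * G \<xi>)) = Re (L2_inner f (\<lambda>x. \<i> * g x))"
    by (intro re assms has_L2_fourier_cmult)
  then have "Im (L2_inner F G) = Im (L2_inner f g)" by (simp add: L2_inner_cmult_right)
  then show ?thesis using re[OF assms] by (simp add: complex_eq_iff)
qed

text \<open>
  The graph of an isometry is closed.
\<close>

lemma has_L2_fourier_limit:
  assumes h: "\<And>n. has_L2_fourier (f n) (F n)" and L: "f0 \<in> L2" "F0 \<in> L2"
    and f: "(\<lambda>n::nat. L2_norm (\<lambda>x. f n x - f0 x)) \<longlonglongrightarrow> 0"
    and F: "(\<lambda>n. L2_norm (\<lambda>x. F n x - F0 x)) \<longlonglongrightarrow> 0"
  shows "has_L2_fourier f0 F0"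
proof -
  obtain G where G: "has_L2_fourier f0 G" using L2_fourier_exists[OF L(1)] by blast
  have "L2_norm (\<lambda>\<xi>. G \<xi> - F0 \<xi>) \<le> 0"
  proof (rule LIMSEQ_le_const)
    show "(\<lambda>n. L2_norm (\<lambda>x. f n x - f0 x) + L2_norm (\<lambda>x. F n x - F0 x)) \<longlonglongrightarrow> 0"
      using tendsto_add[OF f F] by simp
    have "L2_norm (\<lambda>\<xi>. G \<xi> - F0 \<xi>) \<le> L2_norm (\<lambda>x. f n x - f0 x) + L2_norm (\<lambda>x. F n x - F0 x)" for n
      using L2_norm_diff_triangle[OF has_L2_fourierD(2)[OF G] has_L2_fourierD(2)[OF h] L(2), of n]
        has_L2_fourier_dist[OF h G, of n] L2_norm_diff_commute[of G "F n"] by simp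
    then show "\<exists>N. \<forall>n\<ge>N. L2_norm (\<lambda>\<xi>. G \<xi> - F0 \<xi>) \<le> L2_norm (\<lambda>x. f n x - f0 x) + L2_norm (\<lambda>x. F n x - F0 x)" by blast
  qed
  then have "L2_norm (\<lambda>\<xi>. G \<xi> - F0 \<xi>) = 0" by (simp add: order_antisym)
  then have "AE \<xi> in lborel. G \<xi> = F0 \<xi>" by (rule L2_norm_diff_eq_0D[OF has_L2_fourierD(2)[OF G] L(2)])
  then show ?thesis using G L by (intro has_L2_fourier_cong_AE[OF G]) auto
qed

lemma has_L2_fourier_integral:
  assumes f: "integrable lborel f" "f \<in> L2" shows "has_L2_fourier f (FI f)"
proof -
  have "L2_norm (\<lambda>\<xi>. FI f \<xi> - FI (trunc R f) \<xi>) = L2_norm (\<lambda>x. f x - trunc R f x)" for R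
  proof -
    have "L2_norm (FI (\<lambda>x. f x - trunc R f x)) = L2_norm (\<lambda>x. f x - trunc R f x)"
      using f by (intro fourier_integral_Plancherel(2) Bochner_Integration.integrable_diff trunc_integrable L2_diff trunc_L2)
    moreover have "FI (\<lambda>x. f x - trunc R f x) = (\<lambda>\<xi>. FI f \<xi> - FI (trunc R f) \<xi>)"
      using f by (intro ext fourier_integral_diff trunc_integrable)
    ultimately show ?thesis by simp
  qed
  then show ?thesis using f trunc_tendsto[OF f(2)] by (simp add: has_L2_fourier_iff fourier_integral_Plancherel)
qed

lemma trunc_nat_tendsto:
  "f \<in> L2 \<Longrightarrow> (\<lambda>n. L2_norm (\<lambda>x. f x - trunc (real n) f x)) \<longlonglongrightarrow> 0"
  by (rule filterlim_compose[OF trunc_tendsto filterlim_real_sequentially])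

lemma fourier_trunc_nat_tendsto:
  "has_L2_fourier f F \<Longrightarrow> (\<lambda>n. L2_norm (\<lambda>x. F x - FI (trunc (real n) f) x)) \<longlonglongrightarrow> 0"
  using filterlim_compose[OF _ filterlim_real_sequentially, of "\<lambda>R. L2_norm (\<lambda>x. F x - FI (trunc R f) x)"]
  by (auto simp: has_L2_fourier_iff)

text \<open>
  The identity for integrable functions passes to \<open>L\<^sup>2\<close> because both sides are continuous
  there. It says that the transform is symmetric for the bilinear pairing.
\<close>

lemma has_L2_fourier_multiplication:
  assumes h: "has_L2_fourier f F" "has_L2_fourier g G"
  shows "(\<integral>\<xi>. F \<xi> * g \<xi> \<partial>lborel) = (\<integral>x. f x * G x \<partial>lborel)"
proof -
  note L = has_L2_fourierD[OF h(1)] has_L2_fourierD[OF h(2)]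
  have ip: "(\<integral>x. p x * q x \<partial>lborel) = L2_inner p (\<lambda>x. cnj (q x))" for p q by (simp add: L2_inner_def)
  have cd: "L2_norm (\<lambda>x. cnj (p x) - cnj (q x)) = L2_norm (\<lambda>x. p x - q x)" for p q
    using L2_norm_cnj[of "\<lambda>x. p x - q x"] by simp
  have 1: "(\<lambda>n. L2_inner (FI (trunc (real n) f)) (\<lambda>x. cnj (trunc (real n) g x))) \<longlonglongrightarrow> L2_inner F (\<lambda>x. cnj (g x))"
    by (rule L2_inner_tendsto)
      (use L in \<open>auto simp: cd fourier_trunc_L2 trunc_L2 intro!: trunc_nat_tendsto fourier_trunc_nat_tendsto h L2_cnj\<close>)
  have 2: "(\<lambda>n. L2_inner (trunc (real n) f) (\<lambda>x. cnj (FI (trunc (real n) g) x))) \<longlonglongrightarrow> L2_inner f (\<lambda>x. cnj (G x))"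
    by (rule L2_inner_tendsto)
      (use L in \<open>auto simp: cd fourier_trunc_L2 trunc_L2 intro!: trunc_nat_tendsto fourier_trunc_nat_tendsto h L2_cnj\<close>)
  have "L2_inner (FI (trunc (real n) f)) (\<lambda>x. cnj (trunc (real n) g x)) = L2_inner (trunc (real n) f) (\<lambda>x. cnj (FI (trunc (real n) g) x))" for n
    unfolding ip[symmetric] using L by (intro fourier_integral_mult trunc_integrable)
  then show ?thesis unfolding ip using 1 2 LIMSEQ_unique by simp
qed

text \<open>
  Let \<open>h\<close> be the conjugate of \<open>K\<close> and \<open>H\<close> its transform. The multiplication formula gives
  \<open>\<langle>H, G\<rangle> = \<parallel>K\<parallel>\<^sup>2\<close>. As \<open>H\<close>, \<open>K\<close> and \<open>G\<close> have the same norm, this is the case of equality in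
  the Cauchy--Schwarz inequality, so \<open>H = G\<close>.
\<close>

lemma has_L2_fourier_inverse:
  assumes h: "has_L2_fourier (\<lambda>x. cnj (G x)) K" and G: "G \<in> L2"
  shows "has_L2_fourier (\<lambda>x. cnj (K x)) G"
proof -
  note L = has_L2_fourierD[OF h]
  have k: "(\<lambda>x. cnj (K x)) \<in> L2" using L by auto
  obtain H where H: "has_L2_fourier (\<lambda>x. cnj (K x)) H" using L2_fourier_exists[OF k] by blast
  note HL = has_L2_fourierD(2)[OF H]
  have n: "L2_norm H = L2_norm G" "L2_norm K = L2_norm G"
    using has_L2_fourier_norm[OF H] has_L2_fourier_norm[OF h] by auto
  have "L2_inner H G = (\<integral>x. cnj (K x) * K x \<partial>lborel)"
    unfolding L2_inner_def by (rule has_L2_fourier_multiplication[OF H h])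
  also have "\<dots> = L2_inner K K" by (simp add: L2_inner_def mult.commute)
  also have "\<dots> = of_real ((L2_norm G)\<^sup>2)" by (simp add: L2_inner_self n)
  finally have "(L2_norm (\<lambda>x. H x - G x))\<^sup>2 = 0"
    by (simp add: L2_norm_diff_sq[OF HL G] n)
  then have "AE \<xi> in lborel. H \<xi> = G \<xi>" by (intro L2_norm_diff_eq_0D HL G) simp
  then show ?thesis using k G by (intro has_L2_fourier_cong_AE[OF H]) auto
qed

lemma L2_fourier_surj:
  assumes "G \<in> L2" shows "\<exists>g. has_L2_fourier g G"
  using has_L2_fourier_inverse[OF _ assms] L2_fourier_exists[OF L2_cnj[OF assms]] by blast

lemma has_L2_fourier_inverse_integral:
  assumes G: "integrable lborel G" "G \<in> L2" shows "has_L2_fourier (\<lambda>x. FI G (- x)) G"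
proof -
  have "has_L2_fourier (\<lambda>x. cnj (G x)) (FI (\<lambda>x. cnj (G x)))"
    using G by (intro has_L2_fourier_integral L2_cnj) auto
  from has_L2_fourier_inverse[OF this G(2)] show ?thesis by (simp add: fourier_integral_cnj)
qed

lemma has_L2_fourier_shift:
  assumes h: "has_L2_fourier f F"
  shows "has_L2_fourier (\<lambda>x. f (x + y)) (\<lambda>\<xi>. cis (2 * pi * (\<xi> \<bullet> y)) * F \<xi>)"
proof -
  note L = has_L2_fourierD[OF h]
  have [measurable]: "f \<in> borel_measurable borel" using L by auto
  have phase: "(\<lambda>\<xi>. cis (2 * pi * (\<xi> \<bullet> y)) * G \<xi>) \<in> L2" if "G \<in> L2" for G
    using that by (rule L2_mult_bounded[where C=1]) auto
  have [measurable]: "trunc R f \<in> borel_measurable borel" for R using L2_measurable[OF trunc_L2[OF L(1)]] .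
  show ?thesis
  proof (rule has_L2_fourier_limit)
    fix n
    have "has_L2_fourier (\<lambda>x. trunc (real n) f (x + y)) (FI (\<lambda>x. trunc (real n) f (x + y)))"
      by (intro has_L2_fourier_integral lborel_integrable_shift trunc_integrable L2_shift trunc_L2 L) measurable
    moreover have "FI (\<lambda>x. trunc (real n) f (x + y)) = (\<lambda>\<xi>. cis (2 * pi * (\<xi> \<bullet> y)) * FI (trunc (real n) f) \<xi>)"
      by (intro ext fourier_integral_shift) measurable
    ultimately show "has_L2_fourier (\<lambda>x. trunc (real n) f (x + y)) (\<lambda>\<xi>. cis (2 * pi * (\<xi> \<bullet> y)) * FI (trunc (real n) f) \<xi>)" by simp
  next
    have "L2_norm (\<lambda>x. trunc (real n) f (x + y) - f (x + y)) = L2_norm (\<lambda>x. f x - trunc (real n) f x)" for n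
      using L2_norm_shift[OF L2_diff[OF trunc_L2[OF L(1)] L(1)], of n y] L2_norm_diff_commute by simp
    then show "(\<lambda>n. L2_norm (\<lambda>x. trunc (real n) f (x + y) - f (x + y))) \<longlonglongrightarrow> 0"
      using trunc_nat_tendsto[OF L(1)] by simp
    have "L2_norm (\<lambda>\<xi>. cis (2 * pi * (\<xi> \<bullet> y)) * FI (trunc (real n) f) \<xi> - cis (2 * pi * (\<xi> \<bullet> y)) * F \<xi>) = L2_norm (\<lambda>\<xi>. F \<xi> - FI (trunc (real n) f) \<xi>)" for n
      by (simp add: L2_norm_def norm_minus_commute flip: right_diff_distrib)
    then show "(\<lambda>n. L2_norm (\<lambda>\<xi>. cis (2 * pi * (\<xi> \<bullet> y)) * FI (trunc (real n) f) \<xi> - cis (2 * pi * (\<xi> \<bullet> y)) * F \<xi>)) \<longlonglongrightarrow> 0"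
      using fourier_trunc_nat_tendsto[OF h] by simp
  qed (use L L2_shift phase in auto)
qed

text \<open>
  Used with test functions \<open>\<phi>\<close>: it expresses the integrals in the definition of the weak
  gradient by the transform of \<open>u\<close>.
\<close>

lemma has_L2_fourier_pairing:
  assumes u: "has_L2_fourier u F" and \<phi>: "integrable lborel \<phi>" "\<phi> \<in> L2"
  shows "(\<integral>x. u x * \<phi> x \<partial>lborel) = (\<integral>\<xi>. F \<xi> * FI \<phi> (- \<xi>) \<partial>lborel)"
  using has_L2_fourier_multiplication[OF u has_L2_fourier_inverse_integral[OF \<phi>]] by simp

section \<open>Weak compactness in \<open>L\<^sup>2\<close>\<close>

definition L2_weakly :: "(nat \<Rightarrow> real^2 \<Rightarrow> complex) \<Rightarrow> (real^2 \<Rightarrow> complex) \<Rightarrow> bool" where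
  "L2_weakly f f0 \<longleftrightarrow> (\<forall>g\<in>L2. (\<lambda>n. L2_inner (f n) g) \<longlonglongrightarrow> L2_inner f0 g)"

text \<open>
  Minimise \<open>\<parallel>g\<parallel>\<^sup>2 - 2 l g\<close> over \<open>S\<close>. The parallelogram law makes a minimising sequence
  Cauchy, and the vanishing of the first variation at the minimiser is the claim. Working
  with real parts covers antilinear functionals too, and with a proper subspace \<open>S\<close> the lemma
  also provides orthogonal projections.
\<close>

lemma L2_Riesz_subspace:
  fixes S :: "(real^2 \<Rightarrow> complex) set" and l :: "(real^2 \<Rightarrow> complex) \<Rightarrow> real"
  assumes S: "S \<subseteq> L2" "(\<lambda>x. 0) \<in> S"
    and S_add: "\<And>f g. f \<in> S \<Longrightarrow> g \<in> S \<Longrightarrow> (\<lambda>x. f x + g x) \<in> S"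
    and S_cmult: "\<And>f c. f \<in> S \<Longrightarrow> (\<lambda>x. c * f x) \<in> S"
    and S_closed: "\<And>f f0. (\<And>n::nat. f n \<in> S) \<Longrightarrow> f0 \<in> L2 \<Longrightarrow> (\<lambda>n. L2_norm (\<lambda>x. f n x - f0 x)) \<longlonglongrightarrow> 0 \<Longrightarrow> f0 \<in> S"
    and l_add: "\<And>f g. f \<in> S \<Longrightarrow> g \<in> S \<Longrightarrow> l (\<lambda>x. f x + g x) = l f + l g"
    and l_cmult: "\<And>f c. f \<in> S \<Longrightarrow> l (\<lambda>x. complex_of_real c * f x) = c * l f"
    and l_le: "\<And>f. f \<in> S \<Longrightarrow> \<bar>l f\<bar> \<le> K * L2_norm f"
  obtains V where "V \<in> S" "\<And>g. g \<in> S \<Longrightarrow> Re (L2_inner V g) = l g"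
proof -
  define J where "J g = (L2_norm g)\<^sup>2 - 2 * l g" for g
  have J_ge: "- K\<^sup>2 \<le> J g" if "g \<in> S" for g
  proof -
    have "0 \<le> (L2_norm g - K)\<^sup>2" by simp
    then show ?thesis using l_le[OF that] by (simp add: J_def power2_diff mult.commute)
  qed
  define d where "d = Inf (J ` S)"
  have bdd: "bdd_below (J ` S)" using J_ge by (auto intro!: bdd_belowI[where m="- K\<^sup>2"])
  have d_le: "d \<le> J g" if "g \<in> S" for g unfolding d_def using that bdd by (auto intro: cInf_lower)
  have "\<exists>g\<in>S. J g < d + 1 / real (Suc n)" for n
  proof -
    have "Inf (J ` S) < d + 1 / real (Suc n)" unfolding d_def[symmetric] by simp
    then show ?thesis using S(2) bdd by (subst (asm) cInf_less_iff) auto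
  qed
  then obtain g where g: "\<And>n. g n \<in> S" "\<And>n. J (g n) < d + 1 / real (Suc n)" by metis
  have gL: "g n \<in> L2" for n using g S by auto
  have dist: "(L2_norm (\<lambda>x. g m x - g n x))\<^sup>2 \<le> 2 / real (Suc m) + 2 / real (Suc n)" for m n
  proof -
    define h where "h x = complex_of_real (1/2) * (g m x + g n x)" for x
    have hS: "h \<in> S" unfolding h_def using g by (intro S_cmult S_add)
    have "l h = (l (g m) + l (g n)) / 2"
      using l_cmult[OF S_add[OF g(1)[of m] g(1)[of n]], of "1/2"] l_add[OF g(1)[of m] g(1)[of n]]
      by (simp add: h_def[abs_def])
    moreover have "(L2_norm h)\<^sup>2 = (L2_norm (\<lambda>x. g m x + g n x))\<^sup>2 / 4"
      unfolding h_def L2_norm_cmult by (simp add: power_divide)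
    ultimately have "(L2_norm (\<lambda>x. g m x - g n x))\<^sup>2 = 2 * J (g m) + 2 * J (g n) - 4 * J h"
      by (simp add: J_def L2_norm_diff_sq[OF gL gL] L2_norm_add_sq[OF gL gL] field_simps)
    also have "\<dots> \<le> 2 * p + 2 * q" if "J (g m) < d + p" "J (g n) < d + q" for p q
      using that d_le[OF hS] by linarith
    from this[OF g(2) g(2)] have "2 * J (g m) + 2 * J (g n) - 4 * J h \<le> 2 / real (Suc m) + 2 / real (Suc n)" by simp
    finally show ?thesis .
  qed
  obtain V where V: "V \<in> L2" "(\<lambda>n. L2_norm (\<lambda>x. g n x - V x)) \<longlonglongrightarrow> 0"
  proof (rule L2_complete[of g])
    fix e :: real assume e: "e > 0"
    then obtain N where N: "4 / e\<^sup>2 < real N" using reals_Archimedean2 by blast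

    have "L2_norm (\<lambda>x. g m x - g n x) < e" if "m \<ge> N" "n \<ge> N" for m n
    proof (rule power2_less_imp_less)
      have A: "2 / real (Suc k) < e\<^sup>2 / 2" if "k \<ge> N" for k
      proof -
        have "4 / e\<^sup>2 < real (Suc k)" using N that by linarith
        then show ?thesis using e by (simp add: field_simps)
      qed
      then show "(L2_norm (\<lambda>x. g m x - g n x))\<^sup>2 < e\<^sup>2"
        using order.strict_trans1[OF dist add_strict_mono[OF A[OF that(1)] A[OF that(2)]]] by simp
    qed (use e in simp)
    then show "\<exists>N. \<forall>m\<ge>N. \<forall>n\<ge>N. L2_norm (\<lambda>x. g m x - g n x) < e" by blast
  qed (use gL in auto)
  have VS: "V \<in> S" by (rule S_closed[OF g(1) V])
  have "(\<lambda>n. l (g n)) \<longlonglongrightarrow> l V"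
  proof (rule LIM_zero_cancel, rule Lim_null_comparison)
    show "(\<lambda>n. K * L2_norm (\<lambda>x. g n x - V x)) \<longlonglongrightarrow> 0" using V(2) by (rule tendsto_mult_right_zero)
    have "\<bar>l (g n) - l V\<bar> \<le> K * L2_norm (\<lambda>x. g n x - V x)" for n
    proof -
      have mV: "(\<lambda>x. complex_of_real (-1) * V x) \<in> S" using VS by (rule S_cmult)
      have "l (\<lambda>x. g n x - V x) = l (g n) - l V"
        using l_add[OF g(1)[of n] mV] l_cmult[OF VS, of "-1"] by simp
      moreover have "(\<lambda>x. g n x - V x) \<in> S" using S_add[OF g(1)[of n] mV] by simp
      ultimately show ?thesis using l_le by metis
    qed
    then show "\<forall>\<^sub>F n in sequentially. norm (l (g n) - l V) \<le> K * L2_norm (\<lambda>x. g n x - V x)" by simp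
  qed
  moreover have "(\<lambda>n. L2_norm (g n)) \<longlonglongrightarrow> L2_norm V"
    using V(2) L2_norm_diff_commute[of V] by (intro L2_norm_tendsto V gL) simp
  ultimately have "(\<lambda>n. J (g n)) \<longlonglongrightarrow> J V" unfolding J_def by (intro tendsto_intros)
  moreover have "(\<lambda>n. d + 1 / real (Suc n)) \<longlonglongrightarrow> d + 0"
    by (intro tendsto_intros LIMSEQ_Suc[OF lim_1_over_n])
  ultimately have "J V \<le> d + 0" by (rule LIMSEQ_le) (use less_imp_le[OF g(2)] in blast)
  then have Jd: "J V \<le> d" by simp
  have "Re (L2_inner V h) = l h" if h: "h \<in> S" for h
  proof -
    define b where "b = Re (L2_inner V h) - l h"
    define a where "a = (L2_norm h)\<^sup>2"
    have hL: "h \<in> L2" using h S by auto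
    have q: "0 \<le> t\<^sup>2 * a + 2 * t * b" for t
    proof -
      have th: "(\<lambda>x. complex_of_real t * h x) \<in> S" using h by (rule S_cmult)
      have "J V \<le> J (\<lambda>x. V x + complex_of_real t * h x)"
        using Jd d_le[OF S_add[OF VS th]] by linarith
      also have "\<dots> = J V + t\<^sup>2 * a + 2 * t * b"
        unfolding J_def L2_norm_add_sq[OF V(1) L2_cmult[OF hL]] l_add[OF VS th] l_cmult[OF h] L2_norm_cmult L2_inner_cmult_right
        by (simp add: a_def b_def power_mult_distrib algebra_simps)
      finally show ?thesis by simp
    qed
    have a0: "a \<ge> 0" by (simp add: a_def)
    \<comment> \<open>\<open>a + 1\<close> instead of \<open>a\<close> in the denominator covers \<open>a = 0\<close>\<close>
    have "0 \<le> (b / (a+1))\<^sup>2 * a - 2 * (b / (a+1)) * b" using q[of "- b / (a+1)"] by simp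
    then have "0 \<le> ((b / (a+1))\<^sup>2 * a - 2 * (b / (a+1)) * b) * (a+1)\<^sup>2" by (intro mult_nonneg_nonneg) auto
    also have "\<dots> = b\<^sup>2 * a - 2 * b\<^sup>2 * (a + 1)"
      using a0 by (simp add: power_divide left_diff_distrib power2_eq_square)
    finally have "b\<^sup>2 * (a + 2) \<le> 0" by (simp add: algebra_simps)
    then have "b = 0" using a0 by (simp add: mult_le_0_iff)
    then show ?thesis by (simp add: b_def)
  qed
  then show thesis using that VS by blast
qed

text \<open>
  A diagonal sequence makes the inner products with each fixed \<open>f m\<close> converge. The functions
  against which convergence holds form a closed subspace \<open>S\<close> that contains all \<open>f m\<close>; every
  function may be replaced by its projection onto \<open>S\<close>, so \<open>S\<close> is the whole space. The limit
  is represented by the Riesz lemma.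
\<close>

lemma L2_weak_compactness:
  fixes f :: "nat \<Rightarrow> real^2 \<Rightarrow> complex"
  assumes f: "\<And>n. f n \<in> L2" and K: "\<And>n. L2_norm (f n) \<le> K"
  obtains r f0 where "strict_mono r" "f0 \<in> L2" "L2_weakly (\<lambda>n. f (r n)) f0"
proof -
  have K0: "0 \<le> K" by (rule order_trans[OF L2_norm_nonneg K])
  define P where "P m s \<longleftrightarrow> convergent (\<lambda>n. L2_inner (f (s n)) (f m))" for m and s :: "nat \<Rightarrow> nat"
  interpret subseqs P
  proof
    fix m and s :: "nat \<Rightarrow> nat" assume "strict_mono s"
    have "norm (L2_inner (f n) (f m)) \<le> K * K" for n
      using L2_Cauchy_Schwarz[OF f[of n] f[of m]] mult_mono[OF K[of n] K[of m] K0 L2_norm_nonneg] by linarith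
    then have "bounded (range (\<lambda>n. L2_inner (f (s n)) (f m)))" by (auto intro!: boundedI)
    from bounded_imp_convergent_subsequence[OF this]
    obtain l r where "strict_mono r" "((\<lambda>n. L2_inner (f (s n)) (f m)) \<circ> r) \<longlonglongrightarrow> l" by blast
    then show "\<exists>r'. strict_mono r' \<and> P m (s \<circ> r')" by (auto simp: P_def o_def convergent_def)
  qed
  define r where "r = diagseq"
  have r: "strict_mono r" unfolding r_def by (rule subseq_diagseq)
  have conv: "convergent (\<lambda>n. L2_inner (f (r n)) (f m))" for m
  proof -
    have "P m (diagseq \<circ> ((+) (Suc m)))"
    proof (rule diagseq_holds)
      fix s r' :: "nat \<Rightarrow> nat" and n assume "strict_mono r'" "P n s"
      then show "P n (s \<circ> r')"
        unfolding P_def using convergent_subseq_convergent[of "\<lambda>k. L2_inner (f (s k)) (f n)" r'] by (simp add: o_def)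
    qed
    then have "convergent (\<lambda>n. L2_inner (f (r (n + Suc m))) (f m))" by (simp add: P_def r_def o_def add.commute)
    then show ?thesis by (subst (asm) convergent_ignore_initial_segment[of "\<lambda>n. L2_inner (f (r n)) (f m)"])
  qed
  define S where "S = {g \<in> L2. convergent (\<lambda>n. L2_inner (f (r n)) g)}"
  have fS: "f m \<in> S" for m using conv f by (simp add: S_def)
  have S1: "S \<subseteq> L2" "(\<lambda>x. 0) \<in> S" by (auto simp: S_def L2_inner_def convergent_const)
  have S_add: "(\<lambda>x. g x + h x) \<in> S" if "g \<in> S" "h \<in> S" for g h
    using that f by (auto simp: S_def L2_inner_add_right intro!: convergent_add)
  have S_cmult: "(\<lambda>x. c * g x) \<in> S" if "g \<in> S" for c g
    using that f by (auto simp: S_def L2_inner_cmult_right intro!: convergent_mult convergent_const)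
  have S_closed: "g0 \<in> S" if g: "\<And>n::nat. g n \<in> S" and g0: "g0 \<in> L2" and lim: "(\<lambda>n. L2_norm (\<lambda>x. g n x - g0 x)) \<longlonglongrightarrow> 0" for g g0
  proof -
    have "Cauchy (\<lambda>n. L2_inner (f (r n)) g0)"
    proof (rule CauchyI)
      fix e :: real assume e: "e > 0"
      then have "e / (4 * (K + 1)) > 0" using K0 by simp
      then have "\<forall>\<^sub>F k in sequentially. L2_norm (\<lambda>x. g k x - g0 x) < e / (4 * (K + 1))"
        by (rule order_tendstoD(2)[OF lim])
      then obtain k where k: "L2_norm (\<lambda>x. g k x - g0 x) < e / (4 * (K + 1))"
        by (auto simp: eventually_sequentially)
      have gk: "g k \<in> L2" using g S1 by auto
      have near: "norm (L2_inner (f n) (g k) - L2_inner (f n) g0) < e / 4" for n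
      proof -
        have "norm (L2_inner (f n) (g k) - L2_inner (f n) g0) = norm (L2_inner (f n) (\<lambda>x. g k x - g0 x))"
          using gk g0 f by (simp add: L2_inner_diff_right)
        also have "\<dots> \<le> L2_norm (f n) * L2_norm (\<lambda>x. g k x - g0 x)" using gk g0 f by (intro L2_Cauchy_Schwarz) auto
        also have "\<dots> \<le> (K + 1) * L2_norm (\<lambda>x. g k x - g0 x)" using K[of n] by (intro mult_right_mono) auto
        also have "\<dots> < (K + 1) * (e / (4 * (K + 1)))" using k K0 by (intro mult_strict_left_mono) auto
        also have "\<dots> = e / 4" using K0 by (simp add: field_simps)
        finally show ?thesis .
      qed
      have "Cauchy (\<lambda>n. L2_inner (f (r n)) (g k))" using g[of k] by (simp add: S_def convergent_Cauchy)
      then obtain N where N: "\<And>m n. m \<ge> N \<Longrightarrow> n \<ge> N \<Longrightarrow> norm (L2_inner (f (r m)) (g k) - L2_inner (f (r n)) (g k)) < e/4"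
        using CauchyD[of "\<lambda>n. L2_inner (f (r n)) (g k)" "e/4"] e by auto
      have "norm (L2_inner (f (r m)) g0 - L2_inner (f (r n)) g0) < e" if mn: "m \<ge> N" "n \<ge> N" for m n
      proof -
        have tri: "norm (x - y) \<le> norm (a - b) + norm (a - x) + norm (b - y)" for a b x y :: complex
        proof -
          have "x - y = (a - b) - (a - x) + (b - y)" by simp
          then have "norm (x - y) = norm ((a - b) - (a - x) + (b - y))" by (rule arg_cong)
          then show ?thesis
            using norm_triangle_ineq[of "(a - b) - (a - x)" "b - y"] norm_triangle_ineq4[of "a - b" "a - x"] by linarith
        qed
        show ?thesis
          using tri[of "L2_inner (f (r m)) g0" "L2_inner (f (r n)) g0" "L2_inner (f (r m)) (g k)" "L2_inner (f (r n)) (g k)"]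
            N[OF mn] near[of "r m"] near[of "r n"] e by linarith
      qed
      then show "\<exists>M. \<forall>m\<ge>M. \<forall>n\<ge>M. norm (L2_inner (f (r m)) g0 - L2_inner (f (r n)) g0) < e" by blast
    qed
    then show ?thesis using g0 by (simp add: S_def Cauchy_convergent_iff)
  qed
  have all: "g \<in> S" if g: "g \<in> L2" for g
  proof -
    \<comment> \<open>\<open>V\<close> is the orthogonal projection of \<open>g\<close> onto \<open>S\<close>\<close>
    obtain V where V: "V \<in> S" "\<And>h. h \<in> S \<Longrightarrow> Re (L2_inner V h) = Re (L2_inner g h)"
    proof (rule L2_Riesz_subspace[OF S1 S_add S_cmult S_closed, where l="\<lambda>h. Re (L2_inner g h)" and K="L2_norm g"])
      fix h k assume "h \<in> S" "k \<in> S"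
      then show "Re (L2_inner g (\<lambda>x. h x + k x)) = Re (L2_inner g h) + Re (L2_inner g k)"
        using g S1 by (subst L2_inner_add_right) auto
    next
      fix h assume "h \<in> S"
      then show "\<bar>Re (L2_inner g h)\<bar> \<le> L2_norm g * L2_norm h"
        using L2_Cauchy_Schwarz[OF g, of h] S1 abs_Re_le_cmod order_trans by blast
    qed (auto simp: L2_inner_cmult_right)
    have "L2_inner V (f n) = L2_inner g (f n)" for n
      using V(2)[OF fS[of n]] V(2)[OF S_cmult[OF fS[of n], of \<i>]] by (auto simp: complex_eq_iff L2_inner_cmult_right)
    then have "L2_inner (f n) V = L2_inner (f n) g" for n using L2_inner_commute by metis
    then show ?thesis using V(1) g by (simp add: S_def)
  qed
  define l where "l g = lim (\<lambda>n. L2_inner (f (r n)) g)" for g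
  have l: "(\<lambda>n. L2_inner (f (r n)) g) \<longlonglongrightarrow> l g" if "g \<in> L2" for g
    using all[OF that] by (simp add: S_def l_def convergent_LIMSEQ_iff)
  obtain f0 where f0: "f0 \<in> L2" "\<And>g. g \<in> L2 \<Longrightarrow> Re (L2_inner f0 g) = Re (l g)"
  proof (rule L2_Riesz_subspace[of L2 "\<lambda>g. Re (l g)" K])
    fix g h :: "real^2 \<Rightarrow> complex" assume gh: "g \<in> L2" "h \<in> L2"
    have "(\<lambda>n. L2_inner (f (r n)) g + L2_inner (f (r n)) h) \<longlonglongrightarrow> l g + l h" by (intro tendsto_add l gh)
    then have "(\<lambda>n. L2_inner (f (r n)) (\<lambda>x. g x + h x)) \<longlonglongrightarrow> l g + l h" using f gh by (simp add: L2_inner_add_right)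
    then have "l (\<lambda>x. g x + h x) = l g + l h" using l[OF L2_add[OF gh]] LIMSEQ_unique by blast
    then show "Re (l (\<lambda>x. g x + h x)) = Re (l g) + Re (l h)" by simp
  next
    fix g :: "real^2 \<Rightarrow> complex" and c assume g: "g \<in> L2"
    have "(\<lambda>n. of_real c * L2_inner (f (r n)) g) \<longlonglongrightarrow> of_real c * l g" by (intro tendsto_mult_left l g)
    then have "(\<lambda>n. L2_inner (f (r n)) (\<lambda>x. of_real c * g x)) \<longlonglongrightarrow> of_real c * l g" by (simp add: L2_inner_cmult_right)
    then have "l (\<lambda>x. of_real c * g x) = of_real c * l g" using l[OF L2_cmult[OF g]] LIMSEQ_unique by blast
    then show "Re (l (\<lambda>x. of_real c * g x)) = c * Re (l g)" by simp
  next
    fix g :: "real^2 \<Rightarrow> complex" assume g: "g \<in> L2"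
    have "norm (l g) \<le> K * L2_norm g"
    proof (rule LIMSEQ_le_const2)
      show "(\<lambda>n. norm (L2_inner (f (r n)) g)) \<longlonglongrightarrow> norm (l g)" by (intro tendsto_norm l g)
      have "norm (L2_inner (f (r n)) g) \<le> K * L2_norm g" for n
        using L2_Cauchy_Schwarz[OF f[of "r n"] g] mult_right_mono[OF K[of "r n"] L2_norm_nonneg[of g]] by linarith
      then show "\<exists>N. \<forall>n\<ge>N. norm (L2_inner (f (r n)) g) \<le> K * L2_norm g" by blast
    qed
    then show "\<bar>Re (l g)\<bar> \<le> K * L2_norm g" using abs_Re_le_cmod order_trans by blast
  qed auto
  have "(\<lambda>n. L2_inner (f (r n)) g) \<longlonglongrightarrow> L2_inner f0 g" if g: "g \<in> L2" for g
  proof -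
    have ig: "(\<lambda>x. \<i> * g x) \<in> L2" using g by auto
    have "(\<lambda>n. - \<i> * L2_inner (f (r n)) g) \<longlonglongrightarrow> - \<i> * l g" by (intro tendsto_mult_left l g)
    then have "(\<lambda>n. L2_inner (f (r n)) (\<lambda>x. \<i> * g x)) \<longlonglongrightarrow> - \<i> * l g" by (simp add: L2_inner_cmult_right)
    then have "l (\<lambda>x. \<i> * g x) = - \<i> * l g" using l[OF ig] LIMSEQ_unique by blast
    then have "L2_inner f0 g = l g" using f0(2)[OF g] f0(2)[OF ig] by (simp add: complex_eq_iff L2_inner_cmult_right)
    then show ?thesis using l[OF g] by simp
  qed
  then show thesis using that[OF r f0(1)] by (simp add: L2_weakly_def)
qed

section \<open>Smooth bump functions\<close>

text \<open>
  For \<open>t > 0\<close> this is \<open>t\<^sup>-\<^sup>n e\<^sup>-\<^sup>1\<^sup>/\<^sup>t\<close>. The powers are included because they are what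
  differentiation produces.
\<close>

definition flat_exp :: "nat \<Rightarrow> real \<Rightarrow> real" where
  "flat_exp n t = (if t > 0 then (1 / t) ^ n * exp (- (1 / t)) else 0)"

lemma flat_exp_tendsto_0: "(flat_exp n \<longlongrightarrow> 0) (at 0)"
proof -
  have "((\<lambda>s::real. s ^ n / exp s) \<longlongrightarrow> 0) at_top" by (rule tendsto_power_div_exp_0)
  then have "((\<lambda>t::real. (inverse t) ^ n / exp (inverse t)) \<longlongrightarrow> 0) (at_right 0)"
    by (rule filterlim_compose[OF _ filterlim_inverse_at_top_right])
  then have R: "(flat_exp n \<longlongrightarrow> 0) (at_right 0)"
    by (rule Lim_transform_eventually)
      (auto simp: eventually_at_right_less flat_exp_def exp_minus divide_inverse intro!: eventually_mono[OF eventually_at_right_less])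
  have L: "(flat_exp n \<longlongrightarrow> 0) (at_left 0)"
    by (rule tendsto_eventually) (auto simp: flat_exp_def eventually_at_left_field intro!: exI[of _ "-1"])
  show ?thesis using L R by (rule filterlim_split_at)
qed

lemma flat_exp_has_derivative:
  "(flat_exp n has_real_derivative (flat_exp (n + 2) t - n * flat_exp (n + 1) t)) (at t)"
proof -
  consider "t > 0" | "t < 0" | "t = 0" by linarith
  then show ?thesis
  proof cases
    case 1
    have "((\<lambda>t. (1 / t) ^ n * exp (- (1 / t))) has_real_derivative (flat_exp (n + 2) t - n * flat_exp (n + 1) t)) (at t)"
      using 1 by (auto intro!: derivative_eq_intros simp: flat_exp_def field_simps power2_eq_square)
        (cases n; simp add: field_simps power2_eq_square)
    then show ?thesis
      by (rule has_field_derivative_transform_within_open[of _ _ _ "{0<..}"]) (use 1 in \<open>auto simp: flat_exp_def\<close>)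
  next
    case 2
    have "((\<lambda>t::real. 0) has_real_derivative (flat_exp (n + 2) t - n * flat_exp (n + 1) t)) (at t)"
      using 2 by (simp add: flat_exp_def)
    then show ?thesis
      by (rule has_field_derivative_transform_within_open[of _ _ _ "{..<0}"]) (use 2 in \<open>auto simp: flat_exp_def\<close>)
  next
    case 3
    have "((\<lambda>h. (flat_exp n (0 + h) - flat_exp n 0) / h) \<longlongrightarrow> 0) (at 0)"
    proof (rule Lim_transform_eventually[OF flat_exp_tendsto_0[of "Suc n"]])
      show "\<forall>\<^sub>F h in at 0. flat_exp (Suc n) h = (flat_exp n (0 + h) - flat_exp n 0) / h"
        by (auto simp: flat_exp_def eventually_at_filter field_simps)
    qed
    then have "(flat_exp n has_real_derivative 0) (at 0)" unfolding DERIV_def .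
    then show ?thesis using 3 by (simp add: flat_exp_def)
  qed
qed

text \<open>
  To prove that a function is smooth in the sense of \<open>Ck\<close>, one needs a set of differentiable
  functions that contains it and is closed under partial derivatives.
\<close>

inductive_set bump_algebra :: "real \<Rightarrow> real^2 \<Rightarrow> (real^2 \<Rightarrow> complex) set" for k a where
  const: "(\<lambda>x. c) \<in> bump_algebra k a"
| coord: "(\<lambda>x. of_real (x $ i)) \<in> bump_algebra k a"
| add: "f \<in> bump_algebra k a \<Longrightarrow> g \<in> bump_algebra k a \<Longrightarrow> (\<lambda>x. f x + g x) \<in> bump_algebra k a"
| mult: "f \<in> bump_algebra k a \<Longrightarrow> g \<in> bump_algebra k a \<Longrightarrow> (\<lambda>x. f x * g x) \<in> bump_algebra k a"
| flat: "(\<lambda>x. of_real (flat_exp n (1 - k\<^sup>2 * ((x - a) \<bullet> (x - a))))) \<in> bump_algebra k a"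

lemma bump_algebra_derivative:
  assumes "f \<in> bump_algebra k a"
  shows "\<exists>p. (\<forall>i. p i \<in> bump_algebra k a) \<and> (\<forall>x. (f has_derivative (\<lambda>v. \<Sum>i\<in>UNIV. of_real (v $ i) * p i x)) (at x))"
  using assms
proof induction
  case (const c)
  show ?case
    by (rule exI[of _ "\<lambda>i x. 0"]) (auto intro: bump_algebra.const)
next
  case (coord j)
  have "((\<lambda>x. complex_of_real (x $ j)) has_derivative (\<lambda>v. \<Sum>i\<in>UNIV. of_real (v $ i) * (if i = j then 1 else 0))) (at x)" for x :: "real^2"
  proof -
    have "((\<lambda>x. complex_of_real (x $ j)) has_derivative (\<lambda>v. of_real (v $ j))) (at x)"
      by (intro bounded_linear_imp_has_derivative bounded_linear_compose[OF bounded_linear_of_real] bounded_linear_vec_nth)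
    moreover have "(\<Sum>i\<in>UNIV. complex_of_real (v $ i) * (if i = j then 1 else 0)) = of_real (v $ j)" for v :: "real^2"
      by (subst sum.cong[OF refl, of _ _ "\<lambda>i. if i = j then of_real (v $ j) else 0"]) auto
    ultimately show ?thesis by simp
  qed
  then show ?case
    by (intro exI[of _ "\<lambda>i x. if i = j then 1 else 0"]) (auto intro: bump_algebra.const)
next
  case (add f g)
  then obtain p q where p: "\<And>i. p i \<in> bump_algebra k a" "\<And>x. (f has_derivative (\<lambda>v. \<Sum>i\<in>UNIV. of_real (v $ i) * p i x)) (at x)"
    and q: "\<And>i. q i \<in> bump_algebra k a" "\<And>x. (g has_derivative (\<lambda>v. \<Sum>i\<in>UNIV. of_real (v $ i) * q i x)) (at x)" by blast
  have "((\<lambda>x. f x + g x) has_derivative (\<lambda>v. \<Sum>i\<in>UNIV. of_real (v $ i) * (p i x + q i x))) (at x)" for x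
    using has_derivative_add[OF p(2) q(2), of x] by (simp add: ring_distribs sum.distrib)
  then show ?case using bump_algebra.add[OF p(1) q(1)]
    by (intro exI[of _ "\<lambda>i x. p i x + q i x"]) auto
next
  case (mult f g)
  then obtain p q where p: "\<And>i. p i \<in> bump_algebra k a" "\<And>x. (f has_derivative (\<lambda>v. \<Sum>i\<in>UNIV. of_real (v $ i) * p i x)) (at x)"
    and q: "\<And>i. q i \<in> bump_algebra k a" "\<And>x. (g has_derivative (\<lambda>v. \<Sum>i\<in>UNIV. of_real (v $ i) * q i x)) (at x)" by blast
  have "((\<lambda>x. f x * g x) has_derivative (\<lambda>v. \<Sum>i\<in>UNIV. of_real (v $ i) * (f x * q i x + p i x * g x))) (at x)" for x
    using has_derivative_mult[OF p(2) q(2), of x]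
    by (simp add: ring_distribs sum.distrib sum_distrib_left sum_distrib_right mult_ac)
  then show ?case
    by (intro exI[of _ "\<lambda>i x. f x * q i x + p i x * g x"])
      (auto intro!: bump_algebra.add bump_algebra.mult p q mult.hyps)
next
  case (flat n)
  define A where "A x = flat_exp (n + 2) (1 - k\<^sup>2 * ((x - a) \<bullet> (x - a))) - n * flat_exp (n + 1) (1 - k\<^sup>2 * ((x - a) \<bullet> (x - a)))" for x
  define p where "p i x = complex_of_real (- 2 * k\<^sup>2) * (of_real (x $ i) + of_real (- (a $ i))) *
    (of_real (flat_exp (n + 2) (1 - k\<^sup>2 * ((x - a) \<bullet> (x - a)))) + of_real (- real n) * of_real (flat_exp (n + 1) (1 - k\<^sup>2 * ((x - a) \<bullet> (x - a)))))" for i and x :: "real^2"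
  have pA: "p i x = of_real (A x * (- 2 * k\<^sup>2 * ((x - a) $ i)))" for i x
    by (simp add: p_def A_def algebra_simps)
  have "((\<lambda>x. complex_of_real (flat_exp n (1 - k\<^sup>2 * ((x - a) \<bullet> (x - a))))) has_derivative (\<lambda>v. \<Sum>i\<in>UNIV. of_real (v $ i) * p i x)) (at x)" for x
  proof -
    have 1: "((\<lambda>x. 1 - k\<^sup>2 * ((x - a) \<bullet> (x - a))) has_derivative (\<lambda>v. - (k\<^sup>2 * (2 * ((x - a) \<bullet> v))))) (at x)"
      by (auto intro!: derivative_eq_intros simp: inner_commute algebra_simps)
    have 2: "((\<lambda>x. flat_exp n (1 - k\<^sup>2 * ((x - a) \<bullet> (x - a)))) has_derivative (\<lambda>v. A x * (- (k\<^sup>2 * (2 * ((x - a) \<bullet> v)))))) (at x)"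
      using has_derivative_compose[OF 1 flat_exp_has_derivative[unfolded has_field_derivative_def], of n]
      by (simp add: A_def)
    have 3: "((\<lambda>x. complex_of_real (flat_exp n (1 - k\<^sup>2 * ((x - a) \<bullet> (x - a))))) has_derivative (\<lambda>v. of_real (A x * (- (k\<^sup>2 * (2 * ((x - a) \<bullet> v))))))) (at x)"
      by (rule has_derivative_of_real[OF 2])
    have "of_real (A x * (- (k\<^sup>2 * (2 * ((x - a) \<bullet> v))))) = (\<Sum>i\<in>UNIV. of_real (v $ i) * p i x)" for v
    proof -
      have "A x * (- (k\<^sup>2 * (2 * ((x - a) \<bullet> v)))) = (\<Sum>i\<in>UNIV. v $ i * (A x * (- 2 * k\<^sup>2 * ((x - a) $ i))))"
        unfolding inner_vec_def sum_distrib_left sum_negf[symmetric]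
        by (rule sum.cong[OF refl]) (simp add: algebra_simps)
      then show ?thesis unfolding pA by (simp only: of_real_sum of_real_mult)
    qed
    then show ?thesis using 3 by simp
  qed
  moreover have "p i \<in> bump_algebra k a" for i unfolding p_def[abs_def] by (intro bump_algebra.intros)
  ultimately show ?case by (intro exI[of _ p]) auto
qed

lemma partial_deriv_eq:
  assumes "\<And>x. (f has_derivative (\<lambda>v. \<Sum>i\<in>UNIV. of_real (v $ i) * p i x)) (at x)"
  shows "partial_deriv j f = p j"
proof
  fix x
  have "frechet_derivative f (at x) = (\<lambda>v. \<Sum>i\<in>UNIV. of_real (v $ i) * p i x)"
    using frechet_derivative_at[OF assms] by simp
  then have "partial_deriv j f x = (\<Sum>i\<in>UNIV. of_real ((axis j 1 :: real^2) $ i) * p i x)"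
    by (simp add: partial_deriv_def)
  also have "\<dots> = (\<Sum>i\<in>UNIV. if i = j then p j x else 0)"
    by (rule sum.cong) (auto simp: axis_def)
  finally show "partial_deriv j f x = p j x" by simp
qed

lemma bump_algebra_Ck: "f \<in> bump_algebra k a \<Longrightarrow> Ck n f"
proof (induction n arbitrary: f)
  case 0
  obtain p where "\<And>x. (f has_derivative (\<lambda>v. \<Sum>i\<in>UNIV. of_real (v $ i) * p i x)) (at x)"
    using bump_algebra_derivative[OF 0] by blast
  then show ?case by (auto intro!: continuous_at_imp_continuous_on dest: has_derivative_continuous)
next
  case (Suc n)
  obtain p where p: "\<And>i. p i \<in> bump_algebra k a" "\<And>x. (f has_derivative (\<lambda>v. \<Sum>i\<in>UNIV. of_real (v $ i) * p i x)) (at x)"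
    using bump_algebra_derivative[OF Suc.prems] by blast
  then show ?case using Suc.IH[OF p(1)] partial_deriv_eq[OF p(2)] by (auto simp: differentiable_def)
qed

definition bump :: "real \<Rightarrow> real^2 \<Rightarrow> real^2 \<Rightarrow> complex" where
  "bump k a x = of_real (flat_exp 0 (1 - k\<^sup>2 * ((x - a) \<bullet> (x - a))))"

lemma test_function_bump:
  assumes k: "k > 0" shows "test_function (bump k a)"
proof -
  have "{x. bump k a x \<noteq> 0} \<subseteq> cball a (1 / k)"
  proof
    fix x assume "x \<in> {x. bump k a x \<noteq> 0}"
    then have "1 - k\<^sup>2 * (norm (x - a))\<^sup>2 > 0" by (auto simp: bump_def flat_exp_def power2_norm_eq_inner split: if_splits)
    then have "(k * norm (x - a))\<^sup>2 < 1\<^sup>2" by (simp add: power_mult_distrib)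
    then have "k * norm (x - a) < 1" by (rule power2_less_imp_less) simp
    then show "x \<in> cball a (1 / k)" using k by (simp add: dist_norm norm_minus_commute field_simps)
  qed
  then have "bounded {x. bump k a x \<noteq> 0}" by (rule bounded_subset[OF bounded_cball])
  then have "compact (closure {x. bump k a x \<noteq> 0})" by (simp add: compact_closure)
  moreover have "bump k a \<in> bump_algebra k a" unfolding bump_def[abs_def] by (rule bump_algebra.flat)
  ultimately show ?thesis using bump_algebra_Ck by (auto simp: test_function_def)
qed

section \<open>The Fourier integral of a derivative\<close>

lemma test_function_facts:
  assumes "test_function \<phi>"
  shows "\<And>x. \<phi> differentiable (at x)" "continuous_on UNIV \<phi>" "\<And>i. continuous_on UNIV (partial_deriv i \<phi>)"
    and "\<exists>R. \<forall>x. norm x \<ge> R \<longrightarrow> \<phi> x = 0 \<and> partial_deriv i \<phi> x = 0"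
proof -
  have "Ck 0 \<phi>" and C1: "Ck (Suc 0) \<phi>" using assms unfolding test_function_def by blast+
  then show d: "\<And>x. \<phi> differentiable (at x)" "continuous_on UNIV \<phi>" "\<And>i. continuous_on UNIV (partial_deriv i \<phi>)"
    by auto
  have "bounded {x. \<phi> x \<noteq> 0}"
    using assms compact_imp_bounded bounded_subset[OF _ closure_subset] by (auto simp: test_function_def)
  then obtain R where R: "\<And>x. \<phi> x \<noteq> 0 \<Longrightarrow> norm x \<le> R" by (auto simp: bounded_iff)
  have "\<phi> x = 0 \<and> partial_deriv i \<phi> x = 0" if x: "norm x \<ge> R + 1" for x
  proof
    show "\<phi> x = 0" using R[of x] x by fastforce
    have "((\<lambda>x. 0) has_derivative (\<lambda>v. 0)) (at x)" by simp
    then have "(\<phi> has_derivative (\<lambda>v. 0)) (at x)"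
    proof (rule has_derivative_transform_within_open[where s="{y. norm y > R}"])
      show "open {y. norm y > R}" by (intro open_Collect_less continuous_intros)
      show "x \<in> {y. norm y > R}" using x by simp
      show "0 = \<phi> y" if "y \<in> {y. norm y > R}" for y using R[of y] that by fastforce
    qed
    then have "(\<lambda>v. 0) = frechet_derivative \<phi> (at x)" by (rule frechet_derivative_at)
    then show "partial_deriv i \<phi> x = 0" by (simp add: partial_deriv_def fun_eq_iff)
  qed
  then show "\<exists>R. \<forall>x. norm x \<ge> R \<longrightarrow> \<phi> x = 0 \<and> partial_deriv i \<phi> x = 0" by blast
qed

lemma continuous_compact_support_bounded:
  fixes f :: "real^2 \<Rightarrow> complex"
  assumes "continuous_on UNIV f" "\<And>x. norm x \<ge> R \<Longrightarrow> f x = 0"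
  obtains B where "\<And>x. norm (f x) \<le> B"
proof -
  have "compact (f ` cball 0 R)"
    by (rule compact_continuous_image) (use assms(1) continuous_on_subset in auto)
  from compact_imp_bounded[OF this] obtain B where B: "\<And>x. x \<in> cball 0 R \<Longrightarrow> norm (f x) \<le> B"
    unfolding bounded_iff by blast
  have "norm (f x) \<le> max B 0" for x
  proof (cases "norm x \<le> R")
    case True then show ?thesis using B[of x] by auto
  next
    case False then show ?thesis using assms(2)[of x] by auto
  qed
  then show thesis by (rule that)
qed

lemma test_function_L2:
  assumes "test_function \<phi>"
  shows "\<phi> \<in> L2" "integrable lborel \<phi>" "partial_deriv i \<phi> \<in> L2" "integrable lborel (partial_deriv i \<phi>)"
proof -
  note tf = test_function_facts[OF assms]
  obtain R where R: "\<And>x. norm x \<ge> R \<Longrightarrow> \<phi> x = 0 \<and> partial_deriv i \<phi> x = 0" using tf(4)[of i] by blast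
  obtain B where B: "\<And>x. norm (\<phi> x) \<le> B" using continuous_compact_support_bounded[OF tf(2), of R] R by auto
  obtain B' where B': "\<And>x. norm (partial_deriv i \<phi> x) \<le> B'" using continuous_compact_support_bounded[OF tf(3), of R i] R by auto
  have m: "\<phi> \<in> borel_measurable borel" "partial_deriv i \<phi> \<in> borel_measurable borel"
    using tf(2,3) by (auto intro: borel_measurable_continuous_onI)
  show "\<phi> \<in> L2" "integrable lborel \<phi>" using L2_bounded_support[OF m(1) B, of R] R by auto
  show "partial_deriv i \<phi> \<in> L2" "integrable lborel (partial_deriv i \<phi>)" using L2_bounded_support[OF m(2) B', of R] R by auto
qed

lemma difference_quotient_cis:
  fixes c :: real and t :: "nat \<Rightarrow> real"
  assumes t: "t \<longlonglongrightarrow> 0" "\<And>n. t n \<noteq> 0"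
  shows "(\<lambda>n. (cis (c * t n) - 1) / of_real (t n)) \<longlonglongrightarrow> \<i> * of_real c"
proof (cases "c = 0")
  case False
  define z where "z n = \<i> * of_real (c * t n)" for n
  have "(\<lambda>n. c * t n) \<longlonglongrightarrow> c * 0" by (intro tendsto_mult tendsto_const t)
  then have "z \<longlonglongrightarrow> \<i> * of_real (c * 0)" unfolding z_def by (rule tendsto_mult[OF tendsto_const tendsto_of_real])
  moreover have z0: "z n \<noteq> 0" for n using False t by (simp add: z_def)
  ultimately have "filterlim z (at 0) sequentially" by (auto simp: filterlim_at)
  then have "(\<lambda>n. (exp (z n) - 1) / z n) \<longlonglongrightarrow> 1" by (rule filterlim_compose[OF lim_exp_minus_1])
  then have "(\<lambda>n. (\<i> * of_real c) * ((exp (z n) - 1) / z n)) \<longlonglongrightarrow> (\<i> * of_real c) * 1" by (intro tendsto_intros)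
  moreover have "(\<i> * of_real c) * ((exp (z n) - 1) / z n) = (cis (c * t n) - 1) / of_real (t n)" for n
    using False t by (simp add: z_def cis_conv_exp field_simps)
  ultimately show ?thesis by simp
qed auto

text \<open>
  Difference quotients converge boundedly on a fixed ball, and a translation becomes a phase
  under the transform, so the claim is the derivative of a phase.
\<close>

lemma fourier_integral_partial_deriv:
  assumes "test_function \<phi>"
  shows "FI (partial_deriv i \<phi>) \<xi> = 2 * pi * \<i> * of_real (\<xi> $ i) * FI \<phi> \<xi>"
proof -
  note tf = test_function_facts[OF assms]
  obtain R where R: "\<And>x. norm x \<ge> R \<Longrightarrow> \<phi> x = 0 \<and> partial_deriv i \<phi> x = 0" using tf(4)[of i] by blast
  obtain B where B: "\<And>x. norm (partial_deriv i \<phi> x) \<le> B" using continuous_compact_support_bounded[OF tf(3), of R i] R by auto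
  have B0: "0 \<le> B" by (rule order_trans[OF norm_ge_zero B])
  have [measurable]: "\<phi> \<in> borel_measurable borel" using L2_measurable[OF test_function_L2(1)[OF assms]] .
  have [measurable]: "partial_deriv i \<phi> \<in> borel_measurable borel" using L2_measurable[OF test_function_L2(3)[OF assms]] .
  define e where "e = (axis i 1 :: real^2)"
  define t where "t n = 1 / real (Suc n)" for n
  have t: "t n > 0" "t n \<le> 1" "t n \<noteq> 0" for n by (auto simp: t_def)
  have t_lim: "t \<longlonglongrightarrow> 0" unfolding t_def by (rule LIMSEQ_Suc[OF lim_1_over_n])
  have e1: "norm e = 1" by (simp add: e_def)
  define Q where "Q n x = (\<phi> (x + t n *\<^sub>R e) - \<phi> x) / of_real (t n)" for n x
  have [measurable]: "Q n \<in> borel_measurable borel" for n unfolding Q_def by measurable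
  have der: "(\<phi> has_derivative frechet_derivative \<phi> (at x)) (at x)" for x
    using tf(1)[of x] by (simp add: frechet_derivative_works)
  have Q_lim: "(\<lambda>n. Q n x) \<longlonglongrightarrow> partial_deriv i \<phi> x" for x
  proof -
    define A where "A = frechet_derivative \<phi> (at x)"
    have A: "(\<phi> has_derivative A) (at x)" unfolding A_def by (rule der)
    then have bl: "bounded_linear A" by (rule has_derivative_bounded_linear)
    have lim: "((\<lambda>h. norm (\<phi> (x + h) - \<phi> x - A h) / norm h) \<longlongrightarrow> 0) (at 0)"
      using A by (simp add: has_derivative_at)
    have "(\<lambda>n. t n *\<^sub>R e) \<longlonglongrightarrow> 0 *\<^sub>R e" by (intro tendsto_intros t_lim)
    then have "filterlim (\<lambda>n. t n *\<^sub>R e) (at 0) sequentially" using t e1 by (auto simp: filterlim_at)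
    from filterlim_compose[OF lim this]
    have "(\<lambda>n. norm (\<phi> (x + t n *\<^sub>R e) - \<phi> x - A (t n *\<^sub>R e)) / norm (t n *\<^sub>R e)) \<longlonglongrightarrow> 0" .
    moreover have "norm (\<phi> (x + t n *\<^sub>R e) - \<phi> x - A (t n *\<^sub>R e)) / norm (t n *\<^sub>R e) = norm (Q n x - A e)" for n
    proof -
      have "Q n x - A e = (\<phi> (x + t n *\<^sub>R e) - \<phi> x - A (t n *\<^sub>R e)) / of_real (t n)"
        using t(3)[of n] linear_scale[OF bounded_linear.linear[OF bl], of "t n" e]
        by (simp add: Q_def scaleR_conv_of_real field_simps)
      then show ?thesis using t(1)[of n] e1 by (simp add: norm_divide)
    qed
    ultimately have "(\<lambda>n. norm (Q n x - A e)) \<longlonglongrightarrow> 0" by simp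
    then have "(\<lambda>n. Q n x - A e) \<longlonglongrightarrow> 0" by (rule tendsto_norm_zero_cancel)
    then show ?thesis unfolding partial_deriv_def A_def e_def by (rule LIM_zero_cancel)
  qed
  have Q_le: "norm (Q n x) \<le> norm (B * indicator (ball (0::real^2) (R + 1)) x :: real)" for n x
  proof (cases "norm x < R + 1")
    case False
    have "norm x \<le> norm (x + t n *\<^sub>R e) + norm (t n *\<^sub>R e)"
      using norm_triangle_ineq4[of "x + t n *\<^sub>R e" "t n *\<^sub>R e"] by simp
    then have "norm (x + t n *\<^sub>R e) \<ge> R" using False t[of n] e1 by simp
    then show ?thesis using R[of x] R[of "x + t n *\<^sub>R e"] False by (simp add: Q_def)
  next
    case True
    define g where "g s = \<phi> (x + s *\<^sub>R e)" for s
    have g_der: "(g has_derivative (\<lambda>r. r *\<^sub>R partial_deriv i \<phi> (x + s *\<^sub>R e))) (at s within {0..t n})" for s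
    proof -
      have "((\<lambda>s. x + s *\<^sub>R e) has_derivative (\<lambda>r. r *\<^sub>R e)) (at s within {0..t n})"
        by (auto intro!: derivative_eq_intros)
      from has_derivative_compose[OF this der]
      have "(g has_derivative (\<lambda>r. frechet_derivative \<phi> (at (x + s *\<^sub>R e)) (r *\<^sub>R e))) (at s within {0..t n})"
        unfolding g_def .
      moreover have "frechet_derivative \<phi> (at (x + s *\<^sub>R e)) (r *\<^sub>R e) = r *\<^sub>R partial_deriv i \<phi> (x + s *\<^sub>R e)" for r
        unfolding partial_deriv_def e_def
        by (rule linear_scale[OF bounded_linear.linear[OF has_derivative_bounded_linear[OF der]]])
      ultimately show ?thesis by simp
    qed
    have "norm (g (t n) - g 0) \<le> B * norm (t n - 0)"
    proof (rule differentiable_bound[OF _ g_der])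
      show "onorm (\<lambda>r. r *\<^sub>R partial_deriv i \<phi> (x + s *\<^sub>R e)) \<le> B" for s :: real
      proof (rule onorm_bound[OF B0])
        fix r :: real
        show "norm (r *\<^sub>R partial_deriv i \<phi> (x + s *\<^sub>R e)) \<le> B * norm r"
          using mult_left_mono[OF B, of "\<bar>r\<bar>" "x + s *\<^sub>R e"] by (simp add: mult.commute)
      qed
    qed (use t(1)[of n] in auto)
    then have "norm (Q n x) \<le> B" using t(1)[of n] by (simp add: Q_def g_def norm_divide divide_le_eq)
    then show ?thesis using True B0 by simp
  qed
  have FQ: "FI (Q n) \<xi> = (cis (2 * pi * \<xi> $ i * t n) - 1) / of_real (t n) * FI \<phi> \<xi>" for n
  proof -
    have int: "integrable lborel (\<lambda>x. \<phi> (x + t n *\<^sub>R e))"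
      by (rule lborel_integrable_shift) (use test_function_L2(2)[OF assms] in auto)
    have "FI (Q n) \<xi> = FI (\<lambda>x. (1 / of_real (t n)) * (\<phi> (x + t n *\<^sub>R e) - \<phi> x)) \<xi>"
      by (rule arg_cong[where f="\<lambda>q. FI q \<xi>"]) (simp add: Q_def fun_eq_iff)
    also have "\<dots> = (1 / of_real (t n)) * (cis (2 * pi * (\<xi> \<bullet> (t n *\<^sub>R e))) * FI \<phi> \<xi> - FI \<phi> \<xi>)"
      by (simp only: fourier_integral_cmult fourier_integral_diff[OF int test_function_L2(2)[OF assms]] fourier_integral_shift[OF \<open>\<phi> \<in> borel_measurable borel\<close>])
    also have "2 * pi * (\<xi> \<bullet> (t n *\<^sub>R e)) = 2 * pi * \<xi> $ i * t n" by (simp add: e_def inner_axis)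
    finally show ?thesis by (simp add: field_simps)
  qed
  have "(\<lambda>n. FI (Q n) \<xi>) \<longlonglongrightarrow> FI (partial_deriv i \<phi>) \<xi>"
    unfolding fourier_integral_def
  proof (rule integral_dominated_convergence[where w="\<lambda>x. norm (B * indicator (ball (0::real^2) (R + 1)) x :: real)"])
    have "integrable lborel (\<lambda>x::real^2. B * indicator (ball 0 (R+1)) x :: real)"
      using emeasure_bounded_finite[of "ball (0::real^2) (R+1)"]
      by (intro integrable_mult_right integrable_real_indicator) auto
    then show "integrable lborel (\<lambda>x::real^2. norm (B * indicator (ball 0 (R + 1)) x :: real))" by (rule integrable_norm)
    show "AE x in lborel. (\<lambda>n. cis (- 2 * pi * (\<xi> \<bullet> x)) * Q n x) \<longlonglongrightarrow> cis (- 2 * pi * (\<xi> \<bullet> x)) * partial_deriv i \<phi> x"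
      by (intro AE_I2 tendsto_mult_left Q_lim)
    show "AE x in lborel. norm (cis (- 2 * pi * (\<xi> \<bullet> x)) * Q n x) \<le> norm (B * indicator (ball 0 (R + 1)) x :: real)" for n
      using Q_le by (intro AE_I2) (simp only: norm_cis_mult)
  qed measurable
  moreover have "(\<lambda>n. FI (Q n) \<xi>) \<longlonglongrightarrow> (\<i> * of_real (2 * pi * \<xi> $ i)) * FI \<phi> \<xi>"
    unfolding FQ by (intro tendsto_mult_right difference_quotient_cis t_lim t)
  ultimately have "FI (partial_deriv i \<phi>) \<xi> = (\<i> * of_real (2 * pi * \<xi> $ i)) * FI \<phi> \<xi>" by (rule LIMSEQ_unique)
  then show ?thesis by (simp add: mult_ac)
qed

section \<open>The space \<open>H\<^sup>1\<close> on the Fourier side\<close>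

lemma fourier_bump_shift: "FI (bump k a) \<xi> = cis (- 2 * pi * (\<xi> \<bullet> a)) * FI (bump k 0) \<xi>" if "k > 0"
proof -
  have "bump k a = (\<lambda>x. bump k 0 (x + (- a)))" by (simp add: bump_def fun_eq_iff)
  moreover have "bump k 0 \<in> borel_measurable borel"
    using L2_measurable[OF test_function_L2(1)[OF test_function_bump[OF that]]] .
  ultimately show ?thesis using fourier_integral_shift[of "bump k 0" "- a" \<xi>] by simp
qed

text \<open>
  On the support of a bump of radius \<open>1 / k\<close> the phase stays below a quarter turn, so the
  real part of the integrand is positive there.
\<close>

lemma fourier_bump_nonzero:
  assumes k: "k > 0" and \<xi>: "4 * norm \<xi> < k"
  shows "FI (bump k 0) \<xi> \<noteq> 0"
proof
  assume zero: "FI (bump k 0) \<xi> = 0"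
  define b where "b x = flat_exp 0 (1 - k\<^sup>2 * (x \<bullet> x))" for x :: "real^2"
  have bump_b: "bump k 0 x = of_real (b x)" for x by (simp add: bump_def b_def)
  have [measurable]: "bump k 0 \<in> borel_measurable borel"
    using L2_measurable[OF test_function_L2(1)[OF test_function_bump[OF k]]] .
  have int: "integrable lborel (\<lambda>x. cis (- 2 * pi * (\<xi> \<bullet> x)) * bump k 0 x)"
    by (intro fourier_integrable test_function_L2 test_function_bump k)
  have int_re: "integrable lborel (\<lambda>x. cos (2 * pi * (\<xi> \<bullet> x)) * b x)"
    using integrable_Re[OF int] by (simp add: bump_b)
  have pos: "cos (2 * pi * (\<xi> \<bullet> x)) > 0" if x: "k * norm x < 1" for x
  proof -
    have "\<bar>\<xi> \<bullet> x\<bar> \<le> norm \<xi> * norm x" by (rule Cauchy_Schwarz_ineq2)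
    also have "4 * (norm \<xi> * norm x) \<le> k * norm x" using mult_right_mono[OF less_imp_le[OF \<xi>], of "norm x"] by simp
    ultimately have "\<bar>\<xi> \<bullet> x\<bar> < 1 / 4" using x by linarith
    then have "\<bar>2 * pi * (\<xi> \<bullet> x)\<bar> < pi / 2" by (simp add: abs_mult)
    then show ?thesis by (intro cos_gt_zero_pi) linarith+
  qed
  have b_zero: "b x = 0" if "\<not> k * norm x < 1" for x
  proof -
    have "1 \<le> (k * norm x)\<^sup>2" using that by (intro one_le_power) simp
    then show ?thesis by (simp add: b_def flat_exp_def power_mult_distrib power2_norm_eq_inner)
  qed
  have b_nonneg: "b x \<ge> 0" for x by (simp add: b_def flat_exp_def)
  have b_pos: "b x > 0" if "k * norm x < 1" for x
  proof -
    have "(k * norm x)\<^sup>2 < 1" using that k by (simp add: power_less_one_iff abs_square_less_1)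
    then show ?thesis by (simp add: b_def flat_exp_def power_mult_distrib power2_norm_eq_inner)
  qed
  have nn: "0 \<le> cos (2 * pi * (\<xi> \<bullet> x)) * b x" for x
    using pos[of x] b_zero[of x] b_nonneg[of x] by (cases "k * norm x < 1") auto
  have "(\<integral>x. cos (2 * pi * (\<xi> \<bullet> x)) * b x \<partial>lborel) = Re (FI (bump k 0) \<xi>)"
    unfolding fourier_integral_def by (subst integral_Re[OF int, symmetric]) (simp add: bump_b)
  then have "AE x in lborel. cos (2 * pi * (\<xi> \<bullet> x)) * b x = 0"
    using integral_nonneg_eq_0_iff_AE[OF int_re] nn zero by simp
  then have AE: "AE x in lborel. x \<notin> ball (0 :: real^2) (1 / k)"
  proof eventually_elim
    case (elim x)
    then show ?case using pos[of x] b_pos[of x] k by (auto simp: field_simps)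
  qed
  then have "AE x in lebesgue. x \<notin> ball (0::real^2) (1 / k)" by (rule AE_completion)
  then have "negligible (ball (0::real^2) (1 / k))"
    by (simp add: negligible_iff_null_sets AE_iff_null_sets)
  then show False using open_not_negligible[of "ball (0::real^2) (1/k)"] k by simp
qed

lemma L2_component:
  assumes "(g :: real^2 \<Rightarrow> complex^2) \<in> L2" shows "(\<lambda>x. g x $ i) \<in> L2"
proof (rule L2_bound[OF assms])
  have [measurable]: "g \<in> borel_measurable borel" using assms by auto
  show "(\<lambda>x. g x $ i) \<in> borel_measurable borel"
    by (rule borel_measurable_continuous_on[of "\<lambda>v. v $ i"]) (auto intro!: continuous_intros)
  show "norm (g x $ i) \<le> 1 * norm (g x)" for x using Finite_Cartesian_Product.norm_nth_le[of "g x" i] by simp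
qed

lemma norm_complex2: "(norm (v :: complex^2))\<^sup>2 = (\<Sum>i\<in>UNIV. (norm (v $ i))\<^sup>2)"
  by (simp add: norm_vec_def L2_set_def sum_nonneg)

lemma norm_real2: "(norm (v :: real^2))\<^sup>2 = (\<Sum>i\<in>UNIV. (v $ i)\<^sup>2)"
  by (simp add: norm_vec_def L2_set_def sum_nonneg)

lemma L2_vec_lambda:
  assumes g: "\<And>i. g i \<in> L2" shows "(\<lambda>x. (\<chi> i. g i x) :: complex^2) \<in> L2"
proof -
  have [measurable]: "g i \<in> borel_measurable borel" for i using g by auto
  have "(\<lambda>x. (\<chi> i. g i x) :: complex^2) \<in> borel_measurable borel"
  proof (subst borel_measurable_euclidean_space, rule ballI)
    fix b :: "complex^2" assume "b \<in> Basis"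
    then obtain i c where "b = axis i c" by (auto simp: Basis_vec_def)
    then show "(\<lambda>x. (\<chi> i. g i x) \<bullet> b) \<in> borel_measurable borel"
      by (simp add: inner_axis)
  qed
  moreover have "integrable lborel (\<lambda>x. (norm ((\<chi> i. g i x) :: complex^2))\<^sup>2)"
    unfolding norm_complex2 by (auto intro!: Bochner_Integration.integrable_sum L2_integrable g)
  ultimately show ?thesis by (simp add: L2_iff)
qed

text \<open>
  Testing against all translates of a bump shows that the function \<open>K\<close> in the proof, the
  difference of the two sides times the reflected transform of the bump, has a vanishing
  Fourier integral. By Plancherel's theorem \<open>K = 0\<close> almost everywhere. The transform of the
  bump has no zeros near the origin, and shrinking the bump enlarges that region to the whole
  plane. In particular the weak gradient is unique up to null sets.
\<close>

lemma weak_gradient_fourier: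
  assumes u: "has_L2_fourier u F" and w: "has_weak_gradient u g" and G: "has_L2_fourier (\<lambda>x. g x $ i) G"
  shows "AE \<xi> in lborel. G \<xi> = 2 * pi * \<i> * of_real (\<xi> $ i) * F \<xi>"
proof -
  have FL: "F \<in> L2" and GL: "G \<in> L2" using has_L2_fourierD u G by auto
  have [measurable]: "F \<in> borel_measurable borel" "G \<in> borel_measurable borel" using FL GL by auto
  have AEk: "AE \<xi> in lborel. (2 * pi * \<i> * of_real (\<xi> $ i) * F \<xi> - G \<xi>) * FI (bump k 0) (- \<xi>) = 0" if k: "k > 0" for k
  proof -
    define b where "b = bump k 0"
    define D where "D = partial_deriv i b"
    have tb: "test_function b" unfolding b_def by (rule test_function_bump[OF k])
    note bL = test_function_L2(1,2)[OF tb] test_function_L2(3,4)[OF tb, of i, folded D_def]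
    have FD: "FI D \<xi> = 2 * pi * \<i> * of_real (\<xi> $ i) * FI b \<xi>" for \<xi>
      unfolding D_def by (rule fourier_integral_partial_deriv[OF tb])
    have [measurable]: "FI b \<in> borel_measurable borel" "FI D \<in> borel_measurable borel"
      using bL by (auto intro!: borel_measurable_fourier_integral)
    have Fb_L2: "(\<lambda>\<xi>. FI b (- \<xi>)) \<in> L2" "(\<lambda>\<xi>. FI D (- \<xi>)) \<in> L2"
      using bL by (auto intro!: L2_reflect fourier_integral_Plancherel)
    \<comment> \<open>written with the transform of the derivative, so that \<open>K\<close> is visibly integrable and in \<open>L\<^sup>2\<close>\<close>
    define K where "K \<xi> = - (FI D (- \<xi>) * F \<xi>) - FI b (- \<xi>) * G \<xi>" for \<xi>
    have K_eq: "K \<xi> = (2 * pi * \<i> * of_real (\<xi> $ i) * F \<xi> - G \<xi>) * FI b (- \<xi>)" for \<xi>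
      by (simp add: K_def FD algebra_simps)
    have i1: "integrable lborel (\<lambda>\<xi>. FI D (- \<xi>) * F \<xi>)" and i2: "integrable lborel (\<lambda>\<xi>. FI b (- \<xi>) * G \<xi>)"
      by (intro L2_integrable_mult Fb_L2 FL GL)+
    have K_int: "integrable lborel K" unfolding K_def using i1 i2 by auto
    have "(\<lambda>\<xi>. FI D (- \<xi>) * F \<xi>) \<in> L2" "(\<lambda>\<xi>. FI b (- \<xi>) * G \<xi>) \<in> L2"
      by (rule L2_mult_bounded[OF _ _ fourier_integral_bound], use FL GL in auto)+
    then have K_L2: "K \<in> L2" unfolding K_def[abs_def] by (intro L2_diff L2_uminus)
    have "FI K (- a) = 0" for a
    proof -
      have ta: "test_function (bump k a)" by (rule test_function_bump[OF k])
      note aL = test_function_L2[OF ta]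
      have Fa: "FI (bump k a) (- \<xi>) = cis (2 * pi * (a \<bullet> \<xi>)) * FI b (- \<xi>)" for \<xi>
        using fourier_bump_shift[OF k, of a "- \<xi>"] by (simp add: b_def inner_commute)
      have Da: "FI (partial_deriv i (bump k a)) (- \<xi>) = cis (2 * pi * (a \<bullet> \<xi>)) * FI D (- \<xi>)" for \<xi>
        unfolding fourier_integral_partial_deriv[OF ta] Fa FD by (simp add: mult_ac)
      have "(\<integral>x. u x * partial_deriv i (bump k a) x \<partial>lborel) = - (\<integral>x. g x $ i * bump k a x \<partial>lborel)"
        using w ta by (simp add: has_weak_gradient_def)
      then have "(\<integral>\<xi>. F \<xi> * FI (partial_deriv i (bump k a)) (- \<xi>) \<partial>lborel) = - (\<integral>\<xi>. G \<xi> * FI (bump k a) (- \<xi>) \<partial>lborel)"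
        using has_L2_fourier_pairing[OF u aL(4,3)] has_L2_fourier_pairing[OF G aL(2,1)] by simp
      then have "(\<integral>\<xi>. cis (2 * pi * (a \<bullet> \<xi>)) * (FI D (- \<xi>) * F \<xi>) \<partial>lborel) = - (\<integral>\<xi>. cis (2 * pi * (a \<bullet> \<xi>)) * (FI b (- \<xi>) * G \<xi>) \<partial>lborel)"
        unfolding Fa Da by (simp add: mult_ac)
      moreover have "FI K (- a) = - (\<integral>\<xi>. cis (2 * pi * (a \<bullet> \<xi>)) * (FI D (- \<xi>) * F \<xi>) \<partial>lborel) - (\<integral>\<xi>. cis (2 * pi * (a \<bullet> \<xi>)) * (FI b (- \<xi>) * G \<xi>) \<partial>lborel)"
      proof -
        have "FI K (- a) = (\<integral>\<xi>. - (cis (2 * pi * (a \<bullet> \<xi>)) * (FI D (- \<xi>) * F \<xi>)) - (cis (2 * pi * (a \<bullet> \<xi>)) * (FI b (- \<xi>) * G \<xi>)) \<partial>lborel)"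
          unfolding fourier_integral_def[of K] by (rule Bochner_Integration.integral_cong) (auto simp: K_def algebra_simps)
        also have "\<dots> = (\<integral>\<xi>. - (cis (2 * pi * (a \<bullet> \<xi>)) * (FI D (- \<xi>) * F \<xi>)) \<partial>lborel) - (\<integral>\<xi>. cis (2 * pi * (a \<bullet> \<xi>)) * (FI b (- \<xi>) * G \<xi>) \<partial>lborel)"
          by (intro Bochner_Integration.integral_diff Bochner_Integration.integrable_minus fourier_integrable i1 i2)
        finally show ?thesis by (simp only: Bochner_Integration.integral_minus)
      qed
      ultimately show ?thesis by simp
    qed
    then have "FI K \<xi> = 0" for \<xi> by (metis minus_minus)
    then have "L2_norm K = 0" using fourier_integral_Plancherel(2)[OF K_int K_L2] by (simp add: L2_norm_def)
    then show ?thesis using L2_norm_eq_0_iff[OF K_L2] by (simp add: K_eq b_def)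
  qed
  have "AE \<xi> in lborel. \<forall>n. (2 * pi * \<i> * of_real (\<xi> $ i) * F \<xi> - G \<xi>) * FI (bump (real (Suc n)) 0) (- \<xi>) = 0"
    unfolding AE_all_countable by (intro allI AEk) simp
  then show ?thesis
  proof eventually_elim
    case (elim \<xi>)
    obtain n where "4 * norm \<xi> < real n" using reals_Archimedean2 by blast
    then have "FI (bump (real (Suc n)) 0) (- \<xi>) \<noteq> 0" by (intro fourier_bump_nonzero) auto
    then show ?case using elim[rule_format, of n] by simp
  qed
qed

definition h1_weight :: "real^2 \<Rightarrow> real" where
  "h1_weight \<xi> = sqrt (1 + (2 * pi * norm \<xi>)\<^sup>2)"

text \<open>
  With \<open>F\<close> the transform of \<open>u\<close>, these are the transforms of the partial derivatives, a
  function whose norm is that of the gradient, and a function whose norm is the \<open>H\<^sup>1\<close> norm.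
\<close>

abbreviation deriv_mult :: "2 \<Rightarrow> (real^2 \<Rightarrow> complex) \<Rightarrow> real^2 \<Rightarrow> complex" where
  "deriv_mult i F \<equiv> (\<lambda>\<xi>. 2 * pi * \<i> * of_real (\<xi> $ i) * F \<xi>)"

abbreviation grad_mult :: "(real^2 \<Rightarrow> complex) \<Rightarrow> real^2 \<Rightarrow> complex" where
  "grad_mult F \<equiv> (\<lambda>\<xi>. of_real (2 * pi * norm \<xi>) * F \<xi>)"

abbreviation h1_mult :: "(real^2 \<Rightarrow> complex) \<Rightarrow> real^2 \<Rightarrow> complex" where
  "h1_mult F \<equiv> (\<lambda>\<xi>. of_real (h1_weight \<xi>) * F \<xi>)"

lemma h1_weight: "h1_weight \<xi> \<ge> 1" "(h1_weight \<xi>)\<^sup>2 = 1 + (2 * pi * norm \<xi>)\<^sup>2" "2 * pi * norm \<xi> \<le> h1_weight \<xi>" "h1_weight \<xi> \<noteq> 0"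
proof -
  show *: "h1_weight \<xi> \<ge> 1" by (simp add: h1_weight_def)
  show "(h1_weight \<xi>)\<^sup>2 = 1 + (2 * pi * norm \<xi>)\<^sup>2" by (simp add: h1_weight_def)
  show "2 * pi * norm \<xi> \<le> h1_weight \<xi>" unfolding h1_weight_def by (rule real_le_rsqrt) simp
  show "h1_weight \<xi> \<noteq> 0" using * by linarith
qed

lemma borel_measurable_h1_weight [measurable]: "h1_weight \<in> borel_measurable borel"
  unfolding h1_weight_def[abs_def] by measurable

text \<open>
  One half of the identification of \<open>H\<^sup>1\<close> with a weighted \<open>L\<^sup>2\<close> space.
\<close>

lemma H1_fourier_D:
  assumes u: "u \<in> H1" and F: "has_L2_fourier u F"
  shows "h1_mult F \<in> L2"
    and "weak_gradient u \<in> L2"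
    and "has_L2_fourier (\<lambda>x. weak_gradient u x $ i) (deriv_mult i F)"
    and "grad_mult F \<in> L2"
proof -
  have "\<exists>g. g \<in> L2 \<and> has_weak_gradient u g" using u by (auto simp: H1_def)
  then have g: "weak_gradient u \<in> L2" "has_weak_gradient u (weak_gradient u)"
    unfolding weak_gradient_def by (metis (mono_tags, lifting) someI_ex)+
  show "weak_gradient u \<in> L2" by fact
  have FL: "F \<in> L2" using has_L2_fourierD F by auto
  have [measurable]: "F \<in> borel_measurable borel" using FL by auto
  have comp: "has_L2_fourier (\<lambda>x. weak_gradient u x $ i) (deriv_mult i F)" for i
  proof -
    obtain G where G: "has_L2_fourier (\<lambda>x. weak_gradient u x $ i) G"
      using L2_fourier_exists[OF L2_component[OF g(1)]] by blast
    show ?thesis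
      by (rule has_L2_fourier_cong_AE[OF G _ _ _ weak_gradient_fourier[OF F g(2) G]])
        (use L2_component[OF g(1), of i] in \<open>auto intro: L2_measurable\<close>)
  qed
  then show "has_L2_fourier (\<lambda>x. weak_gradient u x $ i) (deriv_mult i F)" .
  have cL: "deriv_mult i F \<in> L2" for i using comp by (rule has_L2_fourierD)
  have grad_int: "integrable lborel (\<lambda>\<xi>. \<Sum>i\<in>UNIV. (norm (2 * pi * \<i> * of_real (\<xi> $ i) * F \<xi>))\<^sup>2)"
    by (intro Bochner_Integration.integrable_sum L2_integrable cL)
  have grad_eq: "(\<Sum>i\<in>UNIV. (norm (2 * pi * \<i> * of_real (\<xi> $ i) * F \<xi>))\<^sup>2) = (norm (of_real (2 * pi * norm \<xi>) * F \<xi>))\<^sup>2" for \<xi>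
  proof -
    have "(\<Sum>i\<in>UNIV. (norm (2 * pi * \<i> * of_real (\<xi> $ i) * F \<xi>))\<^sup>2) = (\<Sum>i\<in>UNIV. (\<xi> $ i)\<^sup>2) * ((2 * pi)\<^sup>2 * (norm (F \<xi>))\<^sup>2)"
      unfolding sum_distrib_right by (rule sum.cong) (auto simp: norm_mult power_mult_distrib mult_ac)
    then show ?thesis by (simp add: norm_real2[symmetric] norm_mult power_mult_distrib mult_ac)
  qed
  show L: "grad_mult F \<in> L2"
    using grad_int unfolding grad_eq L2_iff by auto
  have "integrable lborel (\<lambda>\<xi>. (norm (F \<xi>))\<^sup>2 + (norm (of_real (2 * pi * norm \<xi>) * F \<xi>))\<^sup>2)"
    by (intro Bochner_Integration.integrable_add L2_integrable L FL)
  moreover have "(norm (F \<xi>))\<^sup>2 + (norm (of_real (2 * pi * norm \<xi>) * F \<xi>))\<^sup>2 = (norm (of_real (h1_weight \<xi>) * F \<xi>))\<^sup>2" for \<xi>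
    by (simp add: norm_mult power_mult_distrib h1_weight(2) ring_distribs)
  ultimately show "h1_mult F \<in> L2" by (simp add: L2_iff)
qed

text \<open>
  The other half: the inverse transforms of the functions \<open>deriv_mult i F\<close> form a weak
  gradient. Closure of \<open>H\<^sup>1\<close> under differences, translations and weak limits follows from it.
\<close>

lemma H1_fourier_I:
  assumes F: "has_L2_fourier u F" and w: "h1_mult F \<in> L2"
  shows "u \<in> H1"
proof -
  have FL: "F \<in> L2" "u \<in> L2" using has_L2_fourierD F by auto
  have [measurable]: "F \<in> borel_measurable borel" using FL by auto
  have cL: "deriv_mult i F \<in> L2" for i
  proof (rule L2_bound[OF w])
    show "norm (2 * pi * \<i> * of_real (\<xi> $ i) * F \<xi>) \<le> 1 * norm (of_real (h1_weight \<xi>) * F \<xi>)" for \<xi>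
    proof -
      have "2 * pi * \<bar>\<xi> $ i\<bar> \<le> 2 * pi * norm \<xi>" using component_le_norm_cart[of \<xi> i] by simp
      also have "\<dots> \<le> \<bar>h1_weight \<xi>\<bar>" using h1_weight(3)[of \<xi>] by linarith
      finally show ?thesis by (simp add: norm_mult mult_right_mono)
    qed
  qed measurable
  then have "\<forall>i. \<exists>g. has_L2_fourier g (deriv_mult i F)" by (intro allI L2_fourier_surj)
  then obtain g where g: "\<And>i. has_L2_fourier (g i) (deriv_mult i F)" by metis
  define G where "G x = ((\<chi> i. g i x) :: complex^2)" for x
  have "G \<in> L2" unfolding G_def[abs_def] by (rule L2_vec_lambda[OF has_L2_fourierD(1)[OF g]])
  moreover have "has_weak_gradient u G"
    unfolding has_weak_gradient_def
  proof (intro allI impI)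
    fix \<phi> i assume t: "test_function \<phi>"
    note tL = test_function_L2(1,2)[OF t] test_function_L2(3,4)[OF t, of i]
    have "(\<integral>x. G x $ i * \<phi> x \<partial>lborel) = (\<integral>\<xi>. (2 * pi * \<i> * of_real (\<xi> $ i) * F \<xi>) * FI \<phi> (- \<xi>) \<partial>lborel)"
      using has_L2_fourier_pairing[OF g[of i] tL(2,1)] by (simp add: G_def)
    also have "\<dots> = - (\<integral>\<xi>. F \<xi> * FI (partial_deriv i \<phi>) (- \<xi>) \<partial>lborel)"
      unfolding fourier_integral_partial_deriv[OF t] Bochner_Integration.integral_minus[symmetric]
      by (rule Bochner_Integration.integral_cong) auto
    also have "\<dots> = - (\<integral>x. u x * partial_deriv i \<phi> x \<partial>lborel)"
      using has_L2_fourier_pairing[OF F tL(4,3)] by simp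
    finally show "(\<integral>x. u x * partial_deriv i \<phi> x \<partial>lborel) = - (\<integral>x. G x $ i * \<phi> x \<partial>lborel)" by simp
  qed
  ultimately show ?thesis using FL by (auto simp: H1_def)
qed

lemma H1_L2: "u \<in> H1 \<Longrightarrow> u \<in> L2" by (simp add: H1_def)

lemma H1_obtain_fourier:
  assumes "u \<in> H1" obtains F where "has_L2_fourier u F"
  using L2_fourier_exists[OF H1_L2[OF assms]] by blast

lemma weak_gradient_norm:
  assumes u: "u \<in> H1" and F: "has_L2_fourier u F"
  shows "L2_norm (weak_gradient u) = L2_norm (grad_mult F)"
proof -
  note D = H1_fourier_D[OF u F]
  have "(\<integral>x. (norm (weak_gradient u x))\<^sup>2 \<partial>lborel) = (\<Sum>i\<in>UNIV. (L2_norm (\<lambda>x. weak_gradient u x $ i))\<^sup>2)"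
    unfolding norm_complex2 L2_norm_sq
    by (rule Bochner_Integration.integral_sum) (rule L2_integrable[OF L2_component[OF D(2)]])
  also have "\<dots> = (\<Sum>i\<in>UNIV. (L2_norm (deriv_mult i F))\<^sup>2)"
    by (simp only: has_L2_fourier_norm[OF D(3)])
  also have "\<dots> = (\<integral>\<xi>. (\<Sum>i\<in>UNIV. (norm (2 * pi * \<i> * of_real (\<xi> $ i) * F \<xi>))\<^sup>2) \<partial>lborel)"
    unfolding L2_norm_sq
    by (rule Bochner_Integration.integral_sum[symmetric]) (rule L2_integrable[OF has_L2_fourierD(2)[OF D(3)]])
  also have "\<dots> = (\<integral>\<xi>. (norm (of_real (2 * pi * norm \<xi>) * F \<xi>))\<^sup>2 \<partial>lborel)"
  proof (rule Bochner_Integration.integral_cong[OF refl])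
    fix \<xi> :: "real^2"
    have "(\<Sum>i\<in>UNIV. (norm (2 * pi * \<i> * of_real (\<xi> $ i) * F \<xi>))\<^sup>2) = (\<Sum>i\<in>UNIV. (\<xi> $ i)\<^sup>2) * ((2 * pi)\<^sup>2 * (norm (F \<xi>))\<^sup>2)"
      unfolding sum_distrib_right by (rule sum.cong) (auto simp: norm_mult power_mult_distrib mult_ac)
    then show "(\<Sum>i\<in>UNIV. (norm (2 * pi * \<i> * of_real (\<xi> $ i) * F \<xi>))\<^sup>2) = (norm (of_real (2 * pi * norm \<xi>) * F \<xi>))\<^sup>2"
      by (simp add: norm_real2[symmetric] norm_mult power_mult_distrib mult_ac)
  qed
  finally show ?thesis by (simp add: L2_norm_def)
qed

lemma H1_inner_fourier:
  assumes u: "u \<in> H1" "has_L2_fourier u F" and w: "w \<in> H1" "has_L2_fourier w G"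
  shows "H1_inner u w = L2_inner (h1_mult F) (h1_mult G)"
proof -
  note D = H1_fourier_D[OF u] and E = H1_fourier_D[OF w]
  note L = has_L2_fourierD[OF u(2)] has_L2_fourierD[OF w(2)]
  have "H1_inner u w = L2_inner u w + (\<Sum>i\<in>UNIV. L2_inner (\<lambda>x. weak_gradient u x $ i) (\<lambda>x. weak_gradient w x $ i))"
    unfolding H1_inner_def L2_inner_def
    by (subst Bochner_Integration.integral_add)
      (auto intro!: L2_integrable_inner L Bochner_Integration.integrable_sum L2_component D E Bochner_Integration.integral_sum)
  also have "\<dots> = L2_inner F G + (\<Sum>i\<in>UNIV. L2_inner (deriv_mult i F) (deriv_mult i G))"
    by (simp only: has_L2_fourier_inner[OF u(2) w(2)] has_L2_fourier_inner[OF D(3) E(3)])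
  also have "\<dots> = (\<integral>\<xi>. F \<xi> * cnj (G \<xi>) + (\<Sum>i\<in>UNIV. (2 * pi * \<i> * of_real (\<xi> $ i) * F \<xi>) * cnj (2 * pi * \<i> * of_real (\<xi> $ i) * G \<xi>)) \<partial>lborel)"
  proof -
    have "integrable lborel (\<lambda>\<xi>. (2 * pi * \<i> * of_real (\<xi> $ i) * F \<xi>) * cnj (2 * pi * \<i> * of_real (\<xi> $ i) * G \<xi>))" for i
      by (rule L2_integrable_inner[OF has_L2_fourierD(2)[OF D(3)] has_L2_fourierD(2)[OF E(3)]])
    then show ?thesis unfolding L2_inner_def
      using L2_integrable_inner[OF L(2,4)]
      by (simp only: Bochner_Integration.integral_add Bochner_Integration.integrable_sum Bochner_Integration.integral_sum)
  qed
  also have "\<dots> = L2_inner (h1_mult F) (h1_mult G)"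
    unfolding L2_inner_def
  proof (rule Bochner_Integration.integral_cong[OF refl])
    fix \<xi> :: "real^2"
    have 1: "(\<Sum>i\<in>UNIV. (2 * pi * \<i> * of_real (\<xi> $ i) * F \<xi>) * cnj (2 * pi * \<i> * of_real (\<xi> $ i) * G \<xi>))
      = of_real (\<Sum>i\<in>UNIV. (\<xi> $ i)\<^sup>2) * of_real ((2 * pi)\<^sup>2) * (F \<xi> * cnj (G \<xi>))"
      unfolding of_real_sum sum_distrib_right by (rule sum.cong) (auto simp: power2_eq_square)
    have 2: "(of_real (h1_weight \<xi>) * F \<xi>) * cnj (of_real (h1_weight \<xi>) * G \<xi>) = of_real ((h1_weight \<xi>)\<^sup>2) * (F \<xi> * cnj (G \<xi>))"
      by (simp add: power2_eq_square)
    show "F \<xi> * cnj (G \<xi>) + (\<Sum>i\<in>UNIV. (2 * pi * \<i> * of_real (\<xi> $ i) * F \<xi>) * cnj (2 * pi * \<i> * of_real (\<xi> $ i) * G \<xi>))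
      = (of_real (h1_weight \<xi>) * F \<xi>) * cnj (of_real (h1_weight \<xi>) * G \<xi>)"
      unfolding 1 2 h1_weight(2) norm_real2[symmetric] by (simp add: power_mult_distrib algebra_simps)
  qed
  finally show ?thesis .
qed

section \<open>Low frequencies and the Gagliardo--Nirenberg inequality\<close>

text \<open>
  The part of a function with frequencies below \<open>A\<close>, as a function of its transform \<open>F\<close>.
  Inverting by an integral singles out a representative that is defined at every point.
\<close>

definition low_pass :: "real \<Rightarrow> (real^2 \<Rightarrow> complex) \<Rightarrow> real^2 \<Rightarrow> complex" where
  "low_pass A F x = FI (trunc A F) (- x)"

lemma has_L2_fourier_low_pass: "F \<in> L2 \<Longrightarrow> has_L2_fourier (low_pass A F) (trunc A F)"
  unfolding low_pass_def[abs_def] by (intro has_L2_fourier_inverse_integral trunc_integrable trunc_L2)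

lemma AE_lborel_components_nonzero: "AE x in lborel. \<forall>b\<in>Basis. (x :: real^2) \<bullet> b \<noteq> 0"
proof -
  have "AE x in lborel. (x :: real^2) \<bullet> b \<noteq> 0" if "b \<in> Basis" for b
  proof -
    have "negligible {x::real^2. x \<bullet> b = 0}" using that by (rule negligible_standard_hyperplane)
    then have "AE x in lebesgue. (x :: real^2) \<notin> {x. x \<bullet> b = 0}"
      unfolding negligible_iff_null_sets by (rule AE_not_in)
    then show ?thesis by (simp add: AE_completion_iff)
  qed
  then show ?thesis by (simp add: AE_finite_all)
qed

lemma nn_integral_inverse_sqrt:
  assumes A: "A \<ge> 0"
  shows "(\<integral>\<^sup>+t. ennreal (indicator {-A..A} t * \<bar>t\<bar> powr (-1/2)) \<partial>lborel) = ennreal (4 * sqrt A)"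
proof -
  define h where "h t = (if t \<in> {0..A} then t powr (-1/2) else 0)" for t
  have [measurable]: "h \<in> borel_measurable borel" unfolding h_def by measurable
  have h0: "0 \<le> h t" for t by (simp add: h_def)
  have "((\<lambda>t. t powr (-1/2)) has_integral (A powr (-1/2 + 1) / (-1/2 + 1))) {0..A}"
    by (rule has_integral_powr_from_0) (use A in auto)
  then have "(h has_integral (2 * sqrt A)) UNIV"
    unfolding h_def by (subst has_integral_restrict_UNIV) (use A in \<open>simp add: powr_half_sqrt mult.commute\<close>)
  then have hI: "(\<integral>\<^sup>+t. ennreal (h t) \<partial>lborel) = ennreal (2 * sqrt A)"
    using h0 by (intro nn_integral_has_integral_lborel) auto
  have "(\<integral>\<^sup>+t. ennreal (indicator {-A..A} t * \<bar>t\<bar> powr (-1/2)) \<partial>lborel) = (\<integral>\<^sup>+t. ennreal (h t) + ennreal (h (- t)) \<partial>lborel)"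
    by (rule nn_integral_cong) (auto simp: h_def indicator_def simp flip: ennreal_plus)
  also have "\<dots> = (\<integral>\<^sup>+t. ennreal (h t) \<partial>lborel) + (\<integral>\<^sup>+t. ennreal (h (- t)) \<partial>lborel)"
    by (rule nn_integral_add) auto
  also have "(\<integral>\<^sup>+t. ennreal (h (- t)) \<partial>lborel) = (\<integral>\<^sup>+t. ennreal (h t) \<partial>lborel)"
    using nn_integral_distr[of uminus lborel borel "\<lambda>t. ennreal (h t)"] by (simp add: lborel_distr_uminus)
  finally show ?thesis using A by (simp add: hI flip: ennreal_plus)
qed

text \<open>
  Since \<open>\<bar>\<xi>\<bar>\<^sup>2 \<ge> \<bar>\<xi>\<^sub>1\<bar> \<bar>\<xi>\<^sub>2\<bar>\<close>, the integrand is dominated by a product of one-dimensional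
  singularities of order one half.
\<close>

lemma nn_integral_inverse_norm_ball:
  assumes A: "A \<ge> 0"
  shows "(\<integral>\<^sup>+\<xi>. ennreal (indicator (ball (0::real^2) A) \<xi> / norm \<xi>) \<partial>lborel) \<le> ennreal (16 * A)"
proof -
  define g where "g t = ennreal (indicator {-A..A} t * \<bar>t\<bar> powr (-1/2))" for t
  have [measurable]: "g \<in> borel_measurable borel" unfolding g_def by measurable
  have "(\<integral>\<^sup>+\<xi>. ennreal (indicator (ball (0::real^2) A) \<xi> / norm \<xi>) \<partial>lborel) \<le> (\<integral>\<^sup>+\<xi>. (\<Prod>b\<in>(Basis::(real^2) set). g (\<xi> \<bullet> b)) \<partial>lborel)"
  \<comment> \<open>off the coordinate axes: on them \<open>powr\<close> takes the value \<open>0\<close> and the bound fails\<close>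
  proof (rule nn_integral_mono_AE, use AE_lborel_components_nonzero in eventually_elim)
    case (elim \<xi>)
    have card: "card (Basis :: (real^2) set) = 2" by simp
    show ?case
    proof (cases "\<xi> \<in> ball 0 A")
      case True
      have cpt: "\<bar>\<xi> \<bullet> b\<bar> \<le> norm \<xi>" if "b \<in> Basis" for b using Basis_le_norm[OF that] .
      obtain b0 :: "real^2" where "b0 \<in> Basis" using nonempty_Basis by blast
      then have n0: "norm \<xi> > 0" using elim by auto
      have "1 / norm \<xi> = norm \<xi> powr (-1/2 + -1/2)" using n0 by (simp add: powr_minus_divide)
      also have "\<dots> = norm \<xi> powr (-1/2) * norm \<xi> powr (-1/2)" by (rule powr_add)
      also have "\<dots> = (\<Prod>b\<in>(Basis::(real^2) set). norm \<xi> powr (-1/2))"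
        by (simp only: prod_constant card power2_eq_square)
      also have "\<dots> \<le> (\<Prod>b\<in>(Basis::(real^2) set). \<bar>\<xi> \<bullet> b\<bar> powr (-1/2))"
        using elim cpt by (intro prod_mono) (auto intro!: powr_mono2')
      finally have le: "1 / norm \<xi> \<le> (\<Prod>b\<in>(Basis::(real^2) set). \<bar>\<xi> \<bullet> b\<bar> powr (-1/2))" .
      have "(\<Prod>b\<in>(Basis::(real^2) set). g (\<xi> \<bullet> b)) = (\<Prod>b\<in>(Basis::(real^2) set). ennreal (\<bar>\<xi> \<bullet> b\<bar> powr (-1/2)))"
      proof (rule prod.cong[OF refl])
        fix b :: "real^2" assume "b \<in> Basis"
        then have "\<xi> \<bullet> b \<in> {-A..A}" using cpt[of b] True by auto
        then show "g (\<xi> \<bullet> b) = ennreal (\<bar>\<xi> \<bullet> b\<bar> powr (-1/2))" by (simp add: g_def)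
      qed
      also have "\<dots> = ennreal (\<Prod>b\<in>(Basis::(real^2) set). \<bar>\<xi> \<bullet> b\<bar> powr (-1/2))"
        by (rule prod_ennreal) simp
      finally show ?thesis using True le by (simp add: ennreal_leI)
    qed simp
  qed
  also have "\<dots> = (\<Prod>b\<in>(Basis::(real^2) set). \<integral>\<^sup>+t. g t \<partial>lborel)"
    by (rule nn_integral_lborel_prod[where f="\<lambda>b. g"]) auto
  also have "\<dots> = ennreal (4 * sqrt A) ^ 2"
    unfolding g_def nn_integral_inverse_sqrt[OF A] by simp
  also have "\<dots> = ennreal (16 * A)"
    using A by (simp add: ennreal_power power_mult_distrib)
  finally show ?thesis .
qed

text \<open>
  The Cauchy--Schwarz inequality applied to \<open>\<bar>\<xi>\<bar>\<^sup>-\<^sup>1\<^sup>/\<^sup>2\<close> and \<open>\<bar>\<xi>\<bar>\<^sup>1\<^sup>/\<^sup>2 \<bar>F\<bar>\<close> on the ball.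
\<close>

lemma low_pass_bound:
  assumes F: "F \<in> L2" and H: "(\<integral>\<^sup>+\<xi>. ennreal (norm \<xi> * (cmod (F \<xi>))\<^sup>2) \<partial>lborel) \<le> ennreal H" "0 \<le> H" and A: "A \<ge> 0"
  shows "cmod (low_pass A F x) \<le> 4 * sqrt (A * H)"
proof -
  have [measurable]: "F \<in> borel_measurable borel" using F by auto
  have [measurable]: "(indicator (ball 0 A) :: real^2 \<Rightarrow> real) \<in> borel_measurable borel" by (intro borel_measurable_indicator) auto
  define k where "k \<xi> = complex_of_real (sqrt (indicator (ball (0::real^2) A) \<xi> / norm \<xi>))" for \<xi>
  define h where "h \<xi> = complex_of_real (sqrt (norm \<xi>)) * F \<xi>" for \<xi>
  have [measurable]: "k \<in> borel_measurable borel" "h \<in> borel_measurable borel" unfolding k_def h_def by measurable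
  have ind0: "0 \<le> indicator (ball (0::real^2) A) \<xi> / norm \<xi>" for \<xi> by simp
  have "(cmod (k \<xi>))\<^sup>2 = indicator (ball (0::real^2) A) \<xi> / norm \<xi>" for \<xi>
    using ind0[of \<xi>] unfolding k_def norm_of_real power2_abs by (rule real_sqrt_pow2)
  then have k: "k \<in> L2" "(L2_norm k)\<^sup>2 \<le> 16 * A"
    using L2_nn_integral_le[of k "16 * A"] nn_integral_inverse_norm_ball[OF A] A by auto
  have "(cmod (h \<xi>))\<^sup>2 = norm \<xi> * (cmod (F \<xi>))\<^sup>2" for \<xi>
    by (simp add: h_def norm_mult power_mult_distrib)
  then have h: "h \<in> L2" "(L2_norm h)\<^sup>2 \<le> H"
    using L2_nn_integral_le[of h H] H by auto
  have "cmod (low_pass A F x) \<le> (\<integral>\<xi>. cmod (trunc A F \<xi>) \<partial>lborel)"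
    unfolding low_pass_def by (rule fourier_integral_bound)
  also have "\<dots> = (\<integral>\<xi>. cmod (k \<xi>) * cmod (h \<xi>) \<partial>lborel)"
  proof (rule integral_cong_AE)
    show "(\<lambda>\<xi>. cmod (trunc A F \<xi>)) \<in> borel_measurable lborel"
      using L2_measurable[OF trunc_L2[OF F]] by measurable
    show "AE \<xi> in lborel. cmod (trunc A F \<xi>) = cmod (k \<xi>) * cmod (h \<xi>)"
      using AE_lborel_singleton[of "0::real^2"]
    proof eventually_elim
      case (elim \<xi>)
      then show ?case by (auto simp: trunc_def k_def h_def norm_mult norm_divide indicator_def real_sqrt_divide)
    qed
  qed measurable
  also have "\<dots> \<le> L2_norm k * L2_norm h" by (rule L2_Cauchy_Schwarz_norm[OF k(1) h(1)])
  also have "\<dots> \<le> sqrt (16 * A) * sqrt H"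
    using k(2) h(2) by (intro mult_mono real_le_rsqrt) (auto simp: A)
  also have "\<dots> = 4 * sqrt (A * H)" by (simp add: real_sqrt_mult)
  finally show ?thesis .
qed

lemma high_pass_norm:
  assumes "has_L2_fourier f F"
  shows "(\<integral>\<^sup>+x. ennreal ((cmod (f x - low_pass A F x))\<^sup>2) \<partial>lborel) = (\<integral>\<^sup>+\<xi>. ennreal ((cmod (F \<xi>))\<^sup>2) * indicator {\<xi>. A \<le> norm \<xi>} \<xi> \<partial>lborel)"
proof -
  have FL: "F \<in> L2" using has_L2_fourierD assms by auto
  have d: "has_L2_fourier (\<lambda>x. f x - low_pass A F x) (\<lambda>\<xi>. F \<xi> - trunc A F \<xi>)"
    by (intro has_L2_fourier_diff assms has_L2_fourier_low_pass FL)
  have "(\<integral>\<^sup>+x. ennreal ((cmod (f x - low_pass A F x))\<^sup>2) \<partial>lborel) = (\<integral>\<^sup>+\<xi>. ennreal ((cmod (F \<xi> - trunc A F \<xi>))\<^sup>2) \<partial>lborel)"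
    by (simp only: L2_nn_integral has_L2_fourierD[OF d] has_L2_fourier_norm[OF d])
  also have "\<dots> = (\<integral>\<^sup>+\<xi>. ennreal ((cmod (F \<xi>))\<^sup>2) * indicator {\<xi>. A \<le> norm \<xi>} \<xi> \<partial>lborel)"
    by (rule nn_integral_cong) (auto simp: trunc_def indicator_def)
  finally show ?thesis .
qed

text \<open>
  The embedding of the homogeneous space of order one half into \<open>L\<^sup>4\<close>, by level sets. For
  each height \<open>l\<close> cut at the frequency \<open>A\<close> for which the low part is at most \<open>l / 2\<close>. Then
  \<open>\<bar>f\<bar> \<ge> l\<close> forces the high part to be at least \<open>l / 2\<close>, so the measure of the level set is
  controlled by the energy of \<open>F\<close> above \<open>A\<close>. Integrating over \<open>l\<close> first gives back the weight
  \<open>\<bar>\<xi>\<bar>\<close>.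
\<close>

lemma Gagliardo_Nirenberg_half:
  assumes f: "has_L2_fourier f F" and H: "(\<integral>\<^sup>+\<xi>. ennreal (norm \<xi> * (cmod (F \<xi>))\<^sup>2) \<partial>lborel) \<le> ennreal H" "0 < H"
  shows "(\<integral>\<^sup>+x. ennreal ((cmod (f x)) ^ 4) \<partial>lborel) \<le> ennreal (512 * H\<^sup>2)"
proof -
  note L = has_L2_fourierD[OF f]
  have [measurable]: "f \<in> borel_measurable borel" "F \<in> borel_measurable borel" using L by auto
  have layer: "ennreal ((cmod (f x)) ^ 4) = (\<integral>\<^sup>+l. (if 0 \<le> l \<and> l \<le> cmod (f x) then ennreal (4 * l ^ 3) else 0) \<partial>lborel)" for x
  proof -
    have "(\<integral>\<^sup>+l. ennreal (4 * l ^ 3) * indicator {0..cmod (f x)} l \<partial>lborel) = ennreal ((cmod (f x)) ^ 4 - 0 ^ 4)"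
      by (rule nn_integral_FTC_Icc) (auto intro!: derivative_eq_intros)
    moreover have "(\<integral>\<^sup>+l. ennreal (4 * l ^ 3) * indicator {0..cmod (f x)} l \<partial>lborel) = (\<integral>\<^sup>+l. (if 0 \<le> l \<and> l \<le> cmod (f x) then ennreal (4 * l ^ 3) else 0) \<partial>lborel)"
      by (rule nn_integral_cong) (auto simp: indicator_def)
    ultimately show ?thesis by simp
  qed
  have level: "(\<integral>\<^sup>+x. (if 0 \<le> l \<and> l \<le> cmod (f x) then ennreal (4 * l ^ 3) else 0) \<partial>lborel)
      \<le> (\<integral>\<^sup>+\<xi>. (if 0 \<le> l \<and> l\<^sup>2 \<le> 64 * H * norm \<xi> then ennreal (16 * l) * ennreal ((cmod (F \<xi>))\<^sup>2) else 0) \<partial>lborel)" for l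
  proof (cases "0 \<le> l")
    case True
    \<comment> \<open>chosen so that the bound \<open>4 sqrt (A H)\<close> for the low part equals \<open>l / 2\<close>\<close>
    define A where "A = l\<^sup>2 / (64 * H)"
    have A: "A \<ge> 0" using H by (simp add: A_def)
    have "4 * sqrt (A * H) = l / 2"
    proof -
      have "A * H = (l / 8)\<^sup>2" using H by (simp add: A_def power_divide)
      then show ?thesis using True by simp
    qed
    then have low: "cmod (low_pass A F x) \<le> l / 2" for x
      using low_pass_bound[OF L(2) H(1) less_imp_le[OF H(2)] A, of x] by simp
    have m: "low_pass A F \<in> borel_measurable borel"
      using L2_measurable[OF has_L2_fourierD(1)[OF has_L2_fourier_low_pass[OF L(2)]]] .
    have "(\<integral>\<^sup>+x. (if 0 \<le> l \<and> l \<le> cmod (f x) then ennreal (4 * l ^ 3) else 0) \<partial>lborel) \<le> (\<integral>\<^sup>+x. ennreal (16 * l) * ennreal ((cmod (f x - low_pass A F x))\<^sup>2) \<partial>lborel)"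
    proof (rule nn_integral_mono)
      fix x
      have "4 * l ^ 3 \<le> 16 * l * (cmod (f x - low_pass A F x))\<^sup>2" if "l \<le> cmod (f x)"
      proof -
        have "l / 2 \<le> cmod (f x - low_pass A F x)"
          using low[of x] that norm_triangle_ineq2[of "f x" "low_pass A F x"] by linarith
        then have "(l / 2)\<^sup>2 \<le> (cmod (f x - low_pass A F x))\<^sup>2" using True by (intro power_mono) auto
        then have "16 * l * (l / 2)\<^sup>2 \<le> 16 * l * (cmod (f x - low_pass A F x))\<^sup>2" using True by (intro mult_left_mono) auto
        then show ?thesis by (simp add: power2_eq_square power3_eq_cube)
      qed
      then show "(if 0 \<le> l \<and> l \<le> cmod (f x) then ennreal (4 * l ^ 3) else 0) \<le> ennreal (16 * l) * ennreal ((cmod (f x - low_pass A F x))\<^sup>2)"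
        using True by (auto simp: ennreal_mult'[symmetric] intro!: ennreal_leI)
    qed
    also have "\<dots> = ennreal (16 * l) * (\<integral>\<^sup>+\<xi>. ennreal ((cmod (F \<xi>))\<^sup>2) * indicator {\<xi>. A \<le> norm \<xi>} \<xi> \<partial>lborel)"
      using m by (subst nn_integral_cmult) (auto simp: high_pass_norm[OF f])
    also have "\<dots> = (\<integral>\<^sup>+\<xi>. ennreal (16 * l) * (ennreal ((cmod (F \<xi>))\<^sup>2) * indicator {\<xi>. A \<le> norm \<xi>} \<xi>) \<partial>lborel)"
      by (rule nn_integral_cmult[symmetric]) measurable
    also have "\<dots> = (\<integral>\<^sup>+\<xi>. (if 0 \<le> l \<and> l\<^sup>2 \<le> 64 * H * norm \<xi> then ennreal (16 * l) * ennreal ((cmod (F \<xi>))\<^sup>2) else 0) \<partial>lborel)"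
      by (rule nn_integral_cong) (use True H in \<open>auto simp: A_def indicator_def divide_le_eq mult_ac\<close>)
    finally show ?thesis .
  qed (auto simp: if_distrib)
  have level2: "(\<integral>\<^sup>+l. (if 0 \<le> l \<and> l\<^sup>2 \<le> 64 * H * norm \<xi> then ennreal (16 * l) * ennreal ((cmod (F \<xi>))\<^sup>2) else 0) \<partial>lborel)
      = ennreal (512 * H) * ennreal (norm \<xi> * (cmod (F \<xi>))\<^sup>2)" for \<xi>
  proof -
    define s where "s = sqrt (64 * H * norm \<xi>)"
    have s: "0 \<le> s" "s\<^sup>2 = 64 * H * norm \<xi>" using H by (auto simp: s_def)
    have iff: "0 \<le> l \<and> l\<^sup>2 \<le> 64 * H * norm \<xi> \<longleftrightarrow> l \<in> {0..s}" for l
      unfolding s(2)[symmetric] using s(1) by (auto intro: power2_le_imp_le power_mono)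
    have "(\<integral>\<^sup>+l. (if 0 \<le> l \<and> l\<^sup>2 \<le> 64 * H * norm \<xi> then ennreal (16 * l) * ennreal ((cmod (F \<xi>))\<^sup>2) else 0) \<partial>lborel)
      = (\<integral>\<^sup>+l. (ennreal (16 * l) * indicator {0..s} l) * ennreal ((cmod (F \<xi>))\<^sup>2) \<partial>lborel)"
      unfolding iff by (rule nn_integral_cong) (auto simp: indicator_def)
    also have "\<dots> = (\<integral>\<^sup>+l. ennreal (16 * l) * indicator {0..s} l \<partial>lborel) * ennreal ((cmod (F \<xi>))\<^sup>2)"
      by (rule nn_integral_multc) measurable
    also have "(\<integral>\<^sup>+l. ennreal (16 * l) * indicator {0..s} l \<partial>lborel) = ennreal (8 * s\<^sup>2 - 8 * 0\<^sup>2)"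
      by (rule nn_integral_FTC_Icc) (use s in \<open>auto intro!: derivative_eq_intros\<close>)
    also have "\<dots> = ennreal (512 * H * norm \<xi>)" unfolding s(2) by (simp add: mult.assoc)
    finally show ?thesis using H by (simp add: ennreal_mult'[symmetric] mult_ac)
  qed
  have "(\<integral>\<^sup>+x. ennreal ((cmod (f x)) ^ 4) \<partial>lborel) = (\<integral>\<^sup>+x. \<integral>\<^sup>+l. (if 0 \<le> l \<and> l \<le> cmod (f x) then ennreal (4 * l ^ 3) else 0) \<partial>lborel \<partial>lborel)"
    unfolding layer ..
  also have "\<dots> = (\<integral>\<^sup>+l. \<integral>\<^sup>+x. (if 0 \<le> l \<and> l \<le> cmod (f x) then ennreal (4 * l ^ 3) else 0) \<partial>lborel \<partial>lborel)"
    by (rule lborel_pair.Fubini'[symmetric]) measurable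
  also have "\<dots> \<le> (\<integral>\<^sup>+l. \<integral>\<^sup>+\<xi>. (if 0 \<le> l \<and> l\<^sup>2 \<le> 64 * H * norm \<xi> then ennreal (16 * l) * ennreal ((cmod (F \<xi>))\<^sup>2) else 0) \<partial>lborel \<partial>lborel)"
    by (rule nn_integral_mono) (rule level)
  also have "\<dots> = (\<integral>\<^sup>+\<xi>. \<integral>\<^sup>+l. (if 0 \<le> l \<and> l\<^sup>2 \<le> 64 * H * norm \<xi> then ennreal (16 * l) * ennreal ((cmod (F \<xi>))\<^sup>2) else 0) \<partial>lborel \<partial>lborel)"
    by (rule lborel_pair.Fubini') measurable
  also have "\<dots> = ennreal (512 * H) * (\<integral>\<^sup>+\<xi>. ennreal (norm \<xi> * (cmod (F \<xi>))\<^sup>2) \<partial>lborel)"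
    unfolding level2 by (rule nn_integral_cmult) measurable
  also have "\<dots> \<le> ennreal (512 * H) * ennreal H" by (intro mult_left_mono H) simp
  also have "\<dots> = ennreal (512 * H\<^sup>2)" using H by (simp add: ennreal_mult'[symmetric] power2_eq_square)
  finally show ?thesis .
qed

definition abs_sq :: "(real^2 \<Rightarrow> complex) \<Rightarrow> real^2 \<Rightarrow> complex" where
  "abs_sq u x = of_real ((cmod (u x))\<^sup>2)"

lemma abs_sq_measurable [measurable]: "u \<in> borel_measurable borel \<Longrightarrow> abs_sq u \<in> borel_measurable borel"
  unfolding abs_sq_def[abs_def] by measurable

lemma norm_abs_sq: "cmod (abs_sq u x) = (cmod (u x))\<^sup>2"
  unfolding abs_sq_def norm_of_real by simp

lemma abs_sq_L2_nn:
  assumes [measurable]: "u \<in> borel_measurable borel" and "(\<integral>\<^sup>+x. ennreal ((cmod (u x)) ^ 4) \<partial>lborel) \<le> ennreal (c\<^sup>2)" "0 \<le> c"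
  shows "abs_sq u \<in> L2" "L2_norm (abs_sq u) \<le> c"
proof -
  have "(\<integral>\<^sup>+x. ennreal ((cmod (abs_sq u x))\<^sup>2) \<partial>lborel) \<le> ennreal (c\<^sup>2)"
    using assms(2) by (simp add: norm_abs_sq power_mult[symmetric])
  then have *: "abs_sq u \<in> L2" "(L2_norm (abs_sq u))\<^sup>2 \<le> c\<^sup>2"
    using L2_nn_integral_le[of "abs_sq u" "c\<^sup>2"] by auto
  then show "abs_sq u \<in> L2" "L2_norm (abs_sq u) \<le> c" using assms(3) by (auto intro: power2_le_imp_le)
qed

text \<open>
  The previous bound for the norm of \<open>\<bar>f\<bar>\<^sup>2\<close>. An approximation by \<open>H + e\<close> includes \<open>H = 0\<close>.
\<close>

lemma Gagliardo_Nirenberg_L4: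
  assumes f: "has_L2_fourier f F" and H: "(\<integral>\<^sup>+\<xi>. ennreal (norm \<xi> * (cmod (F \<xi>))\<^sup>2) \<partial>lborel) \<le> ennreal H" "0 \<le> H"
  shows "abs_sq f \<in> L2" "L2_norm (abs_sq f) \<le> 32 * H"
proof -
  have m: "f \<in> borel_measurable borel" using has_L2_fourierD(1)[OF f] by auto
  have *: "abs_sq f \<in> L2 \<and> L2_norm (abs_sq f) \<le> 32 * (H + e)" if e: "e > 0" for e
  proof -
    have "ennreal H \<le> ennreal (H + e)" using e by (intro ennreal_leI) simp
    then have "(\<integral>\<^sup>+x. ennreal ((cmod (f x)) ^ 4) \<partial>lborel) \<le> ennreal (512 * (H + e)\<^sup>2)"
      using H e by (intro Gagliardo_Nirenberg_half[OF f] order_trans[OF H(1)]) auto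
    also have "\<dots> \<le> ennreal ((32 * (H + e))\<^sup>2)"
      unfolding power_mult_distrib by (intro ennreal_leI mult_right_mono) auto
    finally show ?thesis using abs_sq_L2_nn[OF m, of "32 * (H + e)"] H e by auto
  qed
  from *[of 1] show "abs_sq f \<in> L2" by simp
  show "L2_norm (abs_sq f) \<le> 32 * H"
  proof (rule field_le_epsilon)
    fix e :: real assume "e > 0"
    then show "L2_norm (abs_sq f) \<le> 32 * H + e" using *[of "e/32"] by simp
  qed
qed

lemma Gagliardo_Nirenberg:
  assumes f: "has_L2_fourier f F" and g: "grad_mult F \<in> L2"
  shows "abs_sq f \<in> L2" "L2_norm (abs_sq f) \<le> 32 * (L2_norm f * L2_norm (grad_mult F))"
proof -
  define G where "G \<xi> = of_real (2 * pi * norm \<xi>) * F \<xi>" for \<xi>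
  have FL: "F \<in> L2" using has_L2_fourierD(2)[OF f] .
  have GL: "G \<in> L2" using g by (simp add: G_def[abs_def])
  have "(\<integral>\<^sup>+\<xi>. ennreal (norm \<xi> * (cmod (F \<xi>))\<^sup>2) \<partial>lborel) \<le> (\<integral>\<^sup>+\<xi>. ennreal (norm (F \<xi>) * norm (G \<xi>)) \<partial>lborel)"
  proof (intro nn_integral_mono ennreal_leI)
    fix \<xi> :: "real^2"
    \<comment> \<open>dropping the factor \<open>2 \<pi>\<close> keeps the constants simple\<close>
    have "1 * (norm \<xi> * (cmod (F \<xi>))\<^sup>2) \<le> (2 * pi) * (norm \<xi> * (cmod (F \<xi>))\<^sup>2)"
      by (intro mult_right_mono) (use pi_ge_two in auto)
    then show "norm \<xi> * (cmod (F \<xi>))\<^sup>2 \<le> norm (F \<xi>) * norm (G \<xi>)"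
      by (simp add: G_def norm_mult power2_eq_square mult_ac)
  qed
  also have "\<dots> = ennreal (\<integral>\<xi>. norm (F \<xi>) * norm (G \<xi>) \<partial>lborel)"
    by (intro nn_integral_eq_integral L2_integrable_mult_norm FL GL) simp
  also have "\<dots> \<le> ennreal (L2_norm F * L2_norm G)"
    by (intro ennreal_leI L2_Cauchy_Schwarz_norm FL GL)
  finally have "(\<integral>\<^sup>+\<xi>. ennreal (norm \<xi> * (cmod (F \<xi>))\<^sup>2) \<partial>lborel) \<le> ennreal (L2_norm f * L2_norm G)"
    by (simp add: has_L2_fourier_norm[OF f])
  from Gagliardo_Nirenberg_L4[OF f this]
  show "abs_sq f \<in> L2" "L2_norm (abs_sq f) \<le> 32 * (L2_norm f * L2_norm (grad_mult F))"
    by (simp_all add: G_def[abs_def])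
qed

text \<open>
  Above the frequency \<open>A\<close> one has \<open>\<bar>\<xi>\<bar> \<le> \<bar>\<xi>\<bar>\<^sup>2 / A\<close>, so the high part is small in \<open>L\<^sup>4\<close>
  uniformly on bounded sets of \<open>H\<^sup>1\<close>.
\<close>

lemma high_pass_L4:
  assumes f: "has_L2_fourier f F" and g: "grad_mult F \<in> L2" and A: "A > 0"
  shows "abs_sq (\<lambda>x. f x - low_pass A F x) \<in> L2"
    "L2_norm (abs_sq (\<lambda>x. f x - low_pass A F x)) \<le> 32 * ((L2_norm (grad_mult F))\<^sup>2 / A)"
proof -
  define G where "G \<xi> = of_real (2 * pi * norm \<xi>) * F \<xi>" for \<xi>
  have FL: "F \<in> L2" using has_L2_fourierD(2)[OF f] .
  have GL: "G \<in> L2" using g by (simp add: G_def[abs_def])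
  have [measurable]: "F \<in> borel_measurable borel" "G \<in> borel_measurable borel" using FL GL by auto
  have d: "has_L2_fourier (\<lambda>x. f x - low_pass A F x) (\<lambda>\<xi>. F \<xi> - trunc A F \<xi>)"
    by (intro has_L2_fourier_diff f has_L2_fourier_low_pass FL)
  have "(\<integral>\<^sup>+\<xi>. ennreal (norm \<xi> * (cmod (F \<xi> - trunc A F \<xi>))\<^sup>2) \<partial>lborel) \<le> (\<integral>\<^sup>+\<xi>. ennreal (1 / A) * ennreal ((norm (G \<xi>))\<^sup>2) \<partial>lborel)"
  proof (rule nn_integral_mono)
    fix \<xi> :: "real^2"
    have "norm \<xi> * (cmod (F \<xi> - trunc A F \<xi>))\<^sup>2 \<le> 1 / A * (norm (G \<xi>))\<^sup>2"
    proof (cases "norm \<xi> < A")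
      case False
      then have "A * (norm \<xi> * (cmod (F \<xi>))\<^sup>2) \<le> norm \<xi> * (norm \<xi> * (cmod (F \<xi>))\<^sup>2)"
        by (intro mult_right_mono) auto
      also have "1 * \<dots> \<le> (2 * pi)\<^sup>2 * (norm \<xi> * (norm \<xi> * (cmod (F \<xi>))\<^sup>2))"
        using one_le_power[of "2 * pi" 2] pi_ge_two by (intro mult_right_mono) auto
      finally have "A * (norm \<xi> * (cmod (F \<xi>))\<^sup>2) \<le> (norm (G \<xi>))\<^sup>2"
        by (simp add: G_def norm_mult power2_eq_square mult_ac)
      then show ?thesis using False A by (simp add: trunc_def field_simps)
    qed (use A in \<open>simp add: trunc_def\<close>)
    then show "ennreal (norm \<xi> * (cmod (F \<xi> - trunc A F \<xi>))\<^sup>2) \<le> ennreal (1 / A) * ennreal ((norm (G \<xi>))\<^sup>2)"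
      using A by (subst ennreal_mult[symmetric]) (auto intro!: ennreal_leI)
  qed
  also have "\<dots> = ennreal (1 / A) * ennreal ((L2_norm G)\<^sup>2)"
    by (subst nn_integral_cmult) (auto simp: L2_nn_integral[OF GL])
  also have "\<dots> = ennreal ((L2_norm G)\<^sup>2 / A)" using A by (subst ennreal_mult[symmetric]) auto
  finally have "(\<integral>\<^sup>+\<xi>. ennreal (norm \<xi> * (cmod (F \<xi> - trunc A F \<xi>))\<^sup>2) \<partial>lborel) \<le> ennreal ((L2_norm G)\<^sup>2 / A)" .
  from Gagliardo_Nirenberg_L4[OF d this] A
  show "abs_sq (\<lambda>x. f x - low_pass A F x) \<in> L2"
    "L2_norm (abs_sq (\<lambda>x. f x - low_pass A F x)) \<le> 32 * ((L2_norm (grad_mult F))\<^sup>2 / A)"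
    by (simp_all add: G_def[abs_def])
qed

text \<open>
  Point values of the low part are inner products of \<open>f\<close> with a kernel in \<open>L\<^sup>2\<close>, hence
  continuous under weak convergence.
\<close>

lemma low_pass_inner:
  assumes F: "has_L2_fourier f F" and K: "has_L2_fourier k (\<lambda>\<xi>. cis (- 2 * pi * (\<xi> \<bullet> x)) * indicator (ball 0 A) \<xi>)"
  shows "low_pass A F x = L2_inner f k"
proof -
  have "low_pass A F x = L2_inner F (\<lambda>\<xi>. cis (- 2 * pi * (\<xi> \<bullet> x)) * indicator (ball 0 A) \<xi>)"
    unfolding low_pass_def fourier_integral_def trunc_def L2_inner_def
    by (rule Bochner_Integration.integral_cong) (auto simp: cis_cnj inner_commute indicator_def)
  then show ?thesis by (simp only: has_L2_fourier_inner[OF F K])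
qed

lemma low_pass_kernel: 
  obtains k where "has_L2_fourier k (\<lambda>\<xi>. cis (- 2 * pi * (\<xi> \<bullet> x)) * indicator (ball 0 A) \<xi>)"
proof -
  have "(\<lambda>\<xi>. cis (- 2 * pi * (\<xi> \<bullet> x)) * indicator (ball 0 A) \<xi>) \<in> L2"
    by (rule L2_mult_bounded[OF indicator_ball_L2, where C=1]) auto
  then show thesis using L2_fourier_surj that by blast
qed

lemma low_pass_uniform_bound:
  assumes "F \<in> L2" shows "cmod (low_pass A F x) \<le> L2_norm (\<lambda>x::real^2. indicator (ball 0 A) x :: complex) * L2_norm F"
proof -
  have "cmod (low_pass A F x) \<le> (\<integral>\<xi>. cmod (trunc A F \<xi>) \<partial>lborel)"
    unfolding low_pass_def by (rule fourier_integral_bound)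
  also have "\<dots> = (\<integral>\<xi>. cmod (indicator (ball 0 A) \<xi>) * cmod (F \<xi>) \<partial>lborel)"
    by (simp add: trunc_def norm_mult)
  also have "\<dots> \<le> L2_norm (\<lambda>x::real^2. indicator (ball 0 A) x :: complex) * L2_norm F"
    by (rule L2_Cauchy_Schwarz_norm[OF indicator_ball_L2 assms])
  finally show ?thesis .
qed

lemma low_pass_L4:
  assumes F: "has_L2_fourier f F" and M: "\<And>x. cmod (low_pass A F x) \<le> M"
  shows "abs_sq (low_pass A F) \<in> L2" "L2_norm (abs_sq (low_pass A F)) \<le> M * L2_norm f"
proof -
  note L = has_L2_fourierD[OF F]
  have l: "has_L2_fourier (low_pass A F) (trunc A F)" by (rule has_L2_fourier_low_pass[OF L(2)])
  have lL: "low_pass A F \<in> L2" using has_L2_fourierD(1)[OF l] .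
  have [measurable]: "low_pass A F \<in> borel_measurable borel" using lL by auto
  have M0: "0 \<le> M" by (rule order_trans[OF norm_ge_zero M])
  have le: "cmod (abs_sq (low_pass A F) x) \<le> M * cmod (low_pass A F x)" for x
    using M[of x] by (simp add: norm_abs_sq power2_eq_square mult_right_mono)
  show aL: "abs_sq (low_pass A F) \<in> L2" by (rule L2_bound[OF lL _ le]) measurable
  have "(L2_norm (abs_sq (low_pass A F)))\<^sup>2 \<le> (\<integral>x. M\<^sup>2 * (cmod (low_pass A F x))\<^sup>2 \<partial>lborel)"
    unfolding L2_norm_sq
    by (intro integral_mono L2_integrable aL integrable_mult_right lL)
      (use le in \<open>auto simp: power_mult_distrib[symmetric] intro!: power_mono\<close>)
  also have "\<dots> = (M * L2_norm (low_pass A F))\<^sup>2" by (simp add: power_mult_distrib L2_norm_sq)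
  finally have "L2_norm (abs_sq (low_pass A F)) \<le> M * L2_norm (low_pass A F)"
    by (rule power2_le_imp_le) (use M0 in simp)
  also have "L2_norm (low_pass A F) \<le> L2_norm f"
  proof -
    have "(L2_norm (trunc A F))\<^sup>2 \<le> (L2_norm F)\<^sup>2" unfolding L2_norm_sq
      by (intro integral_mono L2_integrable trunc_L2 L) (auto simp: trunc_def indicator_def)
    then have "L2_norm (trunc A F) \<le> L2_norm F" by (rule power2_le_imp_le) simp
    then show ?thesis by (simp add: has_L2_fourier_norm[OF l, symmetric] has_L2_fourier_norm[OF F, symmetric])
  qed
  then have "M * L2_norm (low_pass A F) \<le> M * L2_norm f" using M0 by (rule mult_left_mono)
  finally show "L2_norm (abs_sq (low_pass A F)) \<le> M * L2_norm f" .
qed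

section \<open>The multiplier operator\<close>

definition b_symbol :: "real^2 \<Rightarrow> real" where
  "b_symbol \<xi> = (\<xi> $ 1)\<^sup>2 / ((\<xi> $ 1)\<^sup>2 + (\<xi> $ 2)\<^sup>2)"

lemma b_symbol: "0 \<le> b_symbol \<xi>" "b_symbol \<xi> \<le> 1"
proof -
  show "0 \<le> b_symbol \<xi>" by (simp add: b_symbol_def)
  have "a / (a + b) \<le> 1" if "0 \<le> a" "0 \<le> b" for a b :: real
    by (cases "a + b = 0") (use that in \<open>auto simp: divide_le_eq_1\<close>)
  then show "b_symbol \<xi> \<le> 1" by (simp add: b_symbol_def)
qed

lemma borel_measurable_b_symbol [measurable]: "b_symbol \<in> borel_measurable borel"
  unfolding b_symbol_def[abs_def] by measurable

definition l_symbol :: "real \<Rightarrow> real^2 \<Rightarrow> complex" where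
  "l_symbol \<gamma> \<xi> = of_real (1 + \<gamma> * b_symbol \<xi>)"

lemma borel_measurable_l_symbol [measurable]: "l_symbol \<gamma> \<in> borel_measurable borel"
  unfolding l_symbol_def[abs_def] by measurable

lemma norm_l_symbol: "\<gamma> > 0 \<Longrightarrow> norm (l_symbol \<gamma> \<xi>) \<le> 1 + \<gamma>"
  using b_symbol[of \<xi>] mult_left_mono[OF b_symbol(2)[of \<xi>], of \<gamma>] unfolding l_symbol_def norm_of_real by simp

text \<open>
  Surjectivity of the transform provides a function for the choice in \<open>fourier_multiplier\<close>.
  By uniqueness the result holds for every representative \<open>F\<close>, not only for the chosen one.
\<close>

lemma opL_fourier:
  assumes F: "has_L2_fourier f F"
  shows "has_L2_fourier (opL 1 \<gamma> f) (\<lambda>\<xi>. l_symbol \<gamma> \<xi> * F \<xi>)"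
proof -
  have mult: "(\<lambda>\<xi>. of_real (b_symbol \<xi>) * G \<xi>) \<in> L2" if "G \<in> L2" for G :: "real^2 \<Rightarrow> complex"
    using that by (rule L2_mult_bounded[where C=1]) (use b_symbol in auto)
  have "\<exists>h G. has_L2_fourier f G \<and> has_L2_fourier h (\<lambda>\<xi>. of_real (b_symbol \<xi>) * G \<xi>)"
    using F L2_fourier_surj[OF mult[OF has_L2_fourierD(2)[OF F]]] by blast
  then have "\<exists>G. has_L2_fourier f G \<and> has_L2_fourier (opB f) (\<lambda>\<xi>. of_real (b_symbol \<xi>) * G \<xi>)"
    unfolding opB_def fourier_multiplier_def b_symbol_def[symmetric] by (rule someI_ex)
  then obtain G where G: "has_L2_fourier f G" "has_L2_fourier (opB f) (\<lambda>\<xi>. of_real (b_symbol \<xi>) * G \<xi>)" by blast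
  have "AE \<xi> in lborel. G \<xi> = F \<xi>" by (rule has_L2_fourier_unique[OF G(1) F])
  then have "AE \<xi> in lborel. of_real (b_symbol \<xi>) * G \<xi> = of_real (b_symbol \<xi>) * F \<xi>" by eventually_elim simp
  then have B: "has_L2_fourier (opB f) (\<lambda>\<xi>. of_real (b_symbol \<xi>) * F \<xi>)"
    using G(2) mult[OF has_L2_fourierD(2)[OF F]]
    by (intro has_L2_fourier_cong_AE[OF G(2)]) (auto dest: has_L2_fourierD)
  have "opL 1 \<gamma> f = (\<lambda>x. f x + of_real \<gamma> * opB f x)" by (simp add: opL_def fun_eq_iff)
  moreover have "(\<lambda>\<xi>. l_symbol \<gamma> \<xi> * F \<xi>) = (\<lambda>\<xi>. F \<xi> + of_real \<gamma> * (of_real (b_symbol \<xi>) * F \<xi>))"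
    by (simp add: l_symbol_def fun_eq_iff ring_distribs)
  ultimately show ?thesis using has_L2_fourier_add[OF F has_L2_fourier_cmult[OF B, of "of_real \<gamma>"]] by simp
qed

section \<open>The quadratic form of the operator\<close>

definition L_form :: "real \<Rightarrow> (real^2 \<Rightarrow> complex) \<Rightarrow> (real^2 \<Rightarrow> complex) \<Rightarrow> real" where
  "L_form \<gamma> f g = Re (L2_inner (opL 1 \<gamma> f) g)"

lemma quartic_eq: "quartic \<gamma> u = L_form \<gamma> (abs_sq u) (abs_sq u)"
  unfolding quartic_def L_form_def L2_inner_def abs_sq_def[abs_def] by simp

lemma L_form_fourier:
  "has_L2_fourier f F \<Longrightarrow> has_L2_fourier g G \<Longrightarrow> L_form \<gamma> f g = Re (L2_inner (\<lambda>\<xi>. l_symbol \<gamma> \<xi> * F \<xi>) G)"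
  unfolding L_form_def by (subst has_L2_fourier_inner[OF opL_fourier]) auto

lemma opL_L2: "f \<in> L2 \<Longrightarrow> opL 1 \<gamma> f \<in> L2"
  using opL_fourier L2_fourier_exists has_L2_fourierD(1) by blast

lemma L_form_commute:
  assumes "f \<in> L2" "g \<in> L2" shows "L_form \<gamma> f g = L_form \<gamma> g f"
proof -
  obtain F G where F: "has_L2_fourier f F" and G: "has_L2_fourier g G" using L2_fourier_exists assms by blast
  have "L2_inner (\<lambda>\<xi>. l_symbol \<gamma> \<xi> * F \<xi>) G = cnj (L2_inner (\<lambda>\<xi>. l_symbol \<gamma> \<xi> * G \<xi>) F)"
    unfolding L2_inner_def Bochner_Integration.integral_cnj[symmetric]
    by (rule Bochner_Integration.integral_cong) (auto simp: l_symbol_def)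
  then show ?thesis by (simp add: L_form_fourier[OF F G] L_form_fourier[OF G F])
qed

lemma L_form_add_right:
  "f \<in> L2 \<Longrightarrow> g \<in> L2 \<Longrightarrow> h \<in> L2 \<Longrightarrow> L_form \<gamma> f (\<lambda>x. g x + h x) = L_form \<gamma> f g + L_form \<gamma> f h"
  unfolding L_form_def by (simp add: L2_inner_add_right opL_L2)

lemma L_form_add_left:
  "f \<in> L2 \<Longrightarrow> g \<in> L2 \<Longrightarrow> h \<in> L2 \<Longrightarrow> L_form \<gamma> (\<lambda>x. g x + h x) f = L_form \<gamma> g f + L_form \<gamma> h f"
  using L_form_commute[of f "\<lambda>x. g x + h x"] L_form_commute[of f g] L_form_commute[of f h] L_form_add_right[of f g h]
  by (simp add: L2_add)

lemma L_form_bound: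
  assumes "\<gamma> > 0" "f \<in> L2" "g \<in> L2" shows "\<bar>L_form \<gamma> f g\<bar> \<le> (1 + \<gamma>) * (L2_norm f * L2_norm g)"
proof -
  obtain F where F: "has_L2_fourier f F" using L2_fourier_exists assms by blast
  note FL = has_L2_fourierD(2)[OF F]
  have [measurable]: "F \<in> borel_measurable borel" using FL by auto
  have "L2_norm (opL 1 \<gamma> f) = L2_norm (\<lambda>\<xi>. l_symbol \<gamma> \<xi> * F \<xi>)"
    by (rule has_L2_fourier_norm[OF opL_fourier[OF F], symmetric])
  also have "\<dots> \<le> (1 + \<gamma>) * L2_norm F"
  proof (rule power2_le_imp_le)
    have "(L2_norm (\<lambda>\<xi>. l_symbol \<gamma> \<xi> * F \<xi>))\<^sup>2 \<le> (\<integral>\<xi>. (1 + \<gamma>)\<^sup>2 * (norm (F \<xi>))\<^sup>2 \<partial>lborel)"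
      unfolding L2_norm_sq
    proof (rule integral_mono)
      show "integrable lborel (\<lambda>\<xi>. (norm (l_symbol \<gamma> \<xi> * F \<xi>))\<^sup>2)"
        by (rule L2_integrable[OF has_L2_fourierD(2)[OF opL_fourier[OF F]]])
      show "integrable lborel (\<lambda>\<xi>. (1 + \<gamma>)\<^sup>2 * (norm (F \<xi>))\<^sup>2)" using L2_integrable[OF FL] by simp
      show "(norm (l_symbol \<gamma> \<xi> * F \<xi>))\<^sup>2 \<le> (1 + \<gamma>)\<^sup>2 * (norm (F \<xi>))\<^sup>2" for \<xi>
        unfolding norm_mult power_mult_distrib using norm_l_symbol[OF assms(1)] by (intro mult_right_mono power_mono) auto
    qed
    also have "\<dots> = ((1 + \<gamma>) * L2_norm F)\<^sup>2" by (simp add: power_mult_distrib L2_norm_sq)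
    finally show "(L2_norm (\<lambda>\<xi>. l_symbol \<gamma> \<xi> * F \<xi>))\<^sup>2 \<le> ((1 + \<gamma>) * L2_norm F)\<^sup>2" .
  qed (use assms in simp)
  finally have n: "L2_norm (opL 1 \<gamma> f) \<le> (1 + \<gamma>) * L2_norm f" by (simp add: has_L2_fourier_norm[OF F])
  have "\<bar>L_form \<gamma> f g\<bar> \<le> cmod (L2_inner (opL 1 \<gamma> f) g)" unfolding L_form_def by (rule abs_Re_le_cmod)
  also have "\<dots> \<le> L2_norm (opL 1 \<gamma> f) * L2_norm g" by (rule L2_Cauchy_Schwarz[OF opL_L2[OF assms(2)] assms(3)])
  also have "\<dots> \<le> ((1 + \<gamma>) * L2_norm f) * L2_norm g" by (rule mult_right_mono[OF n]) simp
  finally show ?thesis by (simp add: mult.assoc)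
qed

text \<open>
  The symbol of the operator is at least \<open>1\<close>.
\<close>

lemma L_form_ge:
  assumes "\<gamma> > 0" "f \<in> L2" shows "(L2_norm f)\<^sup>2 \<le> L_form \<gamma> f f"
proof -
  obtain F where F: "has_L2_fourier f F" using L2_fourier_exists assms by blast
  note FL = has_L2_fourierD(2)[OF F]
  have int: "integrable lborel (\<lambda>\<xi>. (l_symbol \<gamma> \<xi> * F \<xi>) * cnj (F \<xi>))"
    by (rule L2_integrable_inner[OF has_L2_fourierD(2)[OF opL_fourier[OF F]] FL])
  have "(L2_norm f)\<^sup>2 = (\<integral>\<xi>. (norm (F \<xi>))\<^sup>2 \<partial>lborel)" by (simp add: has_L2_fourier_norm[OF F, symmetric] L2_norm_sq)
  also have "\<dots> \<le> (\<integral>\<xi>. Re ((l_symbol \<gamma> \<xi> * F \<xi>) * cnj (F \<xi>)) \<partial>lborel)"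
  proof (rule integral_mono[OF L2_integrable[OF FL] integrable_Re[OF int]])
    fix \<xi>
    have "(l_symbol \<gamma> \<xi> * F \<xi>) * cnj (F \<xi>) = of_real ((1 + \<gamma> * b_symbol \<xi>) * (norm (F \<xi>))\<^sup>2)"
      by (simp only: l_symbol_def mult.assoc complex_norm_square[symmetric] of_real_mult of_real_power)
    then have "Re ((l_symbol \<gamma> \<xi> * F \<xi>) * cnj (F \<xi>)) = (1 + \<gamma> * b_symbol \<xi>) * (norm (F \<xi>))\<^sup>2" by (simp only: Re_complex_of_real)
    moreover have "1 * (norm (F \<xi>))\<^sup>2 \<le> (1 + \<gamma> * b_symbol \<xi>) * (norm (F \<xi>))\<^sup>2"
      using assms b_symbol[of \<xi>] by (intro mult_right_mono) auto
    ultimately show "(norm (F \<xi>))\<^sup>2 \<le> Re ((l_symbol \<gamma> \<xi> * F \<xi>) * cnj (F \<xi>))" by simp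
  qed
  also have "\<dots> = L_form \<gamma> f f" unfolding L_form_fourier[OF F F] L2_inner_def by (rule integral_Re[OF int])
  finally show ?thesis .
qed

lemma L_form_shift:
  assumes "f \<in> L2" "g \<in> L2" shows "L_form \<gamma> (\<lambda>x. f (x + y)) (\<lambda>x. g (x + y)) = L_form \<gamma> f g"
proof -
  obtain F G where F: "has_L2_fourier f F" and G: "has_L2_fourier g G" using L2_fourier_exists assms by blast
  have "L2_inner (\<lambda>\<xi>. l_symbol \<gamma> \<xi> * (cis (2 * pi * (\<xi> \<bullet> y)) * F \<xi>)) (\<lambda>\<xi>. cis (2 * pi * (\<xi> \<bullet> y)) * G \<xi>) = L2_inner (\<lambda>\<xi>. l_symbol \<gamma> \<xi> * F \<xi>) G"
    unfolding L2_inner_def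
  proof (rule Bochner_Integration.integral_cong[OF refl])
    fix \<xi> :: "real^2"
    have "cis (2 * pi * (\<xi> \<bullet> y)) * cnj (cis (2 * pi * (\<xi> \<bullet> y))) = 1" by (simp add: cis_cnj cis_mult)
    then have "(l_symbol \<gamma> \<xi> * F \<xi> * cnj (G \<xi>)) * (cis (2 * pi * (\<xi> \<bullet> y)) * cnj (cis (2 * pi * (\<xi> \<bullet> y)))) = l_symbol \<gamma> \<xi> * F \<xi> * cnj (G \<xi>)"
      by (simp only: mult_1_right)
    then show "l_symbol \<gamma> \<xi> * (cis (2 * pi * (\<xi> \<bullet> y)) * F \<xi>) * cnj (cis (2 * pi * (\<xi> \<bullet> y)) * G \<xi>) = l_symbol \<gamma> \<xi> * F \<xi> * cnj (G \<xi>)"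
      by (simp only: complex_cnj_mult mult_ac)
  qed
  then show ?thesis
    by (simp only: L_form_fourier[OF F G] L_form_fourier[OF has_L2_fourier_shift[OF F] has_L2_fourier_shift[OF G]])
qed

section \<open>\<open>H\<^sup>1\<close> as a Hilbert space\<close>

abbreviation grad_norm :: "(real^2 \<Rightarrow> complex) \<Rightarrow> real" where
  "grad_norm u \<equiv> L2_norm (weak_gradient u)"

abbreviation translate :: "real^2 \<Rightarrow> (real^2 \<Rightarrow> complex) \<Rightarrow> real^2 \<Rightarrow> complex" where
  "translate y u \<equiv> (\<lambda>x. u (x + y))"

lemma H1_diff:
  assumes "u \<in> H1" "w \<in> H1" shows "(\<lambda>x. u x - w x) \<in> H1"
proof -
  obtain F G where F: "has_L2_fourier u F" and G: "has_L2_fourier w G" using assms H1_obtain_fourier by metis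
  have "(\<lambda>\<xi>. of_real (h1_weight \<xi>) * F \<xi> - of_real (h1_weight \<xi>) * G \<xi>) \<in> L2"
    by (intro L2_diff H1_fourier_D(1)[OF assms(1) F] H1_fourier_D(1)[OF assms(2) G])
  then show ?thesis by (intro H1_fourier_I[OF has_L2_fourier_diff[OF F G]]) (simp add: right_diff_distrib)
qed

lemma L2_norm_phase: "L2_norm (\<lambda>\<xi>. cis (c \<xi>) * F \<xi>) = L2_norm F"
  by (simp add: L2_norm_def)

lemma H1_shift:
  assumes "u \<in> H1" shows "translate y u \<in> H1" "grad_norm (translate y u) = grad_norm u"
proof -
  obtain F where F: "has_L2_fourier u F" using assms H1_obtain_fourier by metis
  note S = has_L2_fourier_shift[OF F, of y]
  have "(\<lambda>\<xi>. cis (2 * pi * (\<xi> \<bullet> y)) * (of_real (h1_weight \<xi>) * F \<xi>)) \<in> L2"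
    by (rule L2_mult_bounded[OF H1_fourier_D(1)[OF assms F], where C=1]) auto
  then show *: "translate y u \<in> H1" by (intro H1_fourier_I[OF S]) (simp add: mult_ac)
  have "(\<lambda>\<xi>. of_real (2 * pi * norm \<xi>) * (cis (2 * pi * (\<xi> \<bullet> y)) * F \<xi>)) = (\<lambda>\<xi>. cis (2 * pi * (\<xi> \<bullet> y)) * (of_real (2 * pi * norm \<xi>) * F \<xi>))"
    by (simp add: mult_ac)
  then show "grad_norm (translate y u) = grad_norm u"
    by (simp only: weak_gradient_norm[OF * S] weak_gradient_norm[OF assms F] L2_norm_phase)
qed

lemma H1_inner_diff_left:
  assumes "u \<in> H1" "w \<in> H1" "z \<in> H1" shows "H1_inner (\<lambda>x. u x - w x) z = H1_inner u z - H1_inner w z"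
proof -
  obtain F G K where F: "has_L2_fourier u F" and G: "has_L2_fourier w G" and K: "has_L2_fourier z K"
    using assms H1_obtain_fourier by metis
  have "H1_inner (\<lambda>x. u x - w x) z = L2_inner (\<lambda>\<xi>. of_real (h1_weight \<xi>) * F \<xi> - of_real (h1_weight \<xi>) * G \<xi>) (h1_mult K)"
    unfolding H1_inner_fourier[OF H1_diff[OF assms(1,2)] has_L2_fourier_diff[OF F G] assms(3) K] by (simp add: right_diff_distrib)
  also have "\<dots> = H1_inner u z - H1_inner w z"
    unfolding H1_inner_fourier[OF assms(1) F assms(3) K] H1_inner_fourier[OF assms(2) G assms(3) K]
    by (intro L2_inner_diff_left H1_fourier_D(1)[OF assms(1) F] H1_fourier_D(1)[OF assms(2) G] H1_fourier_D(1)[OF assms(3) K])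
  finally show ?thesis .
qed

lemma H1_inner_self:
  assumes "u \<in> H1" shows "H1_inner u u = of_real ((L2_norm u)\<^sup>2 + (grad_norm u)\<^sup>2)"
proof -
  obtain F where F: "has_L2_fourier u F" using assms H1_obtain_fourier by metis
  note D = H1_fourier_D[OF assms F]
  have "(L2_norm (h1_mult F))\<^sup>2 = (\<integral>\<xi>. (norm (F \<xi>))\<^sup>2 + (norm (of_real (2 * pi * norm \<xi>) * F \<xi>))\<^sup>2 \<partial>lborel)"
    unfolding L2_norm_sq by (rule Bochner_Integration.integral_cong) (auto simp: norm_mult power_mult_distrib h1_weight(2) ring_distribs)
  also have "\<dots> = (L2_norm F)\<^sup>2 + (L2_norm (grad_mult F))\<^sup>2"
    unfolding L2_norm_sq by (intro Bochner_Integration.integral_add L2_integrable has_L2_fourierD(2)[OF F] D(4))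
  also have "\<dots> = (L2_norm u)\<^sup>2 + (grad_norm u)\<^sup>2"
    by (simp only: has_L2_fourier_norm[OF F] weak_gradient_norm[OF assms F])
  finally show ?thesis unfolding H1_inner_fourier[OF assms F assms F] L2_inner_self by simp
qed

text \<open>
  Divide the transform of \<open>k\<close> by the square of the weight. So weak convergence in \<open>H\<^sup>1\<close>
  implies weak convergence in \<open>L\<^sup>2\<close>.
\<close>

lemma H1_represents_L2_inner:
  assumes "k \<in> L2" obtains w where "w \<in> H1" "\<And>u. u \<in> H1 \<Longrightarrow> H1_inner u w = L2_inner u k"
proof -
  obtain K where K: "has_L2_fourier k K" using L2_fourier_exists assms by blast
  define G where "G \<xi> = of_real (1 / (h1_weight \<xi>)\<^sup>2) * K \<xi>" for \<xi>
  have le: "1 / (h1_weight \<xi>)\<^sup>2 \<le> 1" "1 / \<bar>h1_weight \<xi>\<bar> \<le> 1" for \<xi> using h1_weight(1)[of \<xi>] by (auto simp: divide_le_eq_1 one_le_power)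
  have GL: "G \<in> L2" unfolding G_def[abs_def]
    by (rule L2_mult_bounded[OF has_L2_fourierD(2)[OF K], where C=1]) (use le in \<open>auto simp: norm_divide norm_power\<close>)
  have wG: "h1_mult G \<in> L2"
  proof -
    have "(\<lambda>\<xi>. of_real (1 / h1_weight \<xi>) * K \<xi>) \<in> L2"
      by (rule L2_mult_bounded[OF has_L2_fourierD(2)[OF K], where C=1]) (use le in \<open>auto simp: norm_divide\<close>)
    moreover have "of_real (1 / h1_weight \<xi>) * K \<xi> = of_real (h1_weight \<xi>) * G \<xi>" for \<xi>
      using h1_weight(4)[of \<xi>] by (simp add: G_def power2_eq_square)
    ultimately show ?thesis by simp
  qed
  obtain w where w: "has_L2_fourier w G" using L2_fourier_surj[OF GL] by blast
  have wH: "w \<in> H1" by (rule H1_fourier_I[OF w wG])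
  have "H1_inner u w = L2_inner u k" if u: "u \<in> H1" for u
  proof -
    obtain F where F: "has_L2_fourier u F" using u H1_obtain_fourier by metis
    have "H1_inner u w = L2_inner F K"
      unfolding H1_inner_fourier[OF u F wH w] L2_inner_def
    proof (rule Bochner_Integration.integral_cong[OF refl])
      fix \<xi>
      have "(of_real (h1_weight \<xi>) * of_real (h1_weight \<xi>) * of_real (1 / (h1_weight \<xi>)\<^sup>2) :: complex) = 1"
        using h1_weight(4)[of \<xi>] by (simp only: of_real_mult[symmetric]) (simp add: power2_eq_square)
      then have "F \<xi> * cnj (K \<xi>) * (of_real (h1_weight \<xi>) * of_real (h1_weight \<xi>) * of_real (1 / (h1_weight \<xi>)\<^sup>2)) = F \<xi> * cnj (K \<xi>)"
        by (simp only: mult_1_right)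
      then show "of_real (h1_weight \<xi>) * F \<xi> * cnj (of_real (h1_weight \<xi>) * G \<xi>) = F \<xi> * cnj (K \<xi>)"
        by (simp only: G_def complex_cnj_mult complex_cnj_complex_of_real mult_ac)
    qed
    then show ?thesis by (simp only: has_L2_fourier_inner[OF F K])
  qed
  then show thesis using that wH by blast
qed

lemma H1_weak_imp_L2_weak:
  assumes "H1_weakly_converges u V" shows "L2_weakly u V"
  unfolding L2_weakly_def
proof
  fix k :: "real^2 \<Rightarrow> complex" assume "k \<in> L2"
  then obtain w where w: "w \<in> H1" "\<And>u. u \<in> H1 \<Longrightarrow> H1_inner u w = L2_inner u k" using H1_represents_L2_inner by blast
  have u: "u n \<in> H1" "V \<in> H1" for n using assms by (auto simp: H1_weakly_converges_def)
  have "(\<lambda>n. H1_inner (u n) w) \<longlonglongrightarrow> H1_inner V w" using assms w(1) by (simp add: H1_weakly_converges_def)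
  then show "(\<lambda>n. L2_inner (u n) k) \<longlonglongrightarrow> L2_inner V k" by (simp only: w(2)[OF u(1)] w(2)[OF u(2)])
qed

text \<open>
  Multiplication of the transform by the weight is an isometry onto \<open>L\<^sup>2\<close>, so the weak limit
  is found there and pulled back.
\<close>

lemma H1_weak_compactness:
  fixes u :: "nat \<Rightarrow> real^2 \<Rightarrow> complex"
  assumes u: "\<And>n. u n \<in> H1" and K: "\<And>n. (L2_norm (u n))\<^sup>2 + (grad_norm (u n))\<^sup>2 \<le> K"
  obtains r V where "strict_mono r" "H1_weakly_converges (\<lambda>n. u (r n)) V"
proof -
  have "\<forall>n. \<exists>G. has_L2_fourier (u n) G" by (intro allI L2_fourier_exists H1_L2 u)
  then obtain F where F: "\<And>n. has_L2_fourier (u n) (F n)" by metis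
  define P where "P n \<xi> = of_real (h1_weight \<xi>) * F n \<xi>" for n \<xi>
  have PL: "P n \<in> L2" for n unfolding P_def[abs_def] by (rule H1_fourier_D(1)[OF u F])
  have "complex_of_real ((L2_norm (P n))\<^sup>2) = of_real ((L2_norm (u n))\<^sup>2 + (grad_norm (u n))\<^sup>2)" for n
    using H1_inner_self[OF u[of n]] H1_inner_fourier[OF u F u F, of n n] L2_inner_self[of "P n"] by (simp add: P_def[abs_def])
  then have Pn: "(L2_norm (P n))\<^sup>2 = (L2_norm (u n))\<^sup>2 + (grad_norm (u n))\<^sup>2" for n by (simp only: of_real_eq_iff)
  have "L2_norm (P n) \<le> sqrt K" for n using K[of n] Pn[of n] by (intro real_le_rsqrt) simp
  then obtain r Q where r: "strict_mono r" and Q: "Q \<in> L2" "L2_weakly (\<lambda>n. P (r n)) Q"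
    using L2_weak_compactness[of P "sqrt K"] PL by blast
  define G where "G \<xi> = of_real (1 / h1_weight \<xi>) * Q \<xi>" for \<xi>
  have le: "0 \<le> 1 / h1_weight \<xi>" "1 / h1_weight \<xi> \<le> 1" for \<xi> using h1_weight(1)[of \<xi>] by (auto simp: divide_le_eq_1)
  have GL: "G \<in> L2" unfolding G_def[abs_def]
    by (rule L2_mult_bounded[OF Q(1), where C=1]) (use le in \<open>auto simp del: of_real_divide\<close>)
  have wG: "(h1_mult G) = Q"
    using h1_weight(4) by (simp add: G_def fun_eq_iff)
  obtain V where V: "has_L2_fourier V G" using L2_fourier_surj[OF GL] by blast
  have VH: "V \<in> H1" by (rule H1_fourier_I[OF V]) (simp add: wG Q)
  have "H1_weakly_converges (\<lambda>n. u (r n)) V"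
    unfolding H1_weakly_converges_def
  proof (intro conjI allI ballI u VH)
    fix w assume w: "w \<in> H1"
    obtain K where K: "has_L2_fourier w K" using w H1_obtain_fourier by metis
    show "(\<lambda>n. H1_inner (u (r n)) w) \<longlonglongrightarrow> H1_inner V w"
      unfolding H1_inner_fourier[OF u F w K] H1_inner_fourier[OF VH V w K] wG P_def[symmetric]
      using Q(2) H1_fourier_D(1)[OF w K] by (simp add: L2_weakly_def P_def[abs_def])
  qed
  then show thesis using that r by blast
qed

section \<open>The optimal constant\<close>

lemma H1_abs_sq:
  assumes "u \<in> H1"
  shows "abs_sq u \<in> L2" "L2_norm (abs_sq u) \<le> 32 * (L2_norm u * grad_norm u)"
proof -
  obtain F where F: "has_L2_fourier u F" using assms H1_obtain_fourier by metis
  show "abs_sq u \<in> L2" "L2_norm (abs_sq u) \<le> 32 * (L2_norm u * grad_norm u)"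
    using Gagliardo_Nirenberg[OF F H1_fourier_D(4)[OF assms F]] by (simp_all only: weak_gradient_norm[OF assms F])
qed

lemma quartic_le:
  assumes "\<gamma> > 0" "u \<in> H1" shows "quartic \<gamma> u \<le> (1 + \<gamma>) * (L2_norm (abs_sq u))\<^sup>2"
  using L_form_bound[OF assms(1) H1_abs_sq(1)[OF assms(2)] H1_abs_sq(1)[OF assms(2)]]
  by (simp add: quartic_eq power2_eq_square)

lemma quartic_shift: "u \<in> H1 \<Longrightarrow> quartic \<gamma> (translate y u) = quartic \<gamma> u"
  using L_form_shift[OF H1_abs_sq(1) H1_abs_sq(1), of u u \<gamma> y] by (simp add: quartic_eq abs_sq_def[abs_def])

lemma quartic_pos:
  assumes "\<gamma> > 0" "u \<in> H1" "L2_norm u \<noteq> 0" shows "quartic \<gamma> u > 0"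
proof -
  have "L2_norm (abs_sq u) \<noteq> 0"
  proof
    assume "L2_norm (abs_sq u) = 0"
    then have "AE x in lborel. abs_sq u x = 0" using L2_norm_eq_0_iff[OF H1_abs_sq(1)[OF assms(2)]] by simp
    then have "AE x in lborel. u x = 0" by eventually_elim (simp add: abs_sq_def)
    then show False using L2_norm_eq_0_iff[OF H1_L2[OF assms(2)]] assms(3) by simp
  qed
  then have "0 < (L2_norm (abs_sq u))\<^sup>2" by simp
  also have "\<dots> \<le> quartic \<gamma> u" unfolding quartic_eq by (rule L_form_ge[OF assms(1) H1_abs_sq(1)[OF assms(2)]])
  finally show ?thesis .
qed

text \<open>
  The admissible constants form a closed set: it is nonempty by the Gagliardo--Nirenberg
  inequality, and \<open>u0\<close> bounds it below by a positive number. So it has a least element, and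
  \<open>LEAST\<close> denotes it.
\<close>

lemma C_opt_optimal:
  assumes \<gamma>: "\<gamma> > 0" and u0: "u0 \<in> H1" "quartic \<gamma> u0 > 0"
  shows "C_opt \<gamma> > 0" "\<And>u. u \<in> H1 \<Longrightarrow> quartic \<gamma> u \<le> C_opt \<gamma> * (grad_norm u)\<^sup>2 * (L2_norm u)\<^sup>2"
proof -
  define p where "p u = (grad_norm u)\<^sup>2 * (L2_norm u)\<^sup>2" for u
  have p0: "0 \<le> p u" for u by (simp add: p_def)
  define S where "S = {C. \<forall>u\<in>H1. quartic \<gamma> u \<le> C * p u}"
  have "(1 + \<gamma>) * 1024 \<in> S"
  proof -
    have "quartic \<gamma> u \<le> (1 + \<gamma>) * 1024 * p u" if u: "u \<in> H1" for u
    proof -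
      have "(L2_norm (abs_sq u))\<^sup>2 \<le> (32 * (L2_norm u * grad_norm u))\<^sup>2" using H1_abs_sq(2)[OF u] by (intro power_mono) auto
      then have "(1 + \<gamma>) * (L2_norm (abs_sq u))\<^sup>2 \<le> (1 + \<gamma>) * (32 * (L2_norm u * grad_norm u))\<^sup>2"
        using \<gamma> by (intro mult_left_mono) auto
      also have "\<dots> = (1 + \<gamma>) * 1024 * p u" by (simp add: p_def power_mult_distrib)
      finally show ?thesis using quartic_le[OF \<gamma> u] by linarith
    qed
    then show ?thesis by (simp add: S_def)
  qed
  then have ne: "S \<noteq> {}" by auto
  then obtain C1 where C1: "C1 \<in> S" by auto
  have p_pos: "p u0 > 0"
  proof (rule ccontr)
    assume "\<not> p u0 > 0"
    then have "p u0 = 0" using p0[of u0] by simp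
    moreover have "quartic \<gamma> u0 \<le> C1 * p u0" using C1 u0(1) by (simp add: S_def)
    ultimately show False using u0(2) by simp
  qed
  have lower: "quartic \<gamma> u / p u \<le> C" if "C \<in> S" "u \<in> H1" "p u > 0" for C u
    using that by (simp add: S_def divide_le_eq)
  have bdd: "bdd_below S" using lower u0(1) p_pos by (auto intro!: bdd_belowI)
  have "quartic \<gamma> u \<le> Inf S * p u" if u: "u \<in> H1" for u
  proof (cases "p u = 0")
    case True
    then show ?thesis using C1 u by (auto simp: S_def)
  next
    case False
    then have "p u > 0" using p0[of u] by simp
    then have "quartic \<gamma> u / p u \<le> Inf S" using lower u ne by (intro cInf_greatest) auto
    then show ?thesis using \<open>p u > 0\<close> by (simp add: divide_le_eq)
  qed
  then have InfS: "Inf S \<in> S" by (simp add: S_def)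
  have "C_opt \<gamma> = Inf S"
    unfolding C_opt_def
  proof (rule Least_equality)
    show "\<forall>u\<in>H1. quartic \<gamma> u \<le> Inf S * (grad_norm u)\<^sup>2 * (L2_norm u)\<^sup>2"
      using InfS by (simp add: S_def p_def mult.assoc)
    fix C assume "\<forall>u\<in>H1. quartic \<gamma> u \<le> C * (grad_norm u)\<^sup>2 * (L2_norm u)\<^sup>2"
    then have "C \<in> S" by (simp add: S_def p_def mult.assoc)
    then show "Inf S \<le> C" using bdd by (rule cInf_lower)
  qed
  then have CS: "C_opt \<gamma> \<in> S" using InfS by simp
  show "\<And>u. u \<in> H1 \<Longrightarrow> quartic \<gamma> u \<le> C_opt \<gamma> * (grad_norm u)\<^sup>2 * (L2_norm u)\<^sup>2"
    using CS by (simp add: S_def p_def mult.assoc)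
  have "0 < quartic \<gamma> u0 / p u0" using u0(2) p_pos by simp
  also have "\<dots> \<le> C_opt \<gamma>" by (rule lower[OF CS u0(1) p_pos])
  finally show "C_opt \<gamma> > 0" .
qed

section \<open>Elementary estimates\<close>

lemma L2_norm_mono:
  fixes f g :: "real^2 \<Rightarrow> complex"
  assumes "f \<in> L2" "g \<in> L2" "\<And>x. norm (f x) \<le> norm (g x)" shows "L2_norm f \<le> L2_norm g"
  unfolding L2_norm_def
  by (intro real_sqrt_le_mono integral_mono L2_integrable assms power_mono) auto

lemma cmod_add_sq_le: "(cmod (a + b))\<^sup>2 \<le> 2 * (cmod a)\<^sup>2 + 2 * (cmod b)\<^sup>2"
proof -
  have "(cmod (a + b))\<^sup>2 \<le> (cmod a + cmod b)\<^sup>2" by (intro power_mono norm_triangle_ineq) auto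
  also have "\<dots> \<le> 2 * (cmod a)\<^sup>2 + 2 * (cmod b)\<^sup>2"
    using sum_squares_bound[of "cmod a" "cmod b"] by (simp add: power2_sum)
  finally show ?thesis .
qed

lemma quotient_small:
  fixes c d :: real
  assumes "0 \<le> c" "0 < d" shows "c / d + 1 > 0" "c / (c / d + 1) < d"
proof -
  show *: "c / d + 1 > 0" using assms by (intro add_nonneg_pos) auto
  have "c < d * (c / d + 1)" using assms by (simp add: distrib_left)
  then show "c / (c / d + 1) < d" using * by (simp only: pos_divide_less_eq)
qed

lemma low_pass_weak_null:
  assumes "\<And>n::nat. has_L2_fourier (r n) (F n)" "L2_weakly r (\<lambda>x. 0)"
  shows "(\<lambda>n. low_pass A (F n) x) \<longlonglongrightarrow> 0"
proof -
  obtain k where k: "has_L2_fourier k (\<lambda>\<xi>. cis (- 2 * pi * (\<xi> \<bullet> x)) * indicator (ball 0 A) \<xi>)" by (rule low_pass_kernel)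
  have "(\<lambda>n. L2_inner (r n) k) \<longlonglongrightarrow> L2_inner (\<lambda>x. 0) k"
    using assms(2) has_L2_fourierD(1)[OF k] by (simp add: L2_weakly_def)
  then show ?thesis by (simp add: low_pass_inner[OF assms(1) k] L2_inner_def)
qed

section \<open>Splitting along weak limits\<close>

text \<open>
  Split \<open>r n\<close> at a high frequency. The high part is small in \<open>L\<^sup>4\<close>, uniformly in \<open>n\<close>; the low
  part tends to zero pointwise and is uniformly bounded, so dominated convergence applies
  once \<open>h\<close> is truncated to a ball.
\<close>

lemma weak_null_mult_tendsto:
  fixes r :: "nat \<Rightarrow> real^2 \<Rightarrow> complex"
  assumes h: "h \<in> L2" and r: "\<And>n. r n \<in> H1" and weak: "L2_weakly r (\<lambda>x. 0)"
    and K: "\<And>n. L2_norm (r n) \<le> K" "\<And>n. grad_norm (r n) \<le> K"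
  shows "(\<lambda>n. \<integral>x. cmod (h x) * cmod (abs_sq (r n) x) \<partial>lborel) \<longlonglongrightarrow> 0"
proof (rule LIMSEQ_I)
  fix e :: real assume e: "e > 0"
  have K0: "0 \<le> K" by (rule order_trans[OF L2_norm_nonneg K(1)])
  have "\<forall>n. \<exists>G. has_L2_fourier (r n) G" by (intro allI L2_fourier_exists H1_L2 r)
  then obtain F where F: "\<And>n. has_L2_fourier (r n) (F n)" by metis
  note FL = has_L2_fourierD(2)[OF F]
  define c where "c = 64 * L2_norm h * K\<^sup>2"
  have c0: "0 \<le> c" by (simp add: c_def)
  define A where "A = c / (e / 3) + 1"
  have A: "A > 0" "c / A < e / 3" unfolding A_def by (rule quotient_small; use e c0 in simp)+
  define low where "low n = low_pass A (F n)" for n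
  define high where "high n = (\<lambda>x. r n x - low n x)" for n
  define M where "M = L2_norm (\<lambda>x::real^2. indicator (ball 0 A) x :: complex) * K"
  have M0: "0 \<le> M" using K0 by (simp add: M_def)
  have low_M: "cmod (low n x) \<le> M" for n x
  proof -
    have "L2_norm (F n) \<le> K" using K(1)[of n] by (simp add: has_L2_fourier_norm[OF F])
    then show ?thesis unfolding low_def M_def
      by (intro order_trans[OF low_pass_uniform_bound[OF FL]] mult_left_mono) auto
  qed
  have lowL: "low n \<in> L2" for n unfolding low_def by (rule has_L2_fourierD(1)[OF has_L2_fourier_low_pass[OF FL]])
  have [measurable]: "low n \<in> borel_measurable borel" for n using lowL by auto
  have low_sq: "abs_sq (low n) \<in> L2" "L2_norm (abs_sq (low n)) \<le> M * K" for n
  proof -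
    show "abs_sq (low n) \<in> L2" unfolding low_def by (rule low_pass_L4(1)[OF F low_M[unfolded low_def]])
    have "L2_norm (abs_sq (low n)) \<le> M * L2_norm (r n)"
      unfolding low_def by (rule low_pass_L4(2)[OF F low_M[unfolded low_def]])
    also have "\<dots> \<le> M * K" by (rule mult_left_mono[OF K(1) M0])
    finally show "L2_norm (abs_sq (low n)) \<le> M * K" .
  qed
  have high_sq: "abs_sq (high n) \<in> L2" "L2_norm (abs_sq (high n)) \<le> 32 * (K\<^sup>2 / A)" for n
  proof -
    note hp = high_pass_L4[OF F H1_fourier_D(4)[OF r F] A(1), folded weak_gradient_norm[OF r F]]
    show "abs_sq (high n) \<in> L2" unfolding high_def low_def by (rule hp(1))
    have "L2_norm (abs_sq (high n)) \<le> 32 * ((grad_norm (r n))\<^sup>2 / A)" unfolding high_def low_def by (rule hp(2))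
    also have "\<dots> \<le> 32 * (K\<^sup>2 / A)" using K(2)[of n] A by (intro mult_left_mono divide_right_mono power_mono) auto
    finally show "L2_norm (abs_sq (high n)) \<le> 32 * (K\<^sup>2 / A)" .
  qed
  have "(\<lambda>n. (2 * (M * K)) * L2_norm (\<lambda>x. h x - trunc (real n) h x)) \<longlonglongrightarrow> 0"
    by (rule tendsto_mult_right_zero[OF trunc_nat_tendsto[OF h]])
  then have "\<forall>\<^sub>F n in sequentially. (2 * (M * K)) * L2_norm (\<lambda>x. h x - trunc (real n) h x) < e / 3"
    using e by (intro order_tendstoD(2)[of _ 0]) auto
  then obtain R where R: "(2 * (M * K)) * L2_norm (\<lambda>x. h x - trunc (real R) h x) < e / 3"
    by (auto simp: eventually_sequentially)
  define h1 where "h1 = trunc (real R) h"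
  define h2 where "h2 = (\<lambda>x. h x - h1 x)"
  have h1: "h1 \<in> L2" "integrable lborel h1" unfolding h1_def by (auto intro: trunc_L2 trunc_integrable h)
  have h2: "h2 \<in> L2" unfolding h2_def using h h1 by auto
  have [measurable]: "h1 \<in> borel_measurable borel" using h1(1) by auto
  have hsplit: "cmod (h x) = cmod (h1 x) + cmod (h2 x)" for x
    by (simp add: h1_def h2_def trunc_def indicator_def)
  have "(\<lambda>n. \<integral>x. cmod (h1 x) * cmod (abs_sq (low n) x) \<partial>lborel) \<longlonglongrightarrow> (\<integral>x. 0 \<partial>(lborel :: (real^2) measure))"
  proof (rule integral_dominated_convergence[where w="\<lambda>x. cmod (h1 x) * M\<^sup>2"])
    show "integrable lborel (\<lambda>x. cmod (h1 x) * M\<^sup>2)" using h1(2) by simp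
    show "AE x in lborel. (\<lambda>n. cmod (h1 x) * cmod (abs_sq (low n) x)) \<longlonglongrightarrow> 0"
    proof (rule AE_I2)
      fix x
      have "(\<lambda>n. low n x) \<longlonglongrightarrow> 0" unfolding low_def by (rule low_pass_weak_null[OF F weak])
      then have "(\<lambda>n. cmod (h1 x) * (cmod (low n x))\<^sup>2) \<longlonglongrightarrow> cmod (h1 x) * (cmod 0)\<^sup>2" by (intro tendsto_intros)
      then show "(\<lambda>n. cmod (h1 x) * cmod (abs_sq (low n) x)) \<longlonglongrightarrow> 0" by (simp add: norm_abs_sq)
    qed
    show "AE x in lborel. norm (cmod (h1 x) * cmod (abs_sq (low n) x)) \<le> cmod (h1 x) * M\<^sup>2" for n
      by (intro AE_I2) (auto simp: norm_abs_sq abs_mult intro!: mult_left_mono power_mono low_M)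
  qed measurable
  then have "(\<lambda>n. 2 * (\<integral>x. cmod (h1 x) * cmod (abs_sq (low n) x) \<partial>lborel)) \<longlonglongrightarrow> 0"
    by (intro tendsto_mult_right_zero) simp
  then have "\<forall>\<^sub>F n in sequentially. 2 * (\<integral>x. cmod (h1 x) * cmod (abs_sq (low n) x) \<partial>lborel) < e / 3"
    using e by (intro order_tendstoD(2)[of _ 0]) auto
  then obtain N where N: "\<And>n. n \<ge> N \<Longrightarrow> 2 * (\<integral>x. cmod (h1 x) * cmod (abs_sq (low n) x) \<partial>lborel) < e / 3"
    by (auto simp: eventually_sequentially)
  have "norm ((\<integral>x. cmod (h x) * cmod (abs_sq (r n) x) \<partial>lborel) - 0) < e" if n: "n \<ge> N" for n
  proof -
    note i1 = L2_integrable_mult_norm[OF h1(1) low_sq(1)[of n]]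
    note i2 = L2_integrable_mult_norm[OF h2 low_sq(1)[of n]]
    note i3 = L2_integrable_mult_norm[OF h high_sq(1)[of n]]
    have "(\<integral>x. cmod (h x) * cmod (abs_sq (r n) x) \<partial>lborel)
      \<le> (\<integral>x. 2 * (cmod (h1 x) * cmod (abs_sq (low n) x)) + 2 * (cmod (h2 x) * cmod (abs_sq (low n) x)) + 2 * (cmod (h x) * cmod (abs_sq (high n) x)) \<partial>lborel)"
    proof (rule integral_mono)
      show "integrable lborel (\<lambda>x. cmod (h x) * cmod (abs_sq (r n) x))"
        by (rule L2_integrable_mult_norm[OF h H1_abs_sq(1)[OF r]])
      show "integrable lborel (\<lambda>x. 2 * (cmod (h1 x) * cmod (abs_sq (low n) x)) + 2 * (cmod (h2 x) * cmod (abs_sq (low n) x)) + 2 * (cmod (h x) * cmod (abs_sq (high n) x)))"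
        using i1 i2 i3 by simp
      fix x
      have "(cmod (r n x))\<^sup>2 \<le> 2 * (cmod (low n x))\<^sup>2 + 2 * (cmod (high n x))\<^sup>2"
        using cmod_add_sq_le[of "low n x" "high n x"] by (simp add: high_def)
      then have "cmod (h x) * (cmod (r n x))\<^sup>2 \<le> cmod (h x) * (2 * (cmod (low n x))\<^sup>2 + 2 * (cmod (high n x))\<^sup>2)"
        by (rule mult_left_mono) simp
      then show "cmod (h x) * cmod (abs_sq (r n) x) \<le> 2 * (cmod (h1 x) * cmod (abs_sq (low n) x)) + 2 * (cmod (h2 x) * cmod (abs_sq (low n) x)) + 2 * (cmod (h x) * cmod (abs_sq (high n) x))"
        unfolding norm_abs_sq by (simp add: hsplit algebra_simps)
    qed
    also have "\<dots> = 2 * (\<integral>x. cmod (h1 x) * cmod (abs_sq (low n) x) \<partial>lborel) + 2 * (\<integral>x. cmod (h2 x) * cmod (abs_sq (low n) x) \<partial>lborel) + 2 * (\<integral>x. cmod (h x) * cmod (abs_sq (high n) x) \<partial>lborel)"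
      using i1 i2 i3 by simp
    also have "\<dots> < e"
    proof -
      have "2 * (\<integral>x. cmod (h2 x) * cmod (abs_sq (low n) x) \<partial>lborel) \<le> 2 * (L2_norm h2 * (M * K))"
        using order_trans[OF L2_Cauchy_Schwarz_norm[OF h2 low_sq(1)] mult_left_mono[OF low_sq(2) L2_norm_nonneg]] by simp
      also have "\<dots> < e / 3" using R by (simp add: h2_def h1_def mult_ac)
      finally have t2: "2 * (\<integral>x. cmod (h2 x) * cmod (abs_sq (low n) x) \<partial>lborel) < e / 3" .
      have "2 * (\<integral>x. cmod (h x) * cmod (abs_sq (high n) x) \<partial>lborel) \<le> 2 * (L2_norm h * (32 * (K\<^sup>2 / A)))"
        using order_trans[OF L2_Cauchy_Schwarz_norm[OF h high_sq(1)] mult_left_mono[OF high_sq(2) L2_norm_nonneg], of n] by linarith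
      also have "\<dots> = c / A" by (simp add: c_def)
      finally show ?thesis using N[OF n] t2 A(2) by linarith
    qed
    finally have "(\<integral>x. cmod (h x) * cmod (abs_sq (r n) x) \<partial>lborel) < e" .
    moreover have "0 \<le> (\<integral>x. cmod (h x) * cmod (abs_sq (r n) x) \<partial>lborel)" by (rule Bochner_Integration.integral_nonneg) simp
    ultimately show ?thesis by simp
  qed
  then show "\<exists>N. \<forall>n\<ge>N. norm ((\<integral>x. cmod (h x) * cmod (abs_sq (r n) x) \<partial>lborel) - 0) < e" by blast
qed

lemma L2_weakly_diff:
  assumes "L2_weakly w V" "\<And>n. w n \<in> L2" "V \<in> L2"
  shows "L2_weakly (\<lambda>n x. w n x - V x) (\<lambda>x. 0)"
  unfolding L2_weakly_def
proof
  fix g :: "real^2 \<Rightarrow> complex" assume g: "g \<in> L2"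
  have "(\<lambda>n. L2_inner (w n) g - L2_inner V g) \<longlonglongrightarrow> 0"
    using assms(1) g LIM_zero by (auto simp: L2_weakly_def)
  then show "(\<lambda>n. L2_inner (\<lambda>x. w n x - V x) g) \<longlonglongrightarrow> L2_inner (\<lambda>x. 0) g"
    using assms(2,3) g by (simp add: L2_inner_diff_left L2_inner_def[of "\<lambda>x. 0"])
qed

text \<open>
  Write \<open>\<bar>w\<bar>\<^sup>2 = \<bar>V\<bar>\<^sup>2 + \<bar>r\<bar>\<^sup>2 + 2 Re (cnj V r)\<close>, where \<open>r\<close> is the remainder. The last term
  tends to zero in \<open>L\<^sup>2\<close>, and \<open>\<bar>r\<bar>\<^sup>2\<close> becomes orthogonal to the fixed function obtained by
  applying the operator to \<open>\<bar>V\<bar>\<^sup>2\<close>. Both facts follow from \<open>weak_null_mult_tendsto\<close>.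
\<close>

lemma quartic_splitting:
  assumes \<gamma>: "\<gamma> > 0" and weak: "H1_weakly_converges w V"
    and K: "\<And>n. L2_norm (\<lambda>x. w n x - V x) \<le> K" "\<And>n. grad_norm (\<lambda>x. w n x - V x) \<le> K"
  shows "(\<lambda>n. quartic \<gamma> (w n) - quartic \<gamma> (\<lambda>x. w n x - V x)) \<longlonglongrightarrow> quartic \<gamma> V"
proof -
  have w: "w n \<in> H1" and V: "V \<in> H1" for n using weak by (auto simp: H1_weakly_converges_def)
  define r where "r n = (\<lambda>x. w n x - V x)" for n
  have r: "r n \<in> H1" for n unfolding r_def by (rule H1_diff[OF w V])
  have r_weak: "L2_weakly r (\<lambda>x. 0)"
    unfolding r_def[abs_def] by (intro L2_weakly_diff H1_weak_imp_L2_weak weak H1_L2 w V)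
  have K': "L2_norm (r n) \<le> K" "grad_norm (r n) \<le> K" for n using K by (auto simp: r_def)
  have K0: "0 \<le> K" by (rule order_trans[OF L2_norm_nonneg K'(1)])
  define s where "s = abs_sq V"
  define \<rho> where "\<rho> n = abs_sq (r n)" for n
  define c where "c n x = complex_of_real (2 * Re (cnj (V x) * r n x))" for n x
  have sL: "s \<in> L2" unfolding s_def by (rule H1_abs_sq(1)[OF V])
  have \<rho>L: "\<rho> n \<in> L2" for n unfolding \<rho>_def by (rule H1_abs_sq(1)[OF r])
  have \<rho>_le: "L2_norm (\<rho> n) \<le> 32 * (K * K)" for n
  proof -
    have "L2_norm (\<rho> n) \<le> 32 * (L2_norm (r n) * grad_norm (r n))" unfolding \<rho>_def by (rule H1_abs_sq(2)[OF r])
    also have "\<dots> \<le> 32 * (K * K)" using K' K0 by (intro mult_left_mono mult_mono) auto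
    finally show ?thesis .
  qed
  have [measurable]: "V \<in> borel_measurable borel" "r n \<in> borel_measurable borel" for n
    using H1_L2[OF V] H1_L2[OF r] by auto
  have [measurable]: "(\<lambda>x. cnj (V x)) \<in> borel_measurable borel" using L2_measurable[OF L2_cnj[OF H1_L2[OF V]]] .
  have cm: "c n \<in> borel_measurable borel" for n unfolding c_def by measurable
  have c_le: "(cmod (c n x))\<^sup>2 \<le> 4 * (cmod (s x) * cmod (\<rho> n x))" for n x
  proof -
    have "cmod (c n x) = 2 * \<bar>Re (cnj (V x) * r n x)\<bar>" unfolding c_def norm_of_real by (simp only: abs_mult abs_numeral)
    also have "\<dots> \<le> 2 * (cmod (V x) * cmod (r n x))"
      using abs_Re_le_cmod[of "cnj (V x) * r n x"] by (simp add: norm_mult)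
    finally have "(cmod (c n x))\<^sup>2 \<le> (2 * (cmod (V x) * cmod (r n x)))\<^sup>2" by (intro power_mono) auto
    then show ?thesis by (simp add: s_def \<rho>_def norm_abs_sq power_mult_distrib)
  qed
  have int: "integrable lborel (\<lambda>x. 4 * (cmod (s x) * cmod (\<rho> n x)))" for n
    using L2_integrable_mult_norm[OF sL \<rho>L[of n]] by simp
  have c_int: "integrable lborel (\<lambda>x. (cmod (c n x))\<^sup>2)" for n
    by (rule Bochner_Integration.integrable_bound[OF int[of n]]) (use c_le cm[of n] in \<open>auto simp: abs_mult\<close>)
  have cL: "c n \<in> L2" for n using cm c_int by (simp add: L2_iff)
  have "(\<lambda>n. (L2_norm (c n))\<^sup>2) \<longlonglongrightarrow> 0"
  proof (rule tendsto_sandwich[OF _ _ tendsto_const])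
    show "(\<lambda>n. 4 * (\<integral>x. cmod (s x) * cmod (\<rho> n x) \<partial>lborel)) \<longlonglongrightarrow> 0"
      unfolding \<rho>_def by (rule tendsto_mult_right_zero[OF weak_null_mult_tendsto[OF sL r r_weak K']])
    show "\<forall>\<^sub>F n in sequentially. (L2_norm (c n))\<^sup>2 \<le> 4 * (\<integral>x. cmod (s x) * cmod (\<rho> n x) \<partial>lborel)"
      unfolding L2_norm_sq integral_mult_right_zero[symmetric]
      by (intro always_eventually allI integral_mono c_int int c_le)
  qed simp
  then have c_lim: "(\<lambda>n. L2_norm (c n)) \<longlonglongrightarrow> 0" by simp
  define q where "q = L_form \<gamma>"
  have q_le: "\<bar>q f g\<bar> \<le> (1 + \<gamma>) * (L2_norm f * L2_norm g)" if "f \<in> L2" "g \<in> L2" for f g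
    unfolding q_def by (rule L_form_bound[OF \<gamma> that])
  have l1: "(\<lambda>n. q s (\<rho> n)) \<longlonglongrightarrow> 0"
  proof (rule Lim_null_comparison)
    show "(\<lambda>n. \<integral>x. cmod (opL 1 \<gamma> s x) * cmod (\<rho> n x) \<partial>lborel) \<longlonglongrightarrow> 0"
      unfolding \<rho>_def by (rule weak_null_mult_tendsto[OF opL_L2[OF sL] r r_weak K'])
    have "\<bar>q s (\<rho> n)\<bar> \<le> (\<integral>x. cmod (opL 1 \<gamma> s x) * cmod (\<rho> n x) \<partial>lborel)" for n
    proof -
      have "\<bar>q s (\<rho> n)\<bar> \<le> cmod (L2_inner (opL 1 \<gamma> s) (\<rho> n))" unfolding q_def L_form_def by (rule abs_Re_le_cmod)
      also have "\<dots> \<le> (\<integral>x. cmod (opL 1 \<gamma> s x * cnj (\<rho> n x)) \<partial>lborel)" unfolding L2_inner_def by (rule integral_norm_bound)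
      finally show ?thesis by (simp add: norm_mult)
    qed
    then show "\<forall>\<^sub>F n in sequentially. norm (q s (\<rho> n)) \<le> (\<integral>x. cmod (opL 1 \<gamma> s x) * cmod (\<rho> n x) \<partial>lborel)" by simp
  qed
  have l2: "(\<lambda>n. q s (c n)) \<longlonglongrightarrow> 0"
  proof (rule Lim_null_comparison)
    show "(\<lambda>n. (1 + \<gamma>) * (L2_norm s * L2_norm (c n))) \<longlonglongrightarrow> 0" by (intro tendsto_mult_right_zero c_lim)
    show "\<forall>\<^sub>F n in sequentially. norm (q s (c n)) \<le> (1 + \<gamma>) * (L2_norm s * L2_norm (c n))" using q_le[OF sL cL] by simp
  qed
  have l3: "(\<lambda>n. q (\<rho> n) (c n)) \<longlonglongrightarrow> 0"
  proof (rule Lim_null_comparison)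
    show "(\<lambda>n. (1 + \<gamma>) * (32 * (K * K) * L2_norm (c n))) \<longlonglongrightarrow> 0" by (intro tendsto_mult_right_zero c_lim)
    have "\<bar>q (\<rho> n) (c n)\<bar> \<le> (1 + \<gamma>) * (32 * (K * K) * L2_norm (c n))" for n
      using \<gamma> \<rho>_le[of n] by (intro order_trans[OF q_le[OF \<rho>L cL]] mult_left_mono mult_right_mono) auto
    then show "\<forall>\<^sub>F n in sequentially. norm (q (\<rho> n) (c n)) \<le> (1 + \<gamma>) * (32 * (K * K) * L2_norm (c n))" by simp
  qed
  have l4: "(\<lambda>n. q (c n) (c n)) \<longlonglongrightarrow> 0"
  proof (rule Lim_null_comparison)
    show "(\<lambda>n. (1 + \<gamma>) * (L2_norm (c n) * L2_norm (c n))) \<longlonglongrightarrow> 0"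
      by (intro tendsto_mult_right_zero tendsto_mult_zero c_lim)
    show "\<forall>\<^sub>F n in sequentially. norm (q (c n) (c n)) \<le> (1 + \<gamma>) * (L2_norm (c n) * L2_norm (c n))" using q_le[OF cL cL] by simp
  qed
  have eq: "quartic \<gamma> (w n) - quartic \<gamma> (r n) = q s s + 2 * q s (\<rho> n) + 2 * q s (c n) + 2 * q (\<rho> n) (c n) + q (c n) (c n)" for n
  proof -
    have "abs_sq (w n) = (\<lambda>x. s x + (\<rho> n x + c n x))"
    proof
      fix x
      have "(cmod (V x + r n x))\<^sup>2 = (cmod (V x))\<^sup>2 + ((cmod (r n x))\<^sup>2 + 2 * Re (cnj (V x) * r n x))"
        by (simp add: cmod_power2 power2_sum algebra_simps)
      moreover have "V x + r n x = w n x" by (simp add: r_def)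
      ultimately show "abs_sq (w n) x = s x + (\<rho> n x + c n x)"
        unfolding s_def \<rho>_def abs_sq_def c_def by (simp only: of_real_add[symmetric])
    qed
    moreover have \<rho>c: "(\<lambda>x. \<rho> n x + c n x) \<in> L2" using \<rho>L cL by (rule L2_add)
    moreover have "(\<lambda>x. s x + (\<rho> n x + c n x)) \<in> L2" using sL \<rho>c by (rule L2_add)
    ultimately have "quartic \<gamma> (w n) = q s s + (q s (\<rho> n) + q s (c n)) + (q (\<rho> n) s + (q (\<rho> n) (\<rho> n) + q (\<rho> n) (c n)) + (q (c n) s + (q (c n) (\<rho> n) + q (c n) (c n))))"
      unfolding quartic_eq q_def
      by (simp only: L_form_add_left[OF _ sL \<rho>c] L_form_add_left[OF _ \<rho>L cL] L_form_add_right[OF sL sL \<rho>c] L_form_add_right[OF sL \<rho>L cL]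
          L_form_add_right[OF \<rho>L sL \<rho>c] L_form_add_right[OF \<rho>L \<rho>L cL] L_form_add_right[OF cL sL \<rho>c] L_form_add_right[OF cL \<rho>L cL])
    moreover have "q (\<rho> n) s = q s (\<rho> n)" "q (c n) s = q s (c n)" "q (c n) (\<rho> n) = q (\<rho> n) (c n)"
      unfolding q_def using sL \<rho>L cL by (auto intro: L_form_commute)
    moreover have "quartic \<gamma> (r n) = q (\<rho> n) (\<rho> n)" by (simp add: quartic_eq q_def \<rho>_def)
    ultimately show ?thesis by simp
  qed
  have "(\<lambda>n. q s s + 2 * q s (\<rho> n) + 2 * q s (c n) + 2 * q (\<rho> n) (c n) + q (c n) (c n)) \<longlonglongrightarrow> q s s + 2 * 0 + 2 * 0 + 2 * 0 + 0"
    by (intro tendsto_add tendsto_mult tendsto_const l1 l2 l3 l4)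
  then show ?thesis unfolding eq[unfolded r_def, symmetric] by (simp add: q_def s_def quartic_eq)
qed

text \<open>
  Pythagoras' theorem in the limit: the mixed terms are inner products with the fixed
  function \<open>V\<close>.
\<close>

lemma norm_splitting:
  assumes weak: "H1_weakly_converges w V"
  shows "(\<lambda>n. (L2_norm (w n))\<^sup>2 - (L2_norm (\<lambda>x. w n x - V x))\<^sup>2) \<longlonglongrightarrow> (L2_norm V)\<^sup>2"
    and "(\<lambda>n. (grad_norm (w n))\<^sup>2 - (grad_norm (\<lambda>x. w n x - V x))\<^sup>2) \<longlonglongrightarrow> (grad_norm V)\<^sup>2"
proof -
  have w: "w n \<in> H1" and V: "V \<in> H1" for n using weak by (auto simp: H1_weakly_converges_def)
  have "(\<lambda>n. 2 * Re (L2_inner (w n) V) - (L2_norm V)\<^sup>2) \<longlonglongrightarrow> 2 * Re (L2_inner V V) - (L2_norm V)\<^sup>2"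
    using H1_weak_imp_L2_weak[OF weak] H1_L2[OF V] by (intro tendsto_intros) (simp add: L2_weakly_def)
  then show A: "(\<lambda>n. (L2_norm (w n))\<^sup>2 - (L2_norm (\<lambda>x. w n x - V x))\<^sup>2) \<longlonglongrightarrow> (L2_norm V)\<^sup>2"
    by (simp add: L2_norm_diff_sq[OF H1_L2[OF w] H1_L2[OF V]] L2_inner_self)
  have H: "(L2_norm u)\<^sup>2 + (grad_norm u)\<^sup>2 = Re (H1_inner u u)" if "u \<in> H1" for u
    using H1_inner_self[OF that] by simp
  have comm: "H1_inner V u = cnj (H1_inner u V)" if u: "u \<in> H1" for u
  proof -
    obtain F G where F: "has_L2_fourier u F" and G: "has_L2_fourier V G"
      using L2_fourier_exists H1_L2[OF u] H1_L2[OF V] by blast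
    show ?thesis unfolding H1_inner_fourier[OF V G u F] H1_inner_fourier[OF u F V G] by (rule L2_inner_commute)
  qed
  have d: "(L2_norm (w n))\<^sup>2 + (grad_norm (w n))\<^sup>2 - ((L2_norm (\<lambda>x. w n x - V x))\<^sup>2 + (grad_norm (\<lambda>x. w n x - V x))\<^sup>2)
      = 2 * Re (H1_inner (w n) V) - Re (H1_inner V V)" for n
  proof -
    have r: "(\<lambda>x. w n x - V x) \<in> H1" by (rule H1_diff[OF w V])
    have "H1_inner (\<lambda>x. w n x - V x) (\<lambda>x. w n x - V x) = H1_inner (w n) (\<lambda>x. w n x - V x) - H1_inner V (\<lambda>x. w n x - V x)"
      by (rule H1_inner_diff_left[OF w V r])
    moreover have "H1_inner V (\<lambda>x. w n x - V x) = cnj (H1_inner (w n) V - H1_inner V V)"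
      unfolding comm[OF r] H1_inner_diff_left[OF w V V] ..
    moreover have "Re (H1_inner (w n) (\<lambda>x. w n x - V x)) = Re (H1_inner (w n) (w n)) - Re (H1_inner (w n) V)"
    proof -
      obtain F where F: "has_L2_fourier (w n) F" using L2_fourier_exists[OF H1_L2[OF w]] by blast
      obtain G where G: "has_L2_fourier V G" using L2_fourier_exists[OF H1_L2[OF V]] by blast
      have "H1_inner (w n) (\<lambda>x. w n x - V x) = L2_inner (h1_mult F) (\<lambda>\<xi>. of_real (h1_weight \<xi>) * F \<xi> - of_real (h1_weight \<xi>) * G \<xi>)"
        unfolding H1_inner_fourier[OF w F r has_L2_fourier_diff[OF F G]] by (simp add: right_diff_distrib)
      also have "\<dots> = H1_inner (w n) (w n) - H1_inner (w n) V"
        unfolding H1_inner_fourier[OF w F w F] H1_inner_fourier[OF w F V G]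
        by (intro L2_inner_diff_right H1_fourier_D(1)[OF w F] H1_fourier_D(1)[OF V G])
      finally show ?thesis by simp
    qed
    ultimately show ?thesis unfolding H[OF w] H[OF r] by simp
  qed
  have "(\<lambda>n. 2 * Re (H1_inner (w n) V) - Re (H1_inner V V)) \<longlonglongrightarrow> 2 * Re (H1_inner V V) - Re (H1_inner V V)"
    using weak V by (intro tendsto_intros) (simp add: H1_weakly_converges_def)
  then have "(\<lambda>n. (L2_norm (w n))\<^sup>2 + (grad_norm (w n))\<^sup>2 - ((L2_norm (\<lambda>x. w n x - V x))\<^sup>2 + (grad_norm (\<lambda>x. w n x - V x))\<^sup>2)) \<longlonglongrightarrow> (L2_norm V)\<^sup>2 + (grad_norm V)\<^sup>2"
    unfolding d H[OF V] by simp
  from tendsto_diff[OF this A]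
  show "(\<lambda>n. (grad_norm (w n))\<^sup>2 - (grad_norm (\<lambda>x. w n x - V x))\<^sup>2) \<longlonglongrightarrow> (grad_norm V)\<^sup>2"
    by (simp add: algebra_simps)
qed

section \<open>Weak limits of translates\<close>

definition weak_limits :: "(nat \<Rightarrow> real^2 \<Rightarrow> complex) \<Rightarrow> (real^2 \<Rightarrow> complex) set" where
  "weak_limits w = {U. \<exists>y r. strict_mono (r :: nat \<Rightarrow> nat) \<and> H1_weakly_converges (\<lambda>n. translate (y n) (w (r n))) U}"

text \<open>
  If the quartic functional stays above \<open>e\<close>, then so does a multiple of the \<open>L\<^sup>4\<close> norm, and
  for a suitable frequency \<open>A\<close> the high part cannot account for it. So the low part is large
  at some point \<open>x n\<close>. That value is the inner product of the function translated by \<open>x n\<close>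
  with one fixed kernel, and the weak limit inherits the lower bound. The constant depends on
  \<open>e\<close> and \<open>K\<close> but not on the sequence, which is what bounds the number of extractions.
\<close>

lemma non_vanishing:
  assumes \<gamma>: "\<gamma> > 0" and e: "e > 0" and K0: "0 \<le> K"
  obtains c where "c > 0" "\<And>w. (\<And>n::nat. w n \<in> H1) \<Longrightarrow> (\<And>n. L2_norm (w n) \<le> K) \<Longrightarrow> (\<And>n. grad_norm (w n) \<le> K)
     \<Longrightarrow> (\<And>n. quartic \<gamma> (w n) \<ge> e) \<Longrightarrow> \<exists>U\<in>weak_limits w. L2_norm U \<ge> c"
proof -
  \<comment> \<open>\<open>e1\<close> is the resulting lower bound for the norm of \<open>\<bar>u\<bar>\<^sup>2\<close>; the choices of \<open>A\<close> and \<open>M\<close> below make the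
    contributions of the high and the low part less than \<open>e1 / 2\<close> each\<close>
  define e1 where "e1 = sqrt (e / (1 + \<gamma>))"
  have e1: "e1 > 0" using e \<gamma> by (simp add: e1_def)
  define A where "A = 64 * K\<^sup>2 / (e1 / 2) + 1"
  have A: "A > 0" "64 * K\<^sup>2 / A < e1 / 2" unfolding A_def by (rule quotient_small; use e1 in simp)+
  define M where "M = e1 / (8 * (K + 1))"
  have M: "M > 0" "M * K < e1 / 4"
  proof -
    show *: "M > 0" using e1 K0 by (simp add: M_def)
    have "e1 / (8 * t) * t = e1 / 8" if "t > 0" for t using that by simp
    from this[of "K + 1"] have "M * (K + 1) = e1 / 8" unfolding M_def using K0 by linarith
    then show "M * K < e1 / 4" using * e1 by (simp add: distrib_left)
  qed
  obtain k where k: "has_L2_fourier k (\<lambda>\<xi>. cis (- 2 * pi * (\<xi> \<bullet> 0)) * indicator (ball 0 A) \<xi>)" by (rule low_pass_kernel)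
  have kL: "k \<in> L2" using has_L2_fourierD(1)[OF k] .
  define c where "c = M / (L2_norm k + 1)"
  have kpos: "L2_norm k + 1 > 0" using L2_norm_nonneg[of k] by linarith
  have c: "c > 0" using M kpos by (simp add: c_def)
  have "\<exists>U\<in>weak_limits w. L2_norm U \<ge> c"
    if w: "\<And>n::nat. w n \<in> H1" and K: "\<And>n. L2_norm (w n) \<le> K" "\<And>n. grad_norm (w n) \<le> K" and q: "\<And>n. quartic \<gamma> (w n) \<ge> e" for w
  proof -
    have "\<exists>x. cmod (L2_inner (translate x (w n)) k) > M" for n
    proof (rule ccontr)
      assume "\<not> ?thesis"
      then have low_le: "cmod (L2_inner (translate x (w n)) k) \<le> M" for x by (simp add: not_less)
      obtain F where F: "has_L2_fourier (w n) F" using L2_fourier_exists[OF H1_L2[OF w]] by blast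
      have "low_pass A F x = L2_inner (translate x (w n)) k" for x
      proof -
        have "L2_inner (translate x (w n)) k = low_pass A (\<lambda>\<xi>. cis (2 * pi * (\<xi> \<bullet> x)) * F \<xi>) 0"
          by (rule low_pass_inner[OF has_L2_fourier_shift[OF F] k, symmetric])
        also have "\<dots> = low_pass A F x"
          unfolding low_pass_def fourier_integral_def trunc_def
          by (rule Bochner_Integration.integral_cong) (auto simp: inner_commute)
        finally show ?thesis by simp
      qed
      then have lM: "cmod (low_pass A F x) \<le> M" for x using low_le by simp
      note l = low_pass_L4[OF F lM]
      note h = high_pass_L4[OF F H1_fourier_D(4)[OF w F] A(1), folded weak_gradient_norm[OF w F]]
      have "L2_norm (abs_sq (w n)) \<le> L2_norm (\<lambda>x. of_real 2 * abs_sq (low_pass A F) x + of_real 2 * abs_sq (\<lambda>x. w n x - low_pass A F x) x)"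
      proof (rule L2_norm_mono[OF H1_abs_sq(1)[OF w]])
        show "(\<lambda>x. of_real 2 * abs_sq (low_pass A F) x + of_real 2 * abs_sq (\<lambda>x. w n x - low_pass A F x) x) \<in> L2"
          by (intro L2_add L2_cmult l(1) h(1))
        fix x
        have "(cmod (w n x))\<^sup>2 \<le> 2 * (cmod (low_pass A F x))\<^sup>2 + 2 * (cmod (w n x - low_pass A F x))\<^sup>2"
          using cmod_add_sq_le[of "low_pass A F x" "w n x - low_pass A F x"] by simp
        also have "\<dots> = norm (complex_of_real (2 * (cmod (low_pass A F x))\<^sup>2 + 2 * (cmod (w n x - low_pass A F x))\<^sup>2))"
          unfolding norm_of_real by simp
        finally show "cmod (abs_sq (w n) x) \<le> cmod (of_real 2 * abs_sq (low_pass A F) x + of_real 2 * abs_sq (\<lambda>x. w n x - low_pass A F x) x)"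
          unfolding norm_abs_sq unfolding abs_sq_def by (simp only: of_real_add of_real_mult)
      qed
      also have "\<dots> \<le> L2_norm (\<lambda>x. of_real 2 * abs_sq (low_pass A F) x) + L2_norm (\<lambda>x. of_real 2 * abs_sq (\<lambda>x. w n x - low_pass A F x) x)"
        by (intro L2_norm_triangle L2_cmult l(1) h(1))
      also have "\<dots> = 2 * L2_norm (abs_sq (low_pass A F)) + 2 * L2_norm (abs_sq (\<lambda>x. w n x - low_pass A F x))"
        unfolding L2_norm_cmult norm_of_real by simp
      also have "\<dots> < e1"
      proof -
        have "L2_norm (abs_sq (low_pass A F)) \<le> M * K"
          using M K(1)[of n] by (intro order_trans[OF l(2)] mult_left_mono) auto
        moreover have "L2_norm (abs_sq (\<lambda>x. w n x - low_pass A F x)) \<le> 32 * (K\<^sup>2 / A)"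
          using A K(2)[of n] by (intro order_trans[OF h(2)] mult_left_mono divide_right_mono power_mono) auto
        moreover have "64 * (K\<^sup>2 / A) = 64 * K\<^sup>2 / A" by simp
        ultimately show ?thesis using M(2) A(2) by linarith
      qed
      finally have "(L2_norm (abs_sq (w n)))\<^sup>2 < e1\<^sup>2" by (intro power_strict_mono) auto
      also have "e1\<^sup>2 = e / (1 + \<gamma>)" using e \<gamma> by (simp add: e1_def)
      finally have "(1 + \<gamma>) * (L2_norm (abs_sq (w n)))\<^sup>2 < e" using \<gamma> by (simp add: less_divide_eq mult.commute)
      then show False using quartic_le[OF \<gamma> w[of n]] q[of n] by linarith
    qed
    then obtain x where x: "\<And>n. cmod (L2_inner (translate (x n) (w n)) k) > M" by metis
    have "(L2_norm (translate (x n) (w n)))\<^sup>2 + (grad_norm (translate (x n) (w n)))\<^sup>2 \<le> K\<^sup>2 + K\<^sup>2" for n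
      unfolding L2_norm_shift[OF H1_L2[OF w]] H1_shift(2)[OF w] using K by (intro add_mono power_mono) auto
    then obtain r U where r: "strict_mono r" and U: "H1_weakly_converges (\<lambda>n. translate (x (r n)) (w (r n))) U"
      using H1_weak_compactness[of "\<lambda>n. translate (x n) (w n)" "K\<^sup>2 + K\<^sup>2"] H1_shift(1)[OF w] by blast
    have UL: "U \<in> L2" using U by (simp add: H1_weakly_converges_def H1_L2)
    have "(\<lambda>n. cmod (L2_inner (translate (x (r n)) (w (r n))) k)) \<longlonglongrightarrow> cmod (L2_inner U k)"
      using H1_weak_imp_L2_weak[OF U] kL by (intro tendsto_norm) (simp add: L2_weakly_def)
    then have "M \<le> cmod (L2_inner U k)"
      by (rule LIMSEQ_le_const) (use less_imp_le[OF x] in blast)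
    also have "\<dots> \<le> L2_norm U * L2_norm k" by (rule L2_Cauchy_Schwarz[OF UL kL])
    also have "\<dots> \<le> L2_norm U * (L2_norm k + 1)" by (intro mult_left_mono) auto
    finally have "c \<le> L2_norm U" using kpos by (simp add: c_def divide_le_eq)
    moreover have "U \<in> weak_limits w" using r U by (auto simp: weak_limits_def)
    ultimately show ?thesis by blast
  qed
  then show thesis using that c by blast
qed

section \<open>Profiles of the remainder\<close>

lemma H1_weakly_subseq:
  assumes "H1_weakly_converges u V" "strict_mono s" shows "H1_weakly_converges (\<lambda>n. u (s n)) V"
  using assms LIMSEQ_subseq_LIMSEQ[OF _ assms(2)] unfolding H1_weakly_converges_def by (auto simp: o_def)

lemma H1_weak_limit_zero:
  assumes "H1_weakly_converges u U" and "\<And>g. g \<in> H1 \<Longrightarrow> (\<lambda>n. H1_inner (u n) g) \<longlonglongrightarrow> 0"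
  shows "L2_norm U = 0"
proof -
  have U: "U \<in> H1" using assms(1) by (simp add: H1_weakly_converges_def)
  have "(\<lambda>n. H1_inner (u n) U) \<longlonglongrightarrow> H1_inner U U" using assms(1) U by (simp add: H1_weakly_converges_def)
  then have "H1_inner U U = 0" using assms(2)[OF U] LIMSEQ_unique by blast
  then have "complex_of_real ((L2_norm U)\<^sup>2 + (grad_norm U)\<^sup>2) = 0" unfolding H1_inner_self[OF U] .
  then have "(L2_norm U)\<^sup>2 + (grad_norm U)\<^sup>2 = 0" by (simp only: of_real_eq_0_iff)
  then show ?thesis by (simp add: sum_power2_eq_zero_iff)
qed

text \<open>
  After truncation the two supports are eventually disjoint.
\<close>

lemma translate_L2_weakly_null:
  assumes p: "p \<in> L2" and g: "g \<in> L2" and y: "filterlim (\<lambda>n. norm (y n)) at_top sequentially"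
  shows "(\<lambda>n::nat. L2_inner (translate (y n) p) g) \<longlonglongrightarrow> 0"
proof (rule LIMSEQ_I)
  fix e :: real assume e: "e > 0"
  define d where "d R = L2_norm (\<lambda>x. p x - trunc (real R) p x) * L2_norm g + L2_norm p * L2_norm (\<lambda>x. g x - trunc (real R) g x)" for R
  have "d \<longlonglongrightarrow> 0"
    unfolding d_def by (intro tendsto_add_zero tendsto_mult_left_zero tendsto_mult_right_zero trunc_nat_tendsto p g)
  then have "\<forall>\<^sub>F R in sequentially. d R < e" using e by (intro order_tendstoD(2)[of _ 0]) auto
  then obtain R where R: "d R < e" by (auto simp: eventually_sequentially)
  have "\<forall>\<^sub>F n in sequentially. 2 * real R < norm (y n)" using y by (rule filterlim_at_top_dense[THEN iffD1, rule_format])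
  then obtain N where N: "\<And>n. n \<ge> N \<Longrightarrow> 2 * real R < norm (y n)" by (auto simp: eventually_sequentially)
  have "norm (L2_inner (translate (y n) p) g - 0) < e" if n: "n \<ge> N" for n
  proof -
    define p1 where "p1 = trunc (real R) p"
    define g1 where "g1 = trunc (real R) g"
    have L: "p1 \<in> L2" "g1 \<in> L2" unfolding p1_def g1_def by (intro trunc_L2 p g)+
    have tL: "translate (y n) p \<in> L2" "translate (y n) p1 \<in> L2" by (intro L2_shift p L)+
    have "translate (y n) p1 x * cnj (g1 x) = 0" for x
    proof (rule ccontr)
      assume "translate (y n) p1 x * cnj (g1 x) \<noteq> 0"
      then have "norm (x + y n) < real R" "norm x < real R" by (auto simp: p1_def g1_def trunc_def indicator_def split: if_splits)
      then show False using N[OF n] norm_triangle_ineq4[of "x + y n" x] by simp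
    qed
    then have "(\<lambda>x. translate (y n) p1 x * cnj (g1 x)) = (\<lambda>x. 0)" by (rule ext)
    then have "L2_inner (translate (y n) p1) g1 = 0" unfolding L2_inner_def by simp
    moreover have "L2_inner (translate (y n) p) g = L2_inner (\<lambda>x. p (x + y n) - p1 (x + y n)) g + (L2_inner (translate (y n) p1) (\<lambda>x. g x - g1 x) + L2_inner (translate (y n) p1) g1)"
      by (simp add: L2_inner_diff_left[OF tL g] L2_inner_diff_right[OF g L(2) tL(2)])
    ultimately have "norm (L2_inner (translate (y n) p) g) \<le> norm (L2_inner (\<lambda>x. p (x + y n) - p1 (x + y n)) g) + norm (L2_inner (translate (y n) p1) (\<lambda>x. g x - g1 x))"
      using norm_triangle_ineq by simp
    also have "\<dots> \<le> L2_norm (\<lambda>x. p (x + y n) - p1 (x + y n)) * L2_norm g + L2_norm (translate (y n) p1) * L2_norm (\<lambda>x. g x - g1 x)"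
      by (intro add_mono L2_Cauchy_Schwarz L2_diff tL g L)
    also have "L2_norm (\<lambda>x. p (x + y n) - p1 (x + y n)) = L2_norm (\<lambda>x. p x - p1 x)"
      using L2_norm_shift[OF L2_diff[OF p L(1)]] by simp
    also have "L2_norm (translate (y n) p1) = L2_norm p1" by (rule L2_norm_shift[OF L(1)])
    also have "L2_norm (\<lambda>x. p x - p1 x) * L2_norm g + L2_norm p1 * L2_norm (\<lambda>x. g x - g1 x) \<le> d R"
      unfolding d_def p1_def g1_def
      by (intro add_left_mono mult_right_mono L2_norm_mono trunc_L2 p) (auto simp: trunc_def indicator_def)
    finally show ?thesis using R by simp
  qed
  then show "\<exists>N. \<forall>n\<ge>N. norm (L2_inner (translate (y n) p) g - 0) < e" by blast
qed

text \<open>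
  Translations act on transforms by phases, which commute with the weight, so the \<open>H\<^sup>1\<close> inner
  product is an \<open>L\<^sup>2\<close> inner product of translated functions.
\<close>

lemma translate_H1_weakly_null:
  assumes V: "V \<in> H1" and g: "g \<in> H1" and y: "filterlim (\<lambda>n. norm (y n)) at_top sequentially"
  shows "(\<lambda>n::nat. H1_inner (translate (y n) V) g) \<longlonglongrightarrow> 0"
proof -
  obtain F where F: "has_L2_fourier V F" using L2_fourier_exists[OF H1_L2[OF V]] by blast
  obtain G where G: "has_L2_fourier g G" using L2_fourier_exists[OF H1_L2[OF g]] by blast
  obtain p where p: "has_L2_fourier p (h1_mult F)" using L2_fourier_surj[OF H1_fourier_D(1)[OF V F]] by blast
  obtain k where k: "has_L2_fourier k (h1_mult G)" using L2_fourier_surj[OF H1_fourier_D(1)[OF g G]] by blast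
  have "H1_inner (translate (y n) V) g = L2_inner (translate (y n) p) k" for n
    unfolding H1_inner_fourier[OF H1_shift(1)[OF V] has_L2_fourier_shift[OF F] g G]
      has_L2_fourier_inner[OF has_L2_fourier_shift[OF p] k, symmetric] by (simp add: mult_ac)
  then show ?thesis using translate_L2_weakly_null[OF has_L2_fourierD(1)[OF p] has_L2_fourierD(1)[OF k] y] by simp
qed

text \<open>
  Moving the translation to the test function gives a strongly convergent sequence of test
  functions.
\<close>

lemma translate_bounded_weakly_null:
  assumes u: "\<And>n::nat. u n \<in> H1" and weak: "\<And>g. g \<in> H1 \<Longrightarrow> (\<lambda>n. H1_inner (u n) g) \<longlonglongrightarrow> 0"
    and K: "\<And>n. L2_norm (u n) \<le> K" "\<And>n. grad_norm (u n) \<le> K" and y: "y \<longlonglongrightarrow> z" and g: "g \<in> H1"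
  shows "(\<lambda>n. H1_inner (translate (y n) (u n)) g) \<longlonglongrightarrow> 0"
proof -
  obtain G where G: "has_L2_fourier g G" using L2_fourier_exists[OF H1_L2[OF g]] by blast
  have "\<forall>n. \<exists>F. has_L2_fourier (u n) F" by (intro allI L2_fourier_exists H1_L2 u)
  then obtain F where F: "\<And>n. has_L2_fourier (u n) (F n)" by metis
  define P where "P n \<xi> = of_real (h1_weight \<xi>) * F n \<xi>" for n \<xi>
  define H where "H \<xi> = of_real (h1_weight \<xi>) * G \<xi>" for \<xi>
  have PL: "P n \<in> L2" for n unfolding P_def[abs_def] by (rule H1_fourier_D(1)[OF u F])
  have HL: "H \<in> L2" unfolding H_def[abs_def] by (rule H1_fourier_D(1)[OF g G])
  have [measurable]: "H \<in> borel_measurable borel" using HL by auto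
  have "complex_of_real ((L2_norm (P n))\<^sup>2) = of_real ((L2_norm (u n))\<^sup>2 + (grad_norm (u n))\<^sup>2)" for n
    using H1_inner_self[OF u[of n]] H1_inner_fourier[OF u F u F, of n n] L2_inner_self[of "P n"] by (simp add: P_def[abs_def])
  then have "(L2_norm (P n))\<^sup>2 = (L2_norm (u n))\<^sup>2 + (grad_norm (u n))\<^sup>2" for n by (simp only: of_real_eq_iff)
  moreover have "(L2_norm (u n))\<^sup>2 + (grad_norm (u n))\<^sup>2 \<le> K\<^sup>2 + K\<^sup>2" for n using K by (intro add_mono power_mono) auto
  ultimately have P_le: "L2_norm (P n) \<le> sqrt (K\<^sup>2 + K\<^sup>2)" for n by (intro real_le_rsqrt) simp
  define E where "E n \<xi> = (cis (- 2 * pi * (\<xi> \<bullet> y n)) - cis (- 2 * pi * (\<xi> \<bullet> z))) * H \<xi>" for n \<xi>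
  have phase: "(\<lambda>\<xi>. cis (- 2 * pi * (\<xi> \<bullet> a)) * H \<xi>) \<in> L2" for a
    by (rule L2_mult_bounded[OF HL, where C=1]) auto
  have EL: "E n \<in> L2" for n
    using L2_diff[OF phase[of "y n"] phase[of z]] unfolding E_def[abs_def] by (simp add: left_diff_distrib)
  have E_lim: "(\<lambda>n. L2_norm (E n)) \<longlonglongrightarrow> 0"
  proof (rule L2_dominated[where h="\<lambda>\<xi>. 2 * cmod (H \<xi>)"])
    show "(\<lambda>\<xi>. 2 * cmod (H \<xi>)) \<in> L2" using HL by (rule L2_bound[where C=2]) auto
    show "cmod (E n \<xi>) \<le> 2 * cmod (H \<xi>)" for n \<xi>
      using norm_triangle_ineq4[of "cis (- 2 * pi * (\<xi> \<bullet> y n))" "cis (- 2 * pi * (\<xi> \<bullet> z))"]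
      unfolding E_def norm_mult by (intro mult_right_mono) auto
    show "AE \<xi> in lborel. (\<lambda>n. E n \<xi>) \<longlonglongrightarrow> 0"
    proof (rule AE_I2)
      fix \<xi>
      have "(\<lambda>n. - 2 * pi * (\<xi> \<bullet> y n)) \<longlonglongrightarrow> - 2 * pi * (\<xi> \<bullet> z)" by (intro tendsto_intros y)
      then have "(\<lambda>n. cis (- 2 * pi * (\<xi> \<bullet> y n))) \<longlonglongrightarrow> cis (- 2 * pi * (\<xi> \<bullet> z))" by (rule tendsto_cis)
      then have "(\<lambda>n. E n \<xi>) \<longlonglongrightarrow> (cis (- 2 * pi * (\<xi> \<bullet> z)) - cis (- 2 * pi * (\<xi> \<bullet> z))) * H \<xi>"
        unfolding E_def by (intro tendsto_mult_right tendsto_diff tendsto_const)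
      then show "(\<lambda>n. E n \<xi>) \<longlonglongrightarrow> 0" by simp
    qed
  qed (use EL in auto)
  have eq: "H1_inner (translate (y n) (u n)) g = H1_inner (u n) (translate (- z) g) + L2_inner (P n) (E n)" for n
  proof -
    have "H1_inner (translate (y n) (u n)) g = L2_inner (P n) (\<lambda>\<xi>. cis (- 2 * pi * (\<xi> \<bullet> y n)) * H \<xi>)"
      unfolding H1_inner_fourier[OF H1_shift(1)[OF u] has_L2_fourier_shift[OF F] g G] L2_inner_def
      by (rule Bochner_Integration.integral_cong) (auto simp: P_def H_def cis_cnj mult_ac)
    also have "(\<lambda>\<xi>. cis (- 2 * pi * (\<xi> \<bullet> y n)) * H \<xi>) = (\<lambda>\<xi>. cis (- 2 * pi * (\<xi> \<bullet> z)) * H \<xi> + E n \<xi>)"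
      by (auto simp: E_def left_diff_distrib)
    also have "L2_inner (P n) \<dots> = L2_inner (P n) (\<lambda>\<xi>. cis (- 2 * pi * (\<xi> \<bullet> z)) * H \<xi>) + L2_inner (P n) (E n)"
      by (rule L2_inner_add_right[OF phase EL PL])
    also have "L2_inner (P n) (\<lambda>\<xi>. cis (- 2 * pi * (\<xi> \<bullet> z)) * H \<xi>) = H1_inner (u n) (translate (- z) g)"
      unfolding H1_inner_fourier[OF u F H1_shift(1)[OF g] has_L2_fourier_shift[OF G]] L2_inner_def
      by (rule Bochner_Integration.integral_cong) (auto simp: P_def H_def mult_ac)
    finally show ?thesis .
  qed
  have "(\<lambda>n. L2_inner (P n) (E n)) \<longlonglongrightarrow> 0"
  proof (rule Lim_null_comparison)
    show "(\<lambda>n. sqrt (K\<^sup>2 + K\<^sup>2) * L2_norm (E n)) \<longlonglongrightarrow> 0" by (rule tendsto_mult_right_zero[OF E_lim])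
    have "norm (L2_inner (P n) (E n)) \<le> sqrt (K\<^sup>2 + K\<^sup>2) * L2_norm (E n)" for n
      by (rule order_trans[OF L2_Cauchy_Schwarz[OF PL EL] mult_right_mono[OF P_le L2_norm_nonneg]])
    then show "\<forall>\<^sub>F n in sequentially. norm (L2_inner (P n) (E n)) \<le> sqrt (K\<^sup>2 + K\<^sup>2) * L2_norm (E n)" by simp
  qed
  from tendsto_add[OF weak[OF H1_shift(1)[OF g, of "- z"]] this] show ?thesis unfolding eq by simp
qed

lemma convergent_subseq_or_unbounded:
  fixes y :: "nat \<Rightarrow> real^2"
  obtains s z where "strict_mono (s :: nat \<Rightarrow> nat)" "(\<lambda>n. y (s n)) \<longlonglongrightarrow> z" | "filterlim (\<lambda>n. norm (y n)) at_top sequentially"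
proof (cases "filterlim (\<lambda>n. norm (y n)) at_top sequentially")
  case False
  then obtain B where "\<not> (\<forall>\<^sub>F n in sequentially. B \<le> norm (y n))" by (auto simp: filterlim_at_top)
  then have "\<exists>\<^sub>F n in sequentially. norm (y n) \<le> B"
    unfolding not_eventually by (rule frequently_elim1) simp
  then have "infinite {n. norm (y n) \<le> B}"
    unfolding cofinite_eq_sequentially[symmetric] frequently_cofinite .
  then obtain s0 :: "nat \<Rightarrow> nat" where s0: "strict_mono s0" "\<And>n. norm (y (s0 n)) \<le> B"
    using infinite_enumerate by blast
  have "bounded (range (\<lambda>n. y (s0 n)))" using s0(2) by (auto intro: boundedI)
  from bounded_imp_convergent_subsequence[OF this] obtain z t where t: "strict_mono t" "((\<lambda>n. y (s0 n)) \<circ> t) \<longlonglongrightarrow> z" by blast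
  show thesis using that(1)[of "s0 \<circ> t" z] strict_mono_o[OF s0(1) t(1)] t(2) by (simp add: o_def)
qed (rule that(2))

text \<open>
  If the translations stay bounded along a subsequence, the translated remainders tend weakly
  to zero, as the remainders do. If they tend to infinity, the translates of \<open>V\<close> disappear
  weakly, and the remainder has the same weak limit as the original sequence.
\<close>

lemma weak_limits_remainder:
  assumes weak: "H1_weakly_converges w V" and K: "\<And>n. L2_norm (\<lambda>x. w n x - V x) \<le> K" "\<And>n. grad_norm (\<lambda>x. w n x - V x) \<le> K"
    and U: "U \<in> weak_limits (\<lambda>n x. w n x - V x)"
  shows "U \<in> weak_limits w \<or> L2_norm U = 0"
proof -
  have w: "w n \<in> H1" and V: "V \<in> H1" for n using weak by (auto simp: H1_weakly_converges_def)
  obtain y r where r: "strict_mono r" and Uw: "H1_weakly_converges (\<lambda>n x. w (r n) (x + y n) - V (x + y n)) U"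
    using U by (auto simp: weak_limits_def)
  have UH: "U \<in> H1" using Uw by (simp add: H1_weakly_converges_def)
  have rem: "(\<lambda>x. w n x - V x) \<in> H1" for n by (rule H1_diff[OF w V])
  have rem_weak: "(\<lambda>n. H1_inner (\<lambda>x. w n x - V x) g) \<longlonglongrightarrow> 0" if "g \<in> H1" for g
    unfolding H1_inner_diff_left[OF w V that] using weak that by (intro LIM_zero) (simp add: H1_weakly_converges_def)
  show ?thesis
  proof (rule convergent_subseq_or_unbounded[of y])
    fix s z assume s: "strict_mono s" "(\<lambda>n. y (s n)) \<longlonglongrightarrow> z"
    have rs: "strict_mono (\<lambda>n. r (s n))" using strict_mono_o[OF r s(1)] by (simp add: o_def)
    have sub: "(\<lambda>n. H1_inner (\<lambda>x. w (r (s n)) x - V x) g) \<longlonglongrightarrow> 0" if "g \<in> H1" for g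
      using LIMSEQ_subseq_LIMSEQ[OF rem_weak[OF that] rs] by (simp add: o_def)
    have "(\<lambda>n. H1_inner (\<lambda>x. w (r (s n)) (x + y (s n)) - V (x + y (s n))) g) \<longlonglongrightarrow> 0" if "g \<in> H1" for g
      using translate_bounded_weakly_null[of "\<lambda>n x. w (r (s n)) x - V x", OF rem sub K s(2) that] .
    then have "L2_norm U = 0" by (rule H1_weak_limit_zero[OF H1_weakly_subseq[OF Uw s(1)]])
    then show ?thesis by simp
  next
    assume y: "filterlim (\<lambda>n. norm (y n)) at_top sequentially"
    have "H1_weakly_converges (\<lambda>n. translate (y n) (w (r n))) U"
      unfolding H1_weakly_converges_def
    proof (intro conjI allI ballI UH)
      show tw: "translate (y n) (w (r n)) \<in> H1" for n by (rule H1_shift(1)[OF w])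
      fix g assume g: "g \<in> H1"
      have tV: "translate (y n) V \<in> H1" for n by (rule H1_shift(1)[OF V])
      have "(\<lambda>n. H1_inner (\<lambda>x. w (r n) (x + y n) - V (x + y n)) g) \<longlonglongrightarrow> H1_inner U g"
        using Uw g by (simp add: H1_weakly_converges_def)
      from tendsto_add[OF this translate_H1_weakly_null[OF V g y]]
      show "(\<lambda>n. H1_inner (translate (y n) (w (r n))) g) \<longlonglongrightarrow> H1_inner U g"
        unfolding H1_inner_diff_left[OF tw tV g] by simp
    qed
    then show ?thesis using r by (auto simp: weak_limits_def)
  qed
qed

lemma weak_limits_subseq:
  assumes "strict_mono s" shows "weak_limits (\<lambda>n. translate (z n) (w (s n))) \<subseteq> weak_limits w"
proof
  fix U assume "U \<in> weak_limits (\<lambda>n. translate (z n) (w (s n)))"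
  then obtain y r where r: "strict_mono r" "H1_weakly_converges (\<lambda>n x. w (s (r n)) (x + y n + z (r n))) U"
    by (auto simp: weak_limits_def)
  have "strict_mono (\<lambda>n. s (r n))" using strict_mono_o[OF assms r(1)] by (simp add: o_def)
  then show "U \<in> weak_limits w" unfolding weak_limits_def using r(2)
    by (intro CollectI exI[of _ "\<lambda>n. y n + z (r n)"] exI[of _ "\<lambda>n. s (r n)"]) (simp add: add.assoc)
qed

section \<open>Repeated extraction of profiles\<close>

text \<open>
  The state of the extraction: \<open>w\<close> is a remainder obtained from \<open>v\<close>, its quartic functional,
  gradient energy and mass have the limits \<open>q\<close>, \<open>A\<close> and \<open>B\<close>, and its nontrivial profiles are
  profiles of \<open>v\<close>.
\<close>

definition tracks :: "real \<Rightarrow> (nat \<Rightarrow> real^2 \<Rightarrow> complex) \<Rightarrow> (nat \<Rightarrow> real^2 \<Rightarrow> complex) \<Rightarrow> real \<Rightarrow> real \<Rightarrow> real \<Rightarrow> bool" where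
  "tracks \<gamma> v w q A B \<longleftrightarrow> (\<forall>n. w n \<in> H1) \<and> (\<lambda>n. quartic \<gamma> (w n)) \<longlonglongrightarrow> q \<and> (\<lambda>n. (grad_norm (w n))\<^sup>2) \<longlonglongrightarrow> A
     \<and> (\<lambda>n. (L2_norm (w n))\<^sup>2) \<longlonglongrightarrow> B \<and> (\<forall>U\<in>weak_limits w. U \<in> weak_limits v \<or> L2_norm U = 0)"

lemma tracks_nonneg:
  assumes "tracks \<gamma> v w q A B" shows "0 \<le> A" "0 \<le> B"
  using assms by (auto simp: tracks_def intro: LIMSEQ_le_const[of _ _ 0])

lemma tracks_shift:
  assumes t: "tracks \<gamma> v w q A B" and s: "strict_mono s" shows "tracks \<gamma> v (\<lambda>n. translate (z n) (w (s n))) q A B"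
proof -
  have w: "w n \<in> H1" for n using t by (simp add: tracks_def)
  show ?thesis unfolding tracks_def
  proof (intro conjI allI ballI)
    show "translate (z n) (w (s n)) \<in> H1" for n by (rule H1_shift(1)[OF w])
    have l: "(\<lambda>n. quartic \<gamma> (w n)) \<longlonglongrightarrow> q" "(\<lambda>n. (grad_norm (w n))\<^sup>2) \<longlonglongrightarrow> A" "(\<lambda>n. (L2_norm (w n))\<^sup>2) \<longlonglongrightarrow> B"
      using t by (simp_all add: tracks_def)
    show "(\<lambda>n. quartic \<gamma> (translate (z n) (w (s n)))) \<longlonglongrightarrow> q"
      using LIMSEQ_subseq_LIMSEQ[OF l(1) s] by (simp add: quartic_shift[OF w] o_def)
    show "(\<lambda>n. (grad_norm (translate (z n) (w (s n))))\<^sup>2) \<longlonglongrightarrow> A"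
      using LIMSEQ_subseq_LIMSEQ[OF l(2) s] by (simp add: H1_shift(2)[OF w] o_def)
    show "(\<lambda>n. (L2_norm (translate (z n) (w (s n))))\<^sup>2) \<longlonglongrightarrow> B"
      using LIMSEQ_subseq_LIMSEQ[OF l(3) s] by (simp add: L2_norm_shift[OF H1_L2[OF w]] o_def)
    fix U assume "U \<in> weak_limits (\<lambda>n. translate (z n) (w (s n)))"
    then show "U \<in> weak_limits v \<or> L2_norm U = 0" using weak_limits_subseq[OF s, where z=z and w=w] t by (auto simp: tracks_def)
  qed
qed

lemma convergent_sq_bounded:
  fixes a :: "nat \<Rightarrow> real" assumes "(\<lambda>n. (a n)\<^sup>2) \<longlonglongrightarrow> L"
  obtains K where "\<And>n. a n \<le> K"
proof -
  have "Bseq (\<lambda>n. (a n)\<^sup>2)" using assms by (intro convergent_imp_Bseq convergentI)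
  then obtain K where K: "\<And>n. norm ((a n)\<^sup>2) \<le> K" by (auto simp: Bseq_def)
  have "a n \<le> sqrt K" for n using K[of n] by (intro real_le_rsqrt) simp
  then show thesis by (rule that)
qed

lemma extract_profile:
  assumes \<gamma>: "\<gamma> > 0" and t: "tracks \<gamma> v w q A B" and U: "U \<in> weak_limits w"
  obtains w' where "tracks \<gamma> v w' (q - quartic \<gamma> U) (A - (grad_norm U)\<^sup>2) (B - (L2_norm U)\<^sup>2)"
proof -
  obtain y r where r: "strict_mono r" and weak: "H1_weakly_converges (\<lambda>n. translate (y n) (w (r n))) U"
    using U by (auto simp: weak_limits_def)
  define u where "u n = translate (y n) (w (r n))" for n
  define w' where "w' n = (\<lambda>x. u n x - U x)" for n
  have tu: "tracks \<gamma> v u q A B" unfolding u_def by (rule tracks_shift[OF t r])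
  have weak': "H1_weakly_converges u U" using weak by (simp add: u_def[abs_def])
  have u: "u n \<in> H1" and UH: "U \<in> H1" for n using weak' by (auto simp: H1_weakly_converges_def)
  have l: "(\<lambda>n. quartic \<gamma> (u n)) \<longlonglongrightarrow> q" "(\<lambda>n. (grad_norm (u n))\<^sup>2) \<longlonglongrightarrow> A" "(\<lambda>n. (L2_norm (u n))\<^sup>2) \<longlonglongrightarrow> B"
    using tu by (simp_all add: tracks_def)
  note split = norm_splitting[OF weak', folded w'_def]
  have B': "(\<lambda>n. (L2_norm (w' n))\<^sup>2) \<longlonglongrightarrow> B - (L2_norm U)\<^sup>2"
    using tendsto_diff[OF l(3) split(1)] by simp
  have A': "(\<lambda>n. (grad_norm (w' n))\<^sup>2) \<longlonglongrightarrow> A - (grad_norm U)\<^sup>2"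
    using tendsto_diff[OF l(2) split(2)] by simp
  obtain K1 where K1: "\<And>n. L2_norm (w' n) \<le> K1" using convergent_sq_bounded[OF B'] by blast
  obtain K2 where K2: "\<And>n. grad_norm (w' n) \<le> K2" using convergent_sq_bounded[OF A'] by blast
  have K: "L2_norm (w' n) \<le> max K1 K2" "grad_norm (w' n) \<le> max K1 K2" for n
    using K1[of n] K2[of n] by auto
  have q': "(\<lambda>n. quartic \<gamma> (w' n)) \<longlonglongrightarrow> q - quartic \<gamma> U"
    using tendsto_diff[OF l(1) quartic_splitting[OF \<gamma> weak' K[unfolded w'_def], folded w'_def]] by simp
  have "tracks \<gamma> v w' (q - quartic \<gamma> U) (A - (grad_norm U)\<^sup>2) (B - (L2_norm U)\<^sup>2)"
    unfolding tracks_def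
  proof (intro conjI allI ballI A' B' q')
    show "w' n \<in> H1" for n unfolding w'_def by (rule H1_diff[OF u UH])
    fix X assume "X \<in> weak_limits w'"
    then have "X \<in> weak_limits u \<or> L2_norm X = 0"
      using weak_limits_remainder[OF weak' K[unfolded w'_def], of X] by (simp add: w'_def[abs_def])
    then show "X \<in> weak_limits v \<or> L2_norm X = 0" using tu by (auto simp: tracks_def)
  qed
  then show thesis by (rule that)
qed

text \<open>
  The constant depends only on \<open>\<gamma>\<close>, \<open>e\<close> and the bound \<open>S\<close>. That bound persists, as the limits
  of mass and gradient energy only decrease during the extraction.
\<close>

lemma profile_nonzero:
  assumes \<gamma>: "\<gamma> > 0" and e: "e > 0" and S: "S \<ge> 0"
  obtains c where "c > 0" "\<And>v w q A B. tracks \<gamma> v w q A B \<Longrightarrow> A \<le> S \<Longrightarrow> B \<le> S \<Longrightarrow> q > e \<Longrightarrow> \<exists>U\<in>weak_limits w. U \<in> weak_limits v \<and> L2_norm U \<ge> c"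
proof -
  have s0: "0 \<le> sqrt (S + 1)" using S by simp
  obtain c where c: "c > 0" "\<And>w. (\<And>n::nat. w n \<in> H1) \<Longrightarrow> (\<And>n. L2_norm (w n) \<le> sqrt (S + 1)) \<Longrightarrow> (\<And>n. grad_norm (w n) \<le> sqrt (S + 1))
     \<Longrightarrow> (\<And>n. quartic \<gamma> (w n) \<ge> e) \<Longrightarrow> \<exists>U\<in>weak_limits w. L2_norm U \<ge> c"
    using non_vanishing[OF \<gamma> e s0] by blast
  have "\<exists>U\<in>weak_limits w. U \<in> weak_limits v \<and> L2_norm U \<ge> c"
    if t: "tracks \<gamma> v w q A B" and AB: "A \<le> S" "B \<le> S" and q: "q > e" for v w q A B
  proof -
    have w: "w n \<in> H1" for n using t by (simp add: tracks_def)
    have l: "(\<lambda>n. quartic \<gamma> (w n)) \<longlonglongrightarrow> q" "(\<lambda>n. (grad_norm (w n))\<^sup>2) \<longlonglongrightarrow> A" "(\<lambda>n. (L2_norm (w n))\<^sup>2) \<longlonglongrightarrow> B"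
      using t by (simp_all add: tracks_def)
    have "\<forall>\<^sub>F n in sequentially. e < quartic \<gamma> (w n)" using l(1) q by (rule order_tendstoD)
    moreover have "\<forall>\<^sub>F n in sequentially. (grad_norm (w n))\<^sup>2 < S + 1" using l(2) by (rule order_tendstoD) (use AB in simp)
    moreover have "\<forall>\<^sub>F n in sequentially. (L2_norm (w n))\<^sup>2 < S + 1" using l(3) by (rule order_tendstoD) (use AB in simp)
    ultimately have "\<forall>\<^sub>F n in sequentially. e < quartic \<gamma> (w n) \<and> (grad_norm (w n))\<^sup>2 < S + 1 \<and> (L2_norm (w n))\<^sup>2 < S + 1"
      by eventually_elim simp
    then obtain N where N: "\<And>n. n \<ge> N \<Longrightarrow> e < quartic \<gamma> (w n) \<and> (grad_norm (w n))\<^sup>2 < S + 1 \<and> (L2_norm (w n))\<^sup>2 < S + 1"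
      by (auto simp: eventually_sequentially)
    have "\<exists>U\<in>weak_limits (\<lambda>n. w (n + N)). L2_norm U \<ge> c"
    proof (rule c(2))
      fix n
      have Nn: "e < quartic \<gamma> (w (n + N)) \<and> (grad_norm (w (n + N)))\<^sup>2 < S + 1 \<and> (L2_norm (w (n + N)))\<^sup>2 < S + 1"
        by (rule N) simp
      show "w (n + N) \<in> H1" by (rule w)
      show "L2_norm (w (n + N)) \<le> sqrt (S + 1)" "grad_norm (w (n + N)) \<le> sqrt (S + 1)"
        by (rule real_le_rsqrt, use Nn in linarith)+
      show "e \<le> quartic \<gamma> (w (n + N))" using Nn by linarith
    qed
    moreover have "weak_limits (\<lambda>n. w (n + N)) \<subseteq> weak_limits w"
      using weak_limits_subseq[where s="\<lambda>n. n + N" and z="\<lambda>n. 0" and w=w] by (simp add: strict_mono_def)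
    ultimately obtain U where U: "U \<in> weak_limits w" "L2_norm U \<ge> c" by blast
    then have "U \<in> weak_limits v" using t c(1) by (auto simp: tracks_def)
    then show ?thesis using U by blast
  qed
  then show thesis using that[OF c(1)] by blast
qed

text \<open>
  Induction on the number of times that the mass \<open>c\<^sup>2\<close> fits into \<open>B\<close>: as long as \<open>q > e\<close>, a
  profile of norm at least \<open>c\<close> can be removed.
\<close>

lemma quartic_limit_le:
  assumes \<gamma>: "\<gamma> > 0" and b2: "0 \<le> b2" and C: "0 \<le> C"
    and GN: "\<And>u. u \<in> H1 \<Longrightarrow> quartic \<gamma> u \<le> C * (grad_norm u)\<^sup>2 * (L2_norm u)\<^sup>2"
    and b: "\<And>U. U \<in> weak_limits v \<Longrightarrow> (L2_norm U)\<^sup>2 \<le> b2"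
    and t: "tracks \<gamma> v w q A B"
  shows "q \<le> C * b2 * A"
proof (rule field_le_epsilon)
  fix e :: real assume e: "e > 0"
  define S where "S = max A B"
  have S0: "S \<ge> 0" using tracks_nonneg[OF t] by (simp add: S_def)
  obtain c where c: "c > 0" "\<And>v w q A B. tracks \<gamma> v w q A B \<Longrightarrow> A \<le> S \<Longrightarrow> B \<le> S \<Longrightarrow> q > e \<Longrightarrow> \<exists>U\<in>weak_limits w. U \<in> weak_limits v \<and> L2_norm U \<ge> c"
    using profile_nonzero[OF \<gamma> e S0] by blast
  have "q \<le> C * b2 * A + e" if "tracks \<gamma> v w q A B" "A \<le> S" "B \<le> S" "B \<le> real m * c\<^sup>2" for m w q A B
    using that
  proof (induction m arbitrary: w q A B)
    case (0 w q A B)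
    have A0: "0 \<le> A" using tracks_nonneg[OF 0(1)] by simp
    have "0 \<le> C * b2 * A" using C b2 A0 by simp
    show ?case
    proof (rule ccontr)
      assume "\<not> q \<le> C * b2 * A + e"
      then have "q > e" using \<open>0 \<le> C * b2 * A\<close> by linarith
      from c(2)[OF 0(1-3) this] obtain U where U: "U \<in> weak_limits w" "L2_norm U \<ge> c" by blast
      obtain w' where "tracks \<gamma> v w' (q - quartic \<gamma> U) (A - (grad_norm U)\<^sup>2) (B - (L2_norm U)\<^sup>2)"
        using extract_profile[OF \<gamma> 0(1) U(1)] by blast
      then have "0 \<le> B - (L2_norm U)\<^sup>2" by (rule tracks_nonneg)
      moreover have "0 < (L2_norm U)\<^sup>2" using U(2) c(1) by (intro zero_less_power) linarith
      ultimately show False using 0(4) by simp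
    qed
  next
    case (Suc m w q A B)
    have A0: "0 \<le> A" using tracks_nonneg[OF Suc.prems(1)] by simp
    show ?case
    proof (cases "q > e")
      case False
      have "0 \<le> C * b2 * A" using C b2 A0 by simp
      then show ?thesis using False by linarith
    next
      case True
      from c(2)[OF Suc.prems(1-3) this] obtain U where U: "U \<in> weak_limits w" "U \<in> weak_limits v" "L2_norm U \<ge> c" by blast
      obtain w' where w': "tracks \<gamma> v w' (q - quartic \<gamma> U) (A - (grad_norm U)\<^sup>2) (B - (L2_norm U)\<^sup>2)"
        using extract_profile[OF \<gamma> Suc.prems(1) U(1)] by blast
      have UH: "U \<in> H1" using U(1) by (auto simp: weak_limits_def H1_weakly_converges_def)
      have "c\<^sup>2 \<le> (L2_norm U)\<^sup>2" using U(3) c(1) by (intro power_mono) auto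
      then have "q - quartic \<gamma> U \<le> C * b2 * (A - (grad_norm U)\<^sup>2) + e"
      proof (intro Suc.IH[OF w'])
        show "A - (grad_norm U)\<^sup>2 \<le> S" using Suc.prems(2) zero_le_power2[of "grad_norm U"] by linarith
        show "B - (L2_norm U)\<^sup>2 \<le> S" using Suc.prems(3) zero_le_power2[of "L2_norm U"] by linarith
        assume "c\<^sup>2 \<le> (L2_norm U)\<^sup>2"
        then show "B - (L2_norm U)\<^sup>2 \<le> real m * c\<^sup>2" using Suc.prems(4) by (simp add: algebra_simps)
      qed
      moreover have "quartic \<gamma> U \<le> C * (grad_norm U)\<^sup>2 * b2"
        using C b[OF U(2)] by (intro order_trans[OF GN[OF UH]] mult_left_mono) auto
      ultimately show ?thesis by (simp add: algebra_simps)
    qed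
  qed
  moreover obtain m :: nat where "B / c\<^sup>2 \<le> real m" using real_arch_simple by blast
  then have "B \<le> real m * c\<^sup>2" using c(1) by (simp add: divide_le_eq)
  ultimately show "q \<le> C * b2 * A + e" using t by (simp add: S_def)
qed

text \<open>
  Otherwise apply the previous bound to the remainder after one extraction. For the extracted
  profile the estimate \<open>C \<parallel>\<nabla>U\<parallel>\<^sup>2 \<parallel>U\<parallel>\<^sup>2 < C b\<^sup>2 \<parallel>\<nabla>U\<parallel>\<^sup>2\<close> is strict, and this turns the bound
  into a contradiction.
\<close>

lemma large_profile:
  assumes \<gamma>: "\<gamma> > 0" and C: "0 < C"
    and GN: "\<And>u. u \<in> H1 \<Longrightarrow> quartic \<gamma> u \<le> C * (grad_norm u)\<^sup>2 * (L2_norm u)\<^sup>2"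
    and b: "b > 0" and q: "0 < q" "C * b\<^sup>2 * A \<le> q" and t: "tracks \<gamma> v w q A B"
  shows "\<exists>U\<in>weak_limits v. b \<le> L2_norm U"
proof (rule ccontr)
  assume "\<not> ?thesis"
  then have lt: "L2_norm U < b" if "U \<in> weak_limits v" for U using that by (auto simp: not_le)
  have S0: "max A B \<ge> 0" using tracks_nonneg[OF t] by simp
  have q2: "0 < q / 2" "q / 2 < q" using q by auto
  obtain c where c: "c > 0" "\<And>v w q' A' B'. tracks \<gamma> v w q' A' B' \<Longrightarrow> A' \<le> max A B \<Longrightarrow> B' \<le> max A B \<Longrightarrow> q' > q / 2 \<Longrightarrow> \<exists>U\<in>weak_limits w. U \<in> weak_limits v \<and> L2_norm U \<ge> c"
    using profile_nonzero[OF \<gamma> q2(1) S0] by blast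
  from c(2)[OF t _ _ q2(2)] obtain U where U: "U \<in> weak_limits w" "U \<in> weak_limits v" "L2_norm U \<ge> c" by auto
  have UH: "U \<in> H1" using U(1) by (auto simp: weak_limits_def H1_weakly_converges_def)
  obtain w' where w': "tracks \<gamma> v w' (q - quartic \<gamma> U) (A - (grad_norm U)\<^sup>2) (B - (L2_norm U)\<^sup>2)"
    using extract_profile[OF \<gamma> t U(1)] by blast
  have "(L2_norm X)\<^sup>2 \<le> b\<^sup>2" if "X \<in> weak_limits v" for X using lt[OF that] by (intro power_mono) auto
  then have "q - quartic \<gamma> U \<le> C * b\<^sup>2 * (A - (grad_norm U)\<^sup>2)"
    using C by (intro quartic_limit_le[OF \<gamma> _ _ GN _ w']) auto
  moreover have "quartic \<gamma> U < C * b\<^sup>2 * (grad_norm U)\<^sup>2"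
  proof -
    have "0 < quartic \<gamma> U" using U(3) c(1) by (intro quartic_pos[OF \<gamma> UH]) simp
    then have "0 < C * (grad_norm U)\<^sup>2 * (L2_norm U)\<^sup>2" using GN[OF UH] by linarith
    then have "0 < (grad_norm U)\<^sup>2" by (cases "grad_norm U = 0") auto
    moreover have "(L2_norm U)\<^sup>2 < b\<^sup>2" using lt[OF U(2)] by (intro power_strict_mono) auto
    ultimately have "C * (grad_norm U)\<^sup>2 * (L2_norm U)\<^sup>2 < C * (grad_norm U)\<^sup>2 * b\<^sup>2" using C by (intro mult_strict_left_mono) auto
    then show ?thesis using GN[OF UH] by (simp add: mult_ac)
  qed
  ultimately show False using q(2) by (simp add: algebra_simps)
qed

lemma limsup_subsequence:
  fixes a :: "nat \<Rightarrow> real"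
  assumes "ereal L \<le> limsup (\<lambda>n. ereal (a n))" and K: "\<And>n. a n \<le> K"
  obtains r q where "strict_mono (r :: nat \<Rightarrow> nat)" "(\<lambda>n. a (r n)) \<longlonglongrightarrow> q" "L \<le> q"
proof -
  obtain r where r: "strict_mono r" "((\<lambda>n. ereal (a n)) \<circ> r) \<longlonglongrightarrow> limsup (\<lambda>n. ereal (a n))"
    using limsup_subseq_lim[of "\<lambda>n. ereal (a n)"] by blast
  have "limsup (\<lambda>n. ereal (a n)) \<le> ereal K" by (rule Limsup_bounded) (use K in simp)
  then obtain q where q: "limsup (\<lambda>n. ereal (a n)) = ereal q" using assms(1) by (cases "limsup (\<lambda>n. ereal (a n))") auto
  have "(\<lambda>n. a (r n)) \<longlonglongrightarrow> q" using r(2) unfolding q by (simp add: o_def)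
  then show thesis using that[OF r(1)] assms(1) unfolding q by simp
qed

theorem theorem5:
  fixes \<gamma> m M :: real
    and v :: "nat \<Rightarrow> real^2 \<Rightarrow> complex"
  assumes "\<gamma> > 0"
    and "\<And>n. v n \<in> H1"
    and "\<exists>K. \<forall>n. H1_norm (v n) \<le> K"
    and "0 < m" and "0 < M"
    and "limsup (\<lambda>n. ereal ((L2_norm (weak_gradient (v n)))\<^sup>2)) \<le> ereal (M\<^sup>2)"
    and "limsup (\<lambda>n. ereal (quartic \<gamma> (v n))) \<ge> ereal (m ^ 4)"
  shows "\<exists>(x :: nat \<Rightarrow> real^2) V r.
           V \<in> H1 \<and> strict_mono r \<and>
           H1_weakly_converges (\<lambda>n y. v (r n) (y + x (r n))) V \<and>
           L2_norm V \<ge> m\<^sup>2 / (M * sqrt (C_opt \<gamma>))"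
proof -
  obtain K where K: "\<And>n. H1_norm (v n) \<le> K" using assms(3) by blast
  have K0: "0 \<le> K" by (rule order_trans[OF _ K[of 0]]) (simp add: H1_norm_def)
  have sq: "(L2_norm (v n))\<^sup>2 + (grad_norm (v n))\<^sup>2 \<le> K\<^sup>2" for n
  proof -
    have "(H1_norm (v n))\<^sup>2 \<le> K\<^sup>2" using K[of n] by (intro power_mono) (auto simp: H1_norm_def)
    then show ?thesis by (simp add: H1_norm_def)
  qed
  have sq1: "(L2_norm (v n))\<^sup>2 \<le> K\<^sup>2" "(grad_norm (v n))\<^sup>2 \<le> K\<^sup>2" for n
    using sq[of n] zero_le_power2[of "L2_norm (v n)"] zero_le_power2[of "grad_norm (v n)"] by linarith+
  have bd: "L2_norm (v n) \<le> K" "grad_norm (v n) \<le> K" for n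
    using sq1[of n] K0 by (auto intro: power2_le_imp_le)
  have q_bd: "quartic \<gamma> (v n) \<le> (1 + \<gamma>) * (32 * (K * K))\<^sup>2" for n
  proof -
    have "L2_norm (abs_sq (v n)) \<le> 32 * (K * K)"
      using bd[of n] K0 by (intro order_trans[OF H1_abs_sq(2)[OF assms(2)]] mult_left_mono mult_mono) auto
    then show ?thesis using assms(1)
      by (intro order_trans[OF quartic_le[OF assms(1,2)]] mult_left_mono power_mono) auto
  qed
  obtain r1 q where r1: "strict_mono r1" "(\<lambda>n. quartic \<gamma> (v (r1 n))) \<longlonglongrightarrow> q" "m ^ 4 \<le> q"
    using limsup_subsequence[OF assms(7) q_bd] by blast
  have "bounded (range (\<lambda>n. ((grad_norm (v (r1 n)))\<^sup>2, (L2_norm (v (r1 n)))\<^sup>2)))"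
  proof (rule boundedI)
    fix p assume "p \<in> range (\<lambda>n. ((grad_norm (v (r1 n)))\<^sup>2, (L2_norm (v (r1 n)))\<^sup>2))"
    then obtain n where p: "p = ((grad_norm (v (r1 n)))\<^sup>2, (L2_norm (v (r1 n)))\<^sup>2)" by blast
    have "norm p \<le> norm ((grad_norm (v (r1 n)))\<^sup>2) + norm ((L2_norm (v (r1 n)))\<^sup>2)" unfolding p by (rule norm_Pair_le)
    also have "\<dots> \<le> K\<^sup>2" using sq[of "r1 n"] by simp
    finally show "norm p \<le> K\<^sup>2" .
  qed
  from bounded_imp_convergent_subsequence[OF this]
  obtain l r2 where r2: "strict_mono r2" "((\<lambda>n. ((grad_norm (v (r1 n)))\<^sup>2, (L2_norm (v (r1 n)))\<^sup>2)) \<circ> r2) \<longlonglongrightarrow> l" by blast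
  define A where "A = fst l"
  define B where "B = snd l"
  define s where "s n = r1 (r2 n)" for n
  have s: "strict_mono s" using strict_mono_o[OF r1(1) r2(1)] by (simp add: s_def[abs_def] o_def)
  have A: "(\<lambda>n. (grad_norm (v (s n)))\<^sup>2) \<longlonglongrightarrow> A" using tendsto_fst[OF r2(2)] by (simp add: o_def s_def A_def)
  have B: "(\<lambda>n. (L2_norm (v (s n)))\<^sup>2) \<longlonglongrightarrow> B" using tendsto_snd[OF r2(2)] by (simp add: o_def s_def B_def)
  have q: "(\<lambda>n. quartic \<gamma> (v (s n))) \<longlonglongrightarrow> q"
    using LIMSEQ_subseq_LIMSEQ[OF r1(2) r2(1)] by (simp add: o_def s_def)
  have "weak_limits (\<lambda>n. v (s n)) \<subseteq> weak_limits v" using weak_limits_subseq[OF s, where z="\<lambda>n. 0" and w=v] by simp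
  then have tr: "tracks \<gamma> v (\<lambda>n. v (s n)) q A B"
    unfolding tracks_def using assms(2) A B q by auto
  have AM: "A \<le> M\<^sup>2"
  proof -
    have "(\<lambda>n. ereal ((grad_norm (v (s n)))\<^sup>2)) \<longlonglongrightarrow> ereal A" using A by simp
    then have "ereal A = limsup ((\<lambda>n. ereal ((grad_norm (v n))\<^sup>2)) \<circ> s)"
      unfolding o_def by (intro lim_imp_Limsup[symmetric]) auto
    also have "\<dots> \<le> limsup (\<lambda>n. ereal ((grad_norm (v n))\<^sup>2))" by (rule limsup_subseq_mono[OF s])
    also have "\<dots> \<le> ereal (M\<^sup>2)" by (rule assms(6))
    finally show ?thesis by simp
  qed
  have q0: "0 < q" using r1(3) assms(4) zero_less_power[of m 4] by linarith
  have "\<forall>\<^sub>F n in sequentially. 0 < quartic \<gamma> (v (s n))" using q q0 by (rule order_tendstoD)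
  then obtain n0 where n0: "0 < quartic \<gamma> (v (s n0))" by (auto simp: eventually_sequentially)
  note C = C_opt_optimal[OF assms(1) assms(2) n0]
  define b where "b = m\<^sup>2 / (M * sqrt (C_opt \<gamma>))"
  have b0: "b > 0" using assms(4,5) C(1) by (simp add: b_def)
  have "C_opt \<gamma> * b\<^sup>2 * M\<^sup>2 = m ^ 4"
    using assms(5) C(1) by (simp add: b_def power_divide power_mult_distrib flip: power_mult)
  moreover have "C_opt \<gamma> * b\<^sup>2 * A \<le> C_opt \<gamma> * b\<^sup>2 * M\<^sup>2" using AM C(1) by (intro mult_left_mono) auto
  ultimately have "C_opt \<gamma> * b\<^sup>2 * A \<le> q" using r1(3) by linarith
  from large_profile[OF assms(1) C b0 q0 this tr]
  obtain V where V: "V \<in> weak_limits v" "b \<le> L2_norm V" by blast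
  then obtain y r where r: "strict_mono r" and weak: "H1_weakly_converges (\<lambda>n. translate (y n) (v (r n))) V"
    by (auto simp: weak_limits_def)
  \<comment> \<open>the translations found are indexed along the subsequence; off its range the value does not matter\<close>
  define x where "x k = y (inv r k)" for k
  have "x (r n) = y n" for n using strict_mono_imp_inj_on[OF r] by (simp add: x_def inv_f_f)
  then have "H1_weakly_converges (\<lambda>n y. v (r n) (y + x (r n))) V" using weak by simp
  moreover have "V \<in> H1" using weak by (simp add: H1_weakly_converges_def)
  ultimately show ?thesis using r V(2) unfolding b_def by blast
qed

end
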